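(* In each of the two cases (L) and (H): let $\Delta\ge 84\,C_\varphi$ and $\kappa\ge1$, and let $\widehat f_w=\sum_{k=1}^{M_n}w_k\widehat f_k$ be the aggregated estimator using either the Bayesian weights $w=\widetilde w$ or the model selection weights $w=\widehat w$. For each $s,L>0$ with $s>1$ there is a finite constant $C_{s,L}$ depending only on the class $\mathcal{D}^s_2(A,L)$ such that for all $n\ge3$ (with $M_n\ge1$) $$\sup_{f\in\mathcal{D}^s_2(A,L)}\mathbb{E}^n_f\|\widehat f_w-f\|_A^2\le C_{s,L}\,n^{-2s/(2s+1)}.$$
   Context: Two cases are considered. Case (L): $A=(0,\infty)$, $\varphi_j=\ell_j$ are the Laguerre functions $\ell_j(x)=\sqrt2\,L_j(2x)e^{-x}\mathbf 1_{(0,\infty)}(x)$, $L_j(x)=\sum_{k=0}^j(-1)^k\binom jk\frac{x^k}{k!}$; $\alpha=-1/2$, $d=1$, $M_n=\lfloor n^2(600\log n)^{-4}\rfloor$. Case (H): $A=\mathbb{R}$, $\varphi_j=h_j$ are the Hermite functions $h_j(x)=(2^jj!\sqrt\pi)^{-1/2}H_j(x)e^{-x^2/2}$, $H_j(x)=(-1)^je^{x^2}\frac{d^j}{dx^j}e^{-x^2}$; $\alpha=2/3$, $d=10/12$, $M_n=n^2$. In each case $(\varphi_j)_{j\ge0}$ is an orthonormal basis of $L^2(A)$ with usual inner product $\langle\cdot,\cdot\rangle_A$ and norm $\|\cdot\|_A$; $\|\cdot\|_\infty$ is the sup norm. $X_1,\dots,X_n$ are i.i.d. with probability density $f\in L^2(A)$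 supported in $A$; $\mathbb{E}_f$, $\mathbb{E}_f^n$ denote expectation under the marginal and joint law. Put $a_j(f)=\langle f,\varphi_j\rangle_A$, $v_f=\mathbb{E}_f(|X_1|^{\alpha})+1$, $\widehat v=1+\frac1n\sum_{i=1}^n|X_i|^\alpha$. For $s,L>0$, $$\mathcal{D}^{s}_{2}(A,L):=\Big\{f\in L^2(A): f\text{ is a probability density},\ \sum_{k\in\mathbb{N}_0}k^s|a_k(f)|^2\le L,\ \mathbb{E}_f(|X_1|^{2\alpha})\le L\Big\}.$$ $C_\varphi\ge1$ is a fixed numerical constant such that for all $k\in\mathbb{N}$ (and all densities $f$): $\|\sum_{j=0}^{k-1}\varphi_j^2\|_\infty\le C_\varphi k^{d}$ and $\sum_{j=0}^{k-1}\mathbb{E}_f(\varphi_j^2(X_1))\le C_\varphi v_fk^{1/2}$. Orthogonal series estimators: $\widehat f_k=\sum_{j=0}^{k-1}\widehat a_j\varphi_j$, $\widehat a_j=\frac1n\sum_{i=1}^n\varphi_j(X_i)$. Penalties: $\widehat{\mathrm{pen}}_k=\Delta\,\widehat v\,k^{1/2}n^{-1}$. Bayesian weights: $$\widetilde w_k=\frac{\exp(-\kappa n\{-\|\widehat f_k\|_A^2+\widehat{\mathrm{pen}}_k\})}{\sum_{l=1}^{M_n}\exp(-\kappa n\{-\|\widehat f_l\|_A^2+\widehat{\mathrm{pen}}_l\})},\quad 1\le k\le M_n.$$ Model selection weights: $\widehat w_k=\mathbf 1\{k=\widehat k\}$, where $\widehat k$ is the smallest minimiser of $k\mapsto-\|\widehat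 f_k\|_A^2+\widehat{\mathrm{pen}}_k$ over $\{1,\dots,M_n\}$. $\Delta$ and $\kappa$ are fixed numerical constants (not depending on $f$, $n$, $s$, $L$). *)

theory Defs
  imports "HOL-Probability.Probability"
begin

definition laguerre_poly :: "nat \<Rightarrow> real \<Rightarrow> real" where
  "laguerre_poly j x = (\<Sum>k=0..j. (-1) ^ k * real (j choose k) * (x ^ k / fact k))"

definition laguerre_fun :: "nat \<Rightarrow> real \<Rightarrow> real" where
  "laguerre_fun j x = sqrt 2 * laguerre_poly j (2 * x) * exp (- x) * indicator {0<..} x"

definition hermite_poly :: "nat \<Rightarrow> real \<Rightarrow> real" where
  "hermite_poly j x = (-1) ^ j * exp (x\<^sup>2) * (deriv ^^ j) (\<lambda>t. exp (- (t\<^sup>2))) x"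

definition hermite_fun :: "nat \<Rightarrow> real \<Rightarrow> real" where
  "hermite_fun j x =
     (2 ^ j * fact j * sqrt pi) powr (- 1 / 2) * hermite_poly j x * exp (- (x\<^sup>2) / 2)"

text \<open>The two cases (L) and (H).\<close>

datatype setting = Laguerre | Hermite

primrec dom_set :: "setting \<Rightarrow> real set" where
  "dom_set Laguerre = {0<..}"
| "dom_set Hermite = UNIV"

primrec basis_fun :: "setting \<Rightarrow> nat \<Rightarrow> real \<Rightarrow> real" where
  "basis_fun Laguerre = laguerre_fun"
| "basis_fun Hermite = hermite_fun"

primrec mom_exp :: "setting \<Rightarrow> real" where
  "mom_exp Laguerre = - 1 / 2"
| "mom_exp Hermite = 2 / 3"

primrec dim_exp :: "setting \<Rightarrow> real" where
  "dim_exp Laguerre = 1"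
| "dim_exp Hermite = 10 / 12"

primrec max_dim :: "setting \<Rightarrow> nat \<Rightarrow> nat" where
  "max_dim Laguerre n = nat \<lfloor>(real n)\<^sup>2 * (600 * ln (real n)) powi (- 4)\<rfloor>"
| "max_dim Hermite n = n\<^sup>2"

definition inner_on :: "real set \<Rightarrow> (real \<Rightarrow> real) \<Rightarrow> (real \<Rightarrow> real) \<Rightarrow> real" where
  "inner_on A g h = (LINT x:A|lborel. g x * h x)"

definition norm_on :: "real set \<Rightarrow> (real \<Rightarrow> real) \<Rightarrow> real" where
  "norm_on A g = sqrt (inner_on A g g)"

definition L2_on :: "real set \<Rightarrow> (real \<Rightarrow> real) set" where
  "L2_on A = {g \<in> borel_measurable borel. set_integrable lborel A (\<lambda>x. (g x)\<^sup>2)}"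

definition sup_norm :: "(real \<Rightarrow> real) \<Rightarrow> ennreal" where
  "sup_norm g = (SUP x. ennreal \<bar>g x\<bar>)"

text \<open>Densities are represented by nonnegative Borel functions vanishing off \<open>A\<close>; every
  almost-everywhere class of probability densities supported in \<open>A\<close> has such a representative.\<close>

definition law :: "(real \<Rightarrow> real) \<Rightarrow> real measure" where
  "law f = density lborel (\<lambda>x. ennreal (f x))"

definition prob_density_on :: "real set \<Rightarrow> (real \<Rightarrow> real) \<Rightarrow> bool" where
  "prob_density_on A f \<longleftrightarrow>
     f \<in> borel_measurable borel \<and> (\<forall>x. 0 \<le> f x) \<and> (\<forall>x. x \<notin> A \<longrightarrow> f x = 0) \<and> prob_space (law f)"

text \<open>\<open>0 powr a = 0\<close> also for negative \<open>a\<close>. This is harmless: the law of a density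
  does not charge \<open>{0}\<close>.\<close>

definition abs_moment :: "(real \<Rightarrow> real) \<Rightarrow> real \<Rightarrow> ennreal" where
  "abs_moment f a = (\<integral>\<^sup>+x. ennreal (\<bar>x\<bar> powr a) \<partial>law f)"

definition basis_coeff :: "setting \<Rightarrow> (real \<Rightarrow> real) \<Rightarrow> nat \<Rightarrow> real" where
  "basis_coeff c f j = inner_on (dom_set c) f (basis_fun c j)"

definition density_class :: "setting \<Rightarrow> real \<Rightarrow> real \<Rightarrow> (real \<Rightarrow> real) set" where
  "density_class c s L =
     {f \<in> L2_on (dom_set c). prob_density_on (dom_set c) f \<and>
        (\<Sum>k. ennreal (real k powr s * \<bar>basis_coeff c f k\<bar>\<^sup>2)) \<le> ennreal L \<and>
        abs_moment f (2 * mom_exp c) \<le> ennreal L}"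

definition basis_bound_const :: "setting \<Rightarrow> real \<Rightarrow> bool" where
  "basis_bound_const c C \<longleftrightarrow> 1 \<le> C \<and>
     (\<forall>k::nat\<ge>1.
        sup_norm (\<lambda>x. \<Sum>j<k. (basis_fun c j x)\<^sup>2) \<le> ennreal (C * real k powr dim_exp c) \<and>
        (\<forall>f. prob_density_on (dom_set c) f \<longrightarrow>
           (\<Sum>j<k. \<integral>\<^sup>+x. ennreal ((basis_fun c j x)\<^sup>2) \<partial>law f)
             \<le> ennreal C * (abs_moment f (mom_exp c) + 1) * ennreal (real k powr (1 / 2))))"

text \<open>A sample \<open>X\<^sub>1, \<dots>, X\<^sub>n\<close> is a function \<open>X\<close> on \<open>{1..n}\<close>; its joint law under \<open>f\<close> is the
  \<open>n\<close>-fold product of \<open>law f\<close>.\<close>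

definition sample_law :: "nat \<Rightarrow> (real \<Rightarrow> real) \<Rightarrow> (nat \<Rightarrow> real) measure" where
  "sample_law n f = (\<Pi>\<^sub>M i\<in>{1..n}. law f)"

definition a_hat :: "setting \<Rightarrow> nat \<Rightarrow> (nat \<Rightarrow> real) \<Rightarrow> nat \<Rightarrow> real" where
  "a_hat c n X j = (1 / real n) * (\<Sum>i=1..n. basis_fun c j (X i))"

definition f_hat :: "setting \<Rightarrow> nat \<Rightarrow> (nat \<Rightarrow> real) \<Rightarrow> nat \<Rightarrow> real \<Rightarrow> real" where
  "f_hat c n X k x = (\<Sum>j<k. a_hat c n X j * basis_fun c j x)"

definition v_hat :: "setting \<Rightarrow> nat \<Rightarrow> (nat \<Rightarrow> real) \<Rightarrow> real" where
  "v_hat c n X = 1 + (1 / real n) * (\<Sum>i=1..n. \<bar>X i\<bar> powr mom_exp c)"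

definition pen_hat :: "setting \<Rightarrow> real \<Rightarrow> nat \<Rightarrow> (nat \<Rightarrow> real) \<Rightarrow> nat \<Rightarrow> real" where
  "pen_hat c \<Delta> n X k = \<Delta> * v_hat c n X * real k powr (1 / 2) / real n"

definition pen_contrast :: "setting \<Rightarrow> real \<Rightarrow> nat \<Rightarrow> (nat \<Rightarrow> real) \<Rightarrow> nat \<Rightarrow> real" where
  "pen_contrast c \<Delta> n X k = - (norm_on (dom_set c) (f_hat c n X k))\<^sup>2 + pen_hat c \<Delta> n X k"

definition bayes_weights ::
    "setting \<Rightarrow> real \<Rightarrow> real \<Rightarrow> nat \<Rightarrow> (nat \<Rightarrow> real) \<Rightarrow> nat \<Rightarrow> real" where
  "bayes_weights c \<Delta> \<kappa> n X k =
     exp (- \<kappa> * real n * pen_contrast c \<Delta> n X k) /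
     (\<Sum>l=1..max_dim c n. exp (- \<kappa> * real n * pen_contrast c \<Delta> n X l))"

definition k_hat :: "setting \<Rightarrow> real \<Rightarrow> nat \<Rightarrow> (nat \<Rightarrow> real) \<Rightarrow> nat" where
  "k_hat c \<Delta> n X = (LEAST k. k \<in> {1..max_dim c n} \<and>
     (\<forall>l\<in>{1..max_dim c n}. pen_contrast c \<Delta> n X k \<le> pen_contrast c \<Delta> n X l))"

definition selection_weights ::
    "setting \<Rightarrow> real \<Rightarrow> nat \<Rightarrow> (nat \<Rightarrow> real) \<Rightarrow> nat \<Rightarrow> real" where
  "selection_weights c \<Delta> n X k = (if k = k_hat c \<Delta> n X then 1 else 0)"

definition f_agg ::
    "setting \<Rightarrow> (nat \<Rightarrow> (nat \<Rightarrow> real) \<Rightarrow> nat \<Rightarrow> real) \<Rightarrow> nat \<Rightarrow> (nat \<Rightarrow> real) \<Rightarrow> real \<Rightarrow> real" where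
  "f_agg c w n X x = (\<Sum>k=1..max_dim c n. w n X k * f_hat c n X k x)"

definition risk ::
    "setting \<Rightarrow> (nat \<Rightarrow> (nat \<Rightarrow> real) \<Rightarrow> nat \<Rightarrow> real) \<Rightarrow> nat \<Rightarrow> (real \<Rightarrow> real) \<Rightarrow> ennreal" where
  "risk c w n f =
     (\<integral>\<^sup>+X. ennreal ((norm_on (dom_set c) (\<lambda>x. f_agg c w n X x - f x))\<^sup>2) \<partial>sample_law n f)"

end

theory Submission
  imports Defs "HOL-Computational_Algebra.Polynomial"
begin

text \<open>
  In coordinates, put \<open>a\<^sub>j = \<langle>f, \<phi>\<^sub>j\<rangle>\<close>, \<open>Z\<^sub>k = \<Sum>\<^sub>j\<^sub><\<^sub>k (\<^bold>a\<^sub>j - a\<^sub>j)\<^sup>2\<close> for the empirical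
  coefficients \<open>\<^bold>a\<^sub>j\<close>, and \<open>r\<^sub>k = \<Sum>\<^sub>j\<^sub>\<ge>\<^sub>k a\<^sub>j\<^sup>2\<close>. Both families of weights satisfy the free energy bound
  \<open>\<Sum>\<^sub>k w\<^sub>k \<gamma>\<^sub>k \<le> \<gamma>\<^sub>l + ln M / n\<close> for every \<open>l\<close>, where \<open>\<gamma>\<close> is the penalised contrast. Convexity of
  the square then reduces the theorem to \<open>4 Z\<^sub>k \<le> pen\<^sub>k + R\<close> for all \<open>k \<le> M\<close>, with a remainder \<open>R\<close> of
  expectation \<open>O(ln n / n)\<close>; the rate is never faster than a power \<open>n powr - \<rho>\<close> with \<open>\<rho> < 1\<close>, so the
  logarithm is harmless.

  No concentration inequality is needed for the remainder. The random variable \<open>Z\<^sub>k\<close> is a diagonal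
  sum plus a degenerate U-statistic. The diagonal is dominated by the empirical penalty for almost
  every sample, because the assumed moment bound on \<open>\<Sum> \<phi>\<^sub>j\<^sup>2\<close> holds for all densities and hence
  pointwise almost everywhere. The U-statistic has standard deviation of order
  \<open>k powr (1/4) / n\<close>, far below the penalty \<open>k powr (1/2) / n\<close>, so its second moment at the
  \<open>O(ln n)\<close> dyadic dimensions suffices. The variance bound uses \<open>f \<le> B\<close> with \<open>B\<close> depending only on the
  class; this is where \<open>s > 1\<close> enters, and it requires that the Laguerre and Hermite functions
  are complete in \<open>L\<^sup>2\<close>.
\<close>

section \<open>Completeness of weighted polynomials\<close>

text \<open>The two assumed bounds on the sum of \<open>\<phi> j\<close> squared over
  \<open>j < k\<close> serve different purposes. The uniform one, of order k, is summed by parts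
  against the weights \<open>j powr - s\<close> and yields f \<le> B. The moment one, of order sqrt
  k, controls the trace of the second moment matrix of the first k basis functions. The obstacle is
  the U-statistic: its variance is governed by the squared Frobenius norm of this matrix, and the
  trace alone bounds that norm only by order k, giving fluctuations as large as the penalty. With f
  \<le> B, Bessel's inequality bounds it by B times the trace, of order sqrt k, and each dyadic
  level then adds only 1/n to the remainder. Completeness is required because neither the bound on f
  nor the decay of the bias follows from the coefficients until f is known to agree with its series.
  The random penalty is used as it stands: the sample average of |X_i|^\<alpha> + 1 is exactly
  \<open>v_hat\<close>, so no event comparing \<open>v_hat\<close> with its mean is
  introduced.\<close>

lemma power_div_fact_le_exp:
  fixes x :: real
  assumes "0 \<le> x"
  shows "x ^ n / fact n \<le> exp x"
proof -
  have "(\<Sum>i\<in>{n}. x ^ i /\<^sub>R fact i) \<le> (\<Sum>i. x ^ i /\<^sub>R fact i)"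
    using assms by (intro sum_le_suminf summable_exp_generic) auto
  then show ?thesis by (simp add: exp_def divide_inverse mult.commute)
qed

lemma sum_power_div_fact_le_exp:
  fixes x :: real
  assumes "0 \<le> x"
  shows "(\<Sum>i<n. x ^ i / fact i) \<le> exp x"
proof -
  have "(\<Sum>i<n. x ^ i /\<^sub>R fact i) \<le> (\<Sum>i. x ^ i /\<^sub>R fact i)"
    using assms by (intro sum_le_suminf summable_exp_generic) auto
  then show ?thesis by (simp add: exp_def divide_inverse mult.commute)
qed

text \<open>Half of the exponential weight absorbs any power: \<open>\<bar>x\<bar> ^ n \<le> fact n
  * (2 / \<delta>) ^ n * exp (\<delta> / 2 * \<bar>x\<bar>)\<close>. The half that is kept dominates
  the expansion of \<open>iexp (h * x)\<close> for
  \<open>\<bar>h\<bar> \<le> \<delta> / 2\<close>.\<close>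

lemma integrable_exp_weight_power:
  fixes u :: "real \<Rightarrow> real"
  assumes [measurable]: "u \<in> borel_measurable borel" and d: "0 < \<delta>"
    and int: "integrable lborel (\<lambda>x. u x * exp (\<delta> * \<bar>x\<bar>))"
  shows "integrable lborel (\<lambda>x. \<bar>u x\<bar> * \<bar>x\<bar> ^ n * exp (\<delta> / 2 * \<bar>x\<bar>))"
proof (rule Bochner_Integration.integrable_bound)
  show "integrable lborel (\<lambda>x. fact n * (2 / \<delta>) ^ n * (u x * exp (\<delta> * \<bar>x\<bar>)))"
    using int by simp
  show "AE x in lborel. norm (\<bar>u x\<bar> * \<bar>x\<bar> ^ n * exp (\<delta> / 2 * \<bar>x\<bar>))
      \<le> norm (fact n * (2 / \<delta>) ^ n * (u x * exp (\<delta> * \<bar>x\<bar>)))"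
  proof (rule AE_I2)
    fix x :: real
    have "(\<delta> / 2 * \<bar>x\<bar>) ^ n \<le> fact n * exp (\<delta> / 2 * \<bar>x\<bar>)"
      using power_div_fact_le_exp[of "\<delta> / 2 * \<bar>x\<bar>" n] d by (simp add: field_simps)
    then have "(2 / \<delta>) ^ n * (\<delta> / 2 * \<bar>x\<bar>) ^ n \<le> (2 / \<delta>) ^ n * (fact n * exp (\<delta> / 2 * \<bar>x\<bar>))"
      using d by (intro mult_left_mono) auto
    moreover have "(2 / \<delta>) ^ n * (\<delta> / 2 * \<bar>x\<bar>) ^ n = \<bar>x\<bar> ^ n"
      using d by (simp flip: power_mult_distrib)
    ultimately have "\<bar>x\<bar> ^ n \<le> fact n * (2 / \<delta>) ^ n * exp (\<delta> / 2 * \<bar>x\<bar>)"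
      by (simp add: mult_ac)
    then have "\<bar>x\<bar> ^ n * (\<bar>u x\<bar> * exp (\<delta> / 2 * \<bar>x\<bar>))
        \<le> fact n * (2 / \<delta>) ^ n * exp (\<delta> / 2 * \<bar>x\<bar>) * (\<bar>u x\<bar> * exp (\<delta> / 2 * \<bar>x\<bar>))"
      by (intro mult_right_mono) auto
    also have "\<dots> = fact n * (2 / \<delta>) ^ n * \<bar>u x\<bar> * exp (\<delta> / 2 * \<bar>x\<bar> + \<delta> / 2 * \<bar>x\<bar>)"
      unfolding exp_add by (simp add: mult_ac)
    finally show "norm (\<bar>u x\<bar> * \<bar>x\<bar> ^ n * exp (\<delta> / 2 * \<bar>x\<bar>))
      \<le> norm (fact n * (2 / \<delta>) ^ n * (u x * exp (\<delta> * \<bar>x\<bar>)))"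
      using d by (simp add: abs_mult mult_ac)
  qed
qed simp

text \<open>Expanding \<open>exp (\<i> h x)\<close> moves the vanishing of all moments along the frequency axis in steps of
  size at most \<open>\<delta> / 2\<close>; this replaces analytic continuation.\<close>

lemma fourier_moments_shift:
  fixes u :: "real \<Rightarrow> real"
  assumes [measurable]: "u \<in> borel_measurable borel" and d: "0 < \<delta>"
    and int: "integrable lborel (\<lambda>x. u x * exp (\<delta> * \<bar>x\<bar>))"
    and zero: "\<And>n. (\<integral>x. complex_of_real (u x * x ^ n) * iexp (t * x) \<partial>lborel) = 0"
    and h: "\<bar>h\<bar> \<le> \<delta> / 2"
  shows "(\<integral>x. complex_of_real (u x * x ^ n) * iexp ((t + h) * x) \<partial>lborel) = 0"
proof -
  \<comment> \<open>The \<open>k\<close>-th term of the expansion of \<open>iexp (h * x)\<close>,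
    based at the frequency \<open>t\<close>. Its integral is a multiple of the moment of order
    \<open>n + k\<close> at \<open>t\<close>, so every term vanishes once sum and integral are
    exchanged.\<close>
  define g where "g k x = complex_of_real (u x * x ^ n) * iexp (t * x) *
    ((\<i> * of_real (h * x)) ^ k /\<^sub>R fact k)" for k x
  have [measurable]: "g k \<in> borel_measurable lborel" for k
    unfolding g_def by measurable
  have norm_g: "norm (g k x) = \<bar>u x\<bar> * \<bar>x\<bar> ^ n * (\<bar>h * x\<bar> ^ k / fact k)" for k x
    by (simp add: g_def norm_mult norm_power abs_mult power_abs divide_inverse mult_ac)
  have dom: "(\<Sum>i<k. norm (g i x)) \<le> \<bar>u x\<bar> * \<bar>x\<bar> ^ n * exp (\<delta> / 2 * \<bar>x\<bar>)" for k x
  proof -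
    have "(\<Sum>i<k. \<bar>h * x\<bar> ^ i / fact i) \<le> exp \<bar>h * x\<bar>"
      by (rule sum_power_div_fact_le_exp) simp
    also have "\<dots> \<le> exp (\<delta> / 2 * \<bar>x\<bar>)"
      using mult_right_mono[OF h, of "\<bar>x\<bar>"] by (simp add: abs_mult)
    finally show ?thesis
      unfolding norm_g sum_distrib_left[symmetric] by (intro mult_left_mono) auto
  qed
  note intw = integrable_exp_weight_power[OF assms(1) d int]
  have int_g: "integrable lborel (g k)" for k
  proof (rule Bochner_Integration.integrable_bound[OF intw[of n]])
    show "AE x in lborel. norm (g k x) \<le> norm (\<bar>u x\<bar> * \<bar>x\<bar> ^ n * exp (\<delta> / 2 * \<bar>x\<bar>))"
    proof (rule AE_I2)
      fix x
      have "norm (g k x) \<le> (\<Sum>i<Suc k. norm (g i x))"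
        by (simp add: sum_nonneg)
      then show "norm (g k x) \<le> norm (\<bar>u x\<bar> * \<bar>x\<bar> ^ n * exp (\<delta> / 2 * \<bar>x\<bar>))"
        using dom[of x "Suc k"] by (simp add: abs_mult)
    qed
  qed simp
  have "(\<integral>x. (\<Sum>k. g k x) \<partial>lborel) = (\<Sum>k. \<integral>x. g k x \<partial>lborel)"
  proof (rule integral_suminf[OF int_g])
    show "AE x in lborel. summable (\<lambda>k. norm (g k x))"
    proof (rule AE_I2, rule bounded_imp_summable)
      fix x k
      show "(\<Sum>i\<le>k. norm (g i x)) \<le> \<bar>u x\<bar> * \<bar>x\<bar> ^ n * exp (\<delta> / 2 * \<bar>x\<bar>)"
        using dom[of x "Suc k"] by (simp only: lessThan_Suc_atMost)
    qed auto
    show "summable (\<lambda>k. \<integral>x. norm (g k x) \<partial>lborel)"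
    proof (rule bounded_imp_summable)
      fix k
      have "(\<Sum>i\<le>k. \<integral>x. norm (g i x) \<partial>lborel) = (\<integral>x. (\<Sum>i<Suc k. norm (g i x)) \<partial>lborel)"
        using int_g by (simp add: lessThan_Suc_atMost del: sum.lessThan_Suc)
      also have "\<dots> \<le> (\<integral>x. \<bar>u x\<bar> * \<bar>x\<bar> ^ n * exp (\<delta> / 2 * \<bar>x\<bar>) \<partial>lborel)"
        by (intro integral_mono dom intw Bochner_Integration.integrable_sum integrable_norm int_g)
      finally show "(\<Sum>i\<le>k. \<integral>x. norm (g i x) \<partial>lborel)
        \<le> (\<integral>x. \<bar>u x\<bar> * \<bar>x\<bar> ^ n * exp (\<delta> / 2 * \<bar>x\<bar>) \<partial>lborel)" .
    qed auto
  qed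
  moreover have "(\<integral>x. g k x \<partial>lborel) = 0" for k
  proof -
    have "g k x = ((\<i> * of_real h) ^ k /\<^sub>R fact k) *
        (complex_of_real (u x * x ^ (n + k)) * iexp (t * x))" for x
      by (simp add: g_def power_mult_distrib power_add mult_ac scaleR_conv_of_real)
    then show ?thesis by (simp only: integral_mult_right_zero zero mult_zero_right)
  qed
  moreover have "(\<Sum>k. g k x) = complex_of_real (u x * x ^ n) * iexp ((t + h) * x)" for x
  proof -
    have "(\<lambda>k. (\<i> * of_real (h * x)) ^ k /\<^sub>R fact k) sums exp (\<i> * of_real (h * x))"
      by (rule exp_converges)
    from sums_mult[OF this, of "complex_of_real (u x * x ^ n) * iexp (t * x)"]
    have "(\<Sum>k. g k x) = complex_of_real (u x * x ^ n) * iexp (t * x) * exp (\<i> * of_real (h * x))"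
      unfolding g_def by (simp add: sums_iff)
    also have "\<dots> = complex_of_real (u x * x ^ n) * (iexp (t * x) * exp (\<i> * of_real (h * x)))"
      by (simp add: mult_ac)
    also have "iexp (t * x) * exp (\<i> * of_real (h * x)) = iexp ((t + h) * x)"
      unfolding exp_add[symmetric] by (simp add: algebra_simps)
    finally show ?thesis .
  qed
  ultimately show ?thesis by simp
qed

text \<open>Repeated shifts make the Fourier transform of \<open>u\<close> vanish everywhere. The
  positive and negative parts then have equal mass and, once normalised, are densities with the same
  characteristic function, so Levy's uniqueness theorem identifies them.\<close>

lemma moment_determinacy:
  fixes u :: "real \<Rightarrow> real"
  assumes m[measurable]: "u \<in> borel_measurable borel" and d: "0 < \<delta>"
    and int: "integrable lborel (\<lambda>x. u x * exp (\<delta> * \<bar>x\<bar>))"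
    and zero: "\<And>n. (\<integral>x. u x * x ^ n \<partial>lborel) = 0"
  shows "AE x in lborel. u x = 0"
proof -
  have zero0: "(\<integral>x. complex_of_real (u x * x ^ n) * iexp (0 * x) \<partial>lborel) = 0" for n
    using zero[of n] by (simp only: mult_zero_left of_real_0 mult_zero_right exp_zero mult_1_right
      integral_complex_of_real)
  have four: "(\<integral>x. complex_of_real (u x) * iexp (t * x) \<partial>lborel) = 0" for t
  proof -
    obtain N :: nat where N: "\<bar>t\<bar> * 2 / \<delta> \<le> real N" using real_arch_simple by blast
    define h where "h = t / real (Suc N)"
    have h: "\<bar>h\<bar> \<le> \<delta> / 2"
    proof -
      have "\<bar>t\<bar> \<le> \<delta> / 2 * real N" using N d by (simp add: field_simps)
      also have "\<dots> \<le> \<delta> / 2 * real (Suc N)" using d by (intro mult_left_mono) auto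
      finally show ?thesis unfolding h_def by (simp add: field_simps)
    qed
    \<comment> \<open>All orders are carried through the induction, since a shift at one order
      consumes the vanishing of every higher moment at the previous frequency.\<close>
    have "(\<integral>x. complex_of_real (u x * x ^ n) * iexp ((real j * h) * x) \<partial>lborel) = 0" for n j
    proof (induction j arbitrary: n)
      case 0
      then show ?case using zero0[of n] by simp
    next
      case (Suc j)
      from fourier_moments_shift[OF m d int Suc h, of n]
      show ?case by (simp add: algebra_simps)
    qed
    from this[of 0 "Suc N"] show ?thesis by (simp add: h_def)
  qed
  have intu: "integrable lborel u"
  proof (rule Bochner_Integration.integrable_bound[OF int])
    show "AE x in lborel. norm (u x) \<le> norm (u x * exp (\<delta> * \<bar>x\<bar>))"
      using d by (auto simp: abs_mult mult_le_cancel_left1)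
  qed simp
  define p where "p x = max 0 (u x)" for x
  define q where "q x = max 0 (- u x)" for x
  have [measurable]: "p \<in> borel_measurable borel" "q \<in> borel_measurable borel"
    unfolding p_def q_def by measurable
  have pq0: "0 \<le> p x" "0 \<le> q x" for x unfolding p_def q_def by auto
  have u: "u x = p x - q x" for x unfolding p_def q_def by auto
  have ip: "integrable lborel p" and iq: "integrable lborel q"
    unfolding p_def q_def using intu by (auto intro!: integrable_max)
  define c where "c = (\<integral>x. p x \<partial>lborel)"
  have cq: "(\<integral>x. q x \<partial>lborel) = c"
    using zero[of 0] ip iq by (simp add: u c_def)
  have c0: "0 \<le> c" unfolding c_def by (simp add: pq0)
  show ?thesis
  proof (cases "c = 0")
    case True
    then have "AE x in lborel. p x = 0" "AE x in lborel. q x = 0"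
      using integral_nonneg_eq_0_iff_AE[OF ip AE_I2[OF pq0(1)]]
        integral_nonneg_eq_0_iff_AE[OF iq AE_I2[OF pq0(2)]] cq by (simp_all add: c_def)
    then show ?thesis by eventually_elim (simp add: u)
  next
    case False
    then have c: "0 < c" using c0 by simp
    define D where "D v = density lborel (\<lambda>x. ennreal (v x / c))" for v :: "real \<Rightarrow> real"
    have rd: "real_distribution (D v)" if "v \<in> borel_measurable borel" "\<And>x. 0 \<le> v x"
      "integrable lborel v" "(\<integral>x. v x \<partial>lborel) = c" for v
    proof -
      have "(\<integral>\<^sup>+x. ennreal (v x / c) \<partial>lborel) = 1"
        using that c by (subst nn_integral_eq_integral) auto
      then have "prob_space (D v)"
        unfolding D_def using that(1)
        by (intro prob_spaceI) (simp add: emeasure_density)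
      then show ?thesis
        by (auto simp: real_distribution_def real_distribution_axioms_def D_def)
    qed
    have ch: "char (D v) t = (\<integral>x. complex_of_real (v x) * iexp (t * x) \<partial>lborel) / c"
      if [measurable]: "v \<in> borel_measurable borel" and v0: "\<And>x. 0 \<le> v x" for v t
    proof -
      have "char (D v) t = (\<integral>x. (v x / c) *\<^sub>R iexp (t * x) \<partial>lborel)"
        unfolding char_def D_def using v0 c by (subst integral_density) auto
      also have "\<dots> = (\<integral>x. complex_of_real (v x) * iexp (t * x) / c \<partial>lborel)"
        by (simp add: scaleR_conv_of_real)
      finally show ?thesis by simp
    qed
    have int_c: "integrable lborel (\<lambda>x. complex_of_real (v x) * iexp (t * x))"
      if [measurable]: "v \<in> borel_measurable borel" and "integrable lborel v" for v t
      by (rule Bochner_Integration.integrable_bound[OF that(2)]) (auto simp: norm_mult)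
    have "char (D p) = char (D q)"
    proof
      fix t
      have "(\<integral>x. complex_of_real (p x) * iexp (t * x) \<partial>lborel)
          - (\<integral>x. complex_of_real (q x) * iexp (t * x) \<partial>lborel) = 0"
        using four[of t] int_c[of p t] int_c[of q t] ip iq
        by (subst Bochner_Integration.integral_diff[symmetric]) (auto simp: u algebra_simps)
      then show "char (D p) t = char (D q) t"
        by (simp add: ch pq0)
    qed
    then have "D p = D q"
      using rd pq0 ip iq cq by (intro Levy_uniqueness rd) (auto simp: c_def)
    then have "AE x in lborel. ennreal (p x / c) = ennreal (q x / c)"
      unfolding D_def by (intro sigma_finite_measure.density_unique[OF sigma_finite_lborel]) auto
    then show ?thesis
      by eventually_elim (use c in \<open>simp add: u pq0\<close>)
  qed
qed

text \<open>With one polynomial in every degree, subtracting a multiple of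
  \<open>p (degree q)\<close> removes the leading term of \<open>q\<close>. This converts
  orthogonality to the basis into vanishing of the plain moments.\<close>

lemma linear_functional_zero_of_graded:
  fixes p :: "nat \<Rightarrow> real poly" and T :: "real poly \<Rightarrow> real"
  assumes deg: "\<And>j. degree (p j) = j" and nz: "\<And>j. p j \<noteq> 0"
    and add: "\<And>a b. T (a + b) = T a + T b" and scale: "\<And>a b. T (smult a b) = a * T b"
    and zero: "\<And>j. T (p j) = 0"
  shows "T q = 0"
proof (induction "degree q" arbitrary: q rule: less_induct)
  case less
  define c where "c = lead_coeff q / lead_coeff (p (degree q))"
  define r where "r = q - smult c (p (degree q))"
  have q: "q = r + smult c (p (degree q))" by (simp add: r_def)
  have "coeff r (degree q) = 0"
    using nz[of "degree q"] deg[of "degree q"] leading_coeff_0_iff[of "p (degree q)"]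
    by (auto simp: r_def c_def)
  moreover have "degree r \<le> degree q"
    unfolding r_def by (intro degree_diff_le) (auto simp: deg intro: order_trans[OF degree_smult_le])
  \<comment> \<open>In degree 0 the remainder is the zero polynomial, whose degree is not smaller;
    hence the second alternative.\<close>
  ultimately have "degree r < degree q \<or> r = 0"
    by (metis le_neq_implies_less leading_coeff_0_iff)
  moreover have "T 0 = 0" using scale[of 0 0] by simp
  ultimately have "T r = 0" using less by auto
  then show ?case by (subst q) (simp add: add scale zero)
qed

lemma integrable_exp_weight_poly:
  fixes u :: "real \<Rightarrow> real"
  assumes [measurable]: "u \<in> borel_measurable borel" and d: "0 < \<delta>"
    and int: "integrable lborel (\<lambda>x. u x * exp (\<delta> * \<bar>x\<bar>))"
  shows "integrable lborel (\<lambda>x. u x * poly q (a * x))"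
proof -
  have "integrable lborel (\<lambda>x. u x * x ^ n)" for n
  proof (rule Bochner_Integration.integrable_bound[OF integrable_exp_weight_power[OF assms, of n]])
    show "AE x in lborel. norm (u x * x ^ n) \<le> norm (\<bar>u x\<bar> * \<bar>x\<bar> ^ n * exp (\<delta> / 2 * \<bar>x\<bar>))"
    proof (rule AE_I2)
      fix x
      have "\<bar>u x\<bar> * \<bar>x\<bar> ^ n * 1 \<le> \<bar>u x\<bar> * \<bar>x\<bar> ^ n * exp (\<delta> / 2 * \<bar>x\<bar>)"
        using d by (intro mult_left_mono) auto
      then show "norm (u x * x ^ n) \<le> norm (\<bar>u x\<bar> * \<bar>x\<bar> ^ n * exp (\<delta> / 2 * \<bar>x\<bar>))"
        by (simp add: abs_mult power_abs)
    qed
  qed simp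
  then have "integrable lborel (\<lambda>x. \<Sum>i\<le>degree q. coeff q i * a ^ i * (u x * x ^ i))"
    by (intro Bochner_Integration.integrable_sum integrable_mult_right)
  then show ?thesis
    by (simp add: poly_altdef sum_distrib_left power_mult_distrib mult_ac)
qed

text \<open>The scale \<open>a\<close> accommodates Laguerre polynomials evaluated at
  \<open>2 * x\<close>; in the moments it contributes only a factor \<open>a ^ n\<close>.\<close>

lemma graded_polynomials_complete:
  fixes u :: "real \<Rightarrow> real" and p :: "nat \<Rightarrow> real poly"
  assumes m: "u \<in> borel_measurable borel" and d: "0 < \<delta>" and a: "a \<noteq> 0"
    and int: "integrable lborel (\<lambda>x. u x * exp (\<delta> * \<bar>x\<bar>))"
    and deg: "\<And>j. degree (p j) = j" and nz: "\<And>j. p j \<noteq> 0"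
    and zero: "\<And>j. (\<integral>x. u x * poly (p j) (a * x) \<partial>lborel) = 0"
  shows "AE x in lborel. u x = 0"
proof (rule moment_determinacy[OF m d int])
  fix n
  define T where "T q = (\<integral>x. u x * poly q (a * x) \<partial>lborel)" for q
  note intp = integrable_exp_weight_poly[OF m d int, of _ a]
  have "T (monom 1 n) = 0"
  proof (rule linear_functional_zero_of_graded[OF deg nz])
    show "T (b + c) = T b + T c" for b c
      unfolding T_def by (simp add: distrib_left intp)
    show "T (smult r b) = r * T b" for r b
      unfolding T_def by (subst integral_mult_right_zero[symmetric]) (simp add: mult_ac)
  qed (simp add: T_def zero)
  also have "T (monom 1 n) = a ^ n * (\<integral>x. u x * x ^ n \<partial>lborel)"
    unfolding T_def by (subst integral_mult_right_zero[symmetric])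
      (simp add: poly_monom power_mult_distrib mult_ac)
  finally show "(\<integral>x. u x * x ^ n \<partial>lborel) = 0" using a by simp
qed

section \<open>Laguerre functions\<close>

text \<open>Pascal's rule and summation by parts. Up to sign, the left side is the forward
  difference of order \<open>Suc j\<close> of \<open>g\<close> at 0, and the right side is the
  difference of order \<open>j\<close> of the first difference.\<close>

lemma alternating_sum_Suc:
  fixes g :: "nat \<Rightarrow> real"
  shows "(\<Sum>k\<le>Suc j. (-1) ^ k * real (Suc j choose k) * g k)
    = (\<Sum>k\<le>j. (-1) ^ k * real (j choose k) * (g k - g (Suc k)))"
proof -
  have "(\<Sum>k\<le>j. (-1) ^ k * real (j choose k) * g k)
      = (\<Sum>k\<le>Suc j. (-1) ^ k * real (j choose k) * g k)" by simp
  also have "\<dots> = g 0 + (\<Sum>k\<le>j. (-1) ^ Suc k * real (j choose Suc k) * g (Suc k))"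
    by (subst sum.atMost_Suc_shift) simp
  finally have *: "(\<Sum>k\<le>j. (-1) ^ k * real (j choose k) * g k)
    = g 0 + (\<Sum>k\<le>j. (-1) ^ Suc k * real (j choose Suc k) * g (Suc k))" .
  have "(\<Sum>k\<le>Suc j. (-1) ^ k * real (Suc j choose k) * g k)
      = g 0 + (\<Sum>k\<le>j. (-1) ^ Suc k * real (Suc j choose Suc k) * g (Suc k))"
    by (subst sum.atMost_Suc_shift) simp
  also have "\<dots> = g 0 + (\<Sum>k\<le>j. (-1) ^ Suc k * real (j choose Suc k) * g (Suc k))
      - (\<Sum>k\<le>j. (-1) ^ k * real (j choose k) * g (Suc k))"
    by (simp add: sum.distrib[symmetric] sum_subtractf[symmetric] algebra_simps sum_negf[symmetric])
  finally show ?thesis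
    unfolding right_diff_distrib sum_subtractf * by simp
qed

text \<open>Each difference in the upper entry lowers the lower entry by one, so \<open>j\<close>
  differences leave \<open>a choose (m - j)\<close>, and nothing when \<open>j > m\<close>.\<close>

lemma alternating_sum_binomial:
  "(\<Sum>k\<le>j. (-1) ^ k * real (j choose k) * real ((a + k) choose m))
    = (if j \<le> m then (-1) ^ j * real (a choose (m - j)) else 0)"
proof (induction j arbitrary: a m)
  case (Suc j)
  show ?case
  proof (cases m)
    case 0
    then show ?thesis unfolding alternating_sum_Suc by simp
  next
    case (Suc m')
    have "(\<Sum>k\<le>Suc j. (-1) ^ k * real (Suc j choose k) * real ((a + k) choose m))
      = - (\<Sum>k\<le>j. (-1) ^ k * real (j choose k) * real ((a + k) choose m'))"
      unfolding alternating_sum_Suc Suc by (simp add: sum_negf[symmetric])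
    then show ?thesis using Suc.IH[of a m'] Suc by simp
  qed
qed simp

lemma has_integral_gamma_monomial:
  "has_bochner_integral lborel (\<lambda>x. (2 * x) ^ n * exp (- 2 * x) * indicator {0<..} x) (fact n / 2 :: real)"
proof -
  have "has_bochner_integral lborel (\<lambda>x. x ^ n * exp (- x) * indicator {0..} x) (fact n :: real)"
    using nn_intergal_power_times_exp_Ici[of n]
    by (intro has_bochner_integral_nn_integral)
       (auto simp: nn_integral_set_ennreal split: split_indicator)
  then have "has_bochner_integral lborel (\<lambda>x. x ^ n * exp (- x) * indicator {0<..} x) (fact n :: real)"
    using AE_lborel_singleton[of "0::real"]
    by (subst has_bochner_integral_cong_AE[where g="\<lambda>x. x ^ n * exp (- x) * indicator {0..} x"])
       (auto elim!: eventually_mono split: split_indicator)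
  then have "has_bochner_integral lborel
      (\<lambda>x. (0 + 2 * x) ^ n * exp (- (0 + 2 * x)) * indicator {0<..} (0 + 2 * x)) (fact n /\<^sub>R \<bar>2\<bar> :: real)"
    by (subst lborel_has_bochner_integral_real_affine_iff[where c=2 and t=0, symmetric]) auto
  moreover have "indicator {0<..} (0 + 2 * x) = (indicator {0<..} x :: real)" for x :: real
    by (auto split: split_indicator)
  ultimately show ?thesis by simp
qed

text \<open>Since \<open>fact (k + m) / fact k = fact m * ((m + k) choose m)\<close>, termwise
  integration leaves an alternating binomial sum. The factor \<open>m choose j\<close> vanishes for
  \<open>m < j\<close>: this is the orthogonality to lower degrees.\<close>

lemma has_integral_laguerre_monomial:
  "has_bochner_integral lborel
     (\<lambda>x. laguerre_poly j (2 * x) * (2 * x) ^ m * exp (- 2 * x) * indicator {0<..} x)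
     (fact m * ((-1) ^ j * real (m choose j)) / 2)"
proof -
  have "has_bochner_integral lborel
     (\<lambda>x. \<Sum>k\<le>j. ((-1) ^ k * real (j choose k) / fact k) *
        ((2 * x) ^ (k + m) * exp (- 2 * x) * indicator {0<..} x))
     (\<Sum>k\<le>j. ((-1) ^ k * real (j choose k) / fact k) * (fact (k + m) / 2))"
    by (intro has_bochner_integral_sum has_bochner_integral_mult_right has_integral_gamma_monomial)
  moreover have "(\<Sum>k\<le>j. ((-1) ^ k * real (j choose k) / fact k) *
        ((2 * x) ^ (k + m) * exp (- 2 * x) * indicator {0<..} x))
      = laguerre_poly j (2 * x) * (2 * x) ^ m * exp (- 2 * x) * indicator {0<..} x" for x
    unfolding laguerre_poly_def sum_distrib_right
    by (rule sum.cong) (auto simp: atMost_atLeast0 power_add mult_ac)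
  moreover have "(\<Sum>k\<le>j. ((-1) ^ k * real (j choose k) / fact k) * (fact (k + m) / 2))
      = fact m * ((-1) ^ j * real (m choose j)) / 2"
  proof -
    have "(fact (k + m) :: real) / fact k = fact m * real ((m + k) choose m)" for k
      by (subst binomial_fact) (auto simp: add.commute)
    then have "(\<Sum>k\<le>j. ((-1) ^ k * real (j choose k) / fact k) * (fact (k + m) / 2))
      = fact m / 2 * (\<Sum>k\<le>j. (-1) ^ k * real (j choose k) * real ((m + k) choose m))"
      unfolding sum_distrib_left by (intro sum.cong) (auto simp: field_simps)
    also have "\<dots> = fact m * ((-1) ^ j * real (m choose j)) / 2"
      unfolding alternating_sum_binomial by (auto simp: binomial_symmetric[symmetric])
    finally show ?thesis .
  qed
  ultimately show ?thesis by (simp only:)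
qed

lemma laguerre_fun_borel[measurable]: "laguerre_fun j \<in> borel_measurable borel"
  unfolding laguerre_fun_def laguerre_poly_def by measurable

text \<open>Only the factor of smaller index is expanded into monomials. Those of degree below
  \<open>j\<close> integrate to zero, so a contribution, equal to one, remains only for
  \<open>m = j = k\<close>.\<close>

lemma laguerre_orthonormal_le:
  assumes "k \<le> j"
  shows "has_bochner_integral lborel (\<lambda>x. laguerre_fun j x * laguerre_fun k x) (if j = k then 1 else 0)"
proof -
  have "has_bochner_integral lborel
     (\<lambda>x. \<Sum>m\<le>k. (2 * ((-1) ^ m * real (k choose m) / fact m)) *
        (laguerre_poly j (2 * x) * (2 * x) ^ m * exp (- 2 * x) * indicator {0<..} x))
     (\<Sum>m\<le>k. (2 * ((-1) ^ m * real (k choose m) / fact m)) * (fact m * ((-1) ^ j * real (m choose j)) / 2))"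
    by (intro has_bochner_integral_sum has_bochner_integral_mult_right has_integral_laguerre_monomial)
  moreover have "(\<Sum>m\<le>k. (2 * ((-1) ^ m * real (k choose m) / fact m)) *
        (laguerre_poly j (2 * x) * (2 * x) ^ m * exp (- 2 * x) * indicator {0<..} x))
      = laguerre_fun j x * laguerre_fun k x" for x
  proof -
    have "(\<Sum>m\<le>k. (2 * ((-1) ^ m * real (k choose m) / fact m)) *
        (laguerre_poly j (2 * x) * (2 * x) ^ m * exp (- 2 * x) * indicator {0<..} x))
      = 2 * (laguerre_poly j (2 * x) * laguerre_poly k (2 * x)) * exp (- x + - x) * indicator {0<..} x"
      by (simp add: laguerre_poly_def[of k] sum_distrib_right sum_distrib_left mult_ac atMost_atLeast0)
    then show ?thesis
      unfolding exp_add laguerre_fun_def by (auto split: split_indicator)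
  qed
  moreover have "(\<Sum>m\<le>k. (2 * ((-1) ^ m * real (k choose m) / fact m)) *
      (fact m * ((-1) ^ j * real (m choose j)) / 2)) = (if j = k then 1 else 0)"
  proof (cases "j = k")
    case True
    have "(\<Sum>m\<le>k. (2 * ((-1) ^ m * real (k choose m) / fact m)) *
        (fact m * ((-1) ^ j * real (m choose j)) / 2)) = (\<Sum>m\<le>k. if m = k then 1 else 0)"
      using True by (intro sum.cong) (auto simp: binomial_eq_0 power_mult_distrib[symmetric])
    then show ?thesis using True by simp
  next
    case False
    then show ?thesis using assms by (auto intro!: sum.neutral simp: binomial_eq_0)
  qed
  ultimately show ?thesis by simp
qed

lemma laguerre_orthonormal:
  "has_bochner_integral lborel (\<lambda>x. laguerre_fun j x * laguerre_fun k x) (if j = k then 1 else 0)"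
  using laguerre_orthonormal_le[of k j] laguerre_orthonormal_le[of j k]
  by (cases "k \<le> j") (auto simp: mult.commute)

text \<open>Up to \<open>sqrt 2\<close>, the basis function tests \<open>h x * exp (- x)\<close>
  against a polynomial in \<open>2 * x\<close>. Adding the weight
  \<open>exp (\<bar>x\<bar> / 2)\<close> leaves \<open>exp (- x / 2)\<close>, square integrable on
  the half-line; the support condition removes the side where \<open>exp (- x)\<close>
  grows.\<close>

lemma laguerre_complete:
  assumes [measurable]: "h \<in> borel_measurable borel"
    and int: "integrable lborel (\<lambda>x. (h x)\<^sup>2)" and supp: "\<And>x. x \<le> 0 \<Longrightarrow> h x = 0"
    and zero: "\<And>j. (\<integral>x. h x * laguerre_fun j x \<partial>lborel) = 0"
  shows "AE x in lborel. h x = 0"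
proof -
  define p where "p j = (\<Sum>k\<le>j. monom ((-1) ^ k * real (j choose k) / fact k) k)" for j
  have cp: "coeff (p j) i = (if i \<le> j then (-1) ^ i * real (j choose i) / fact i else 0)" for i j
    unfolding p_def by (auto simp: coeff_sum coeff_monom)
  have poly_p: "poly (p j) x = laguerre_poly j x" for j x
    by (simp add: p_def poly_sum poly_monom laguerre_poly_def atMost_atLeast0)
  have "AE x in lborel. h x * exp (- x) = 0"
  proof (rule graded_polynomials_complete[where p=p and \<delta>="1/2" and a=2])
    show "degree (p j) = j" for j
    proof (rule antisym)
      show "degree (p j) \<le> j" by (intro degree_le) (auto simp: cp)
      show "j \<le> degree (p j)" by (intro le_degree) (auto simp: cp)
    qed
    have "coeff (p j) j \<noteq> 0" for j by (simp add: cp)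
    then show "p j \<noteq> 0" for j by (metis coeff_0)
    show "integrable lborel (\<lambda>x. h x * exp (- x) * exp (1 / 2 * \<bar>x\<bar>))"
    proof (rule Bochner_Integration.integrable_bound)
      have "integrable lborel (\<lambda>x. (2 * (x / 2)) ^ 0 * exp (- 2 * (x / 2)) * indicator {0<..} (x / 2) :: real)"
        using lborel_integrable_real_affine[OF conjunct1[OF iffD1[OF has_bochner_integral_iff has_integral_gamma_monomial[of 0]]], of "1/2" 0]
        by simp
      then show "integrable lborel (\<lambda>x. (h x)\<^sup>2 + exp (- x) * indicator {0<..} (x/2))"
        using int by simp
      show "AE x in lborel. norm (h x * exp (- x) * exp (1 / 2 * \<bar>x\<bar>))
          \<le> norm ((h x)\<^sup>2 + exp (- x) * indicator {0<..} (x/2))"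
      proof (rule AE_I2)
        fix x :: real
        show "norm (h x * exp (- x) * exp (1 / 2 * \<bar>x\<bar>))
          \<le> norm ((h x)\<^sup>2 + exp (- x) * indicator {0<..} (x/2))"
        proof (cases "0 < x")
          case True
          have "exp (- x) * exp (1 / 2 * \<bar>x\<bar>) = exp (- x / 2)"
            using True unfolding exp_add[symmetric] by simp
          moreover have "exp (- x) = (exp (- x / 2))\<^sup>2"
            unfolding power2_eq_square exp_add[symmetric] by simp
          moreover have "\<bar>h x\<bar> * exp (- x / 2) \<le> (h x)\<^sup>2 + (exp (- x / 2))\<^sup>2"
          proof -
            have "0 \<le> \<bar>h x\<bar> * exp (- x / 2)" by simp
            then show ?thesis
              using sum_squares_bound[of "\<bar>h x\<bar>" "exp (- x / 2)"] unfolding power2_abs by linarith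
          qed
          ultimately show ?thesis using True by (simp add: abs_mult mult.assoc)
        qed (simp add: supp)
      qed
    qed simp
    show "(\<integral>x. h x * exp (- x) * poly (p j) (2 * x) \<partial>lborel) = 0" for j
    proof -
      have "h x * laguerre_fun j x = sqrt 2 * (h x * exp (- x) * poly (p j) (2 * x))" for x
        using supp[of x] by (cases "0 < x") (auto simp: laguerre_fun_def poly_p mult_ac)
      then show ?thesis using zero[of j] by (simp only: integral_mult_right_zero) simp
    qed
  qed auto
  then show ?thesis by simp
qed

section \<open>Hermite functions\<close>

text \<open>The Rodrigues formula read as a recursion: differentiating
  \<open>poly P x * exp (- (x\<^sup>2))\<close> and changing sign turns \<open>P\<close> into
  \<open>2 * x * P - P'\<close>. The type \<open>real poly\<close> gives access to degrees and
  iterated derivatives.\<close>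

primrec herm :: "nat \<Rightarrow> real poly" where
  "herm 0 = 1"
| "herm (Suc j) = [:0, 2:] * herm j - pderiv (herm j)"

lemma deriv_funpow_gaussian:
  "(deriv ^^ j) (\<lambda>t. exp (- (t\<^sup>2))) = (\<lambda>x. (-1) ^ j * poly (herm j) x * exp (- (x\<^sup>2)))"
proof (induction j)
  case (Suc j)
  have "((\<lambda>x. (-1) ^ j * poly (herm j) x * exp (- (x\<^sup>2))) has_real_derivative
      (-1) ^ Suc j * poly (herm (Suc j)) x * exp (- (x\<^sup>2))) (at x)" for x
    by (auto intro!: derivative_eq_intros simp: algebra_simps)
  then show ?case using Suc by (auto simp: DERIV_imp_deriv)
qed simp

lemma hermite_poly_eq: "hermite_poly j x = poly (herm j) x"
proof -
  have "hermite_poly j x = ((-1) ^ j * (-1) ^ j) * poly (herm j) x * (exp (x\<^sup>2) * exp (- (x\<^sup>2)))"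
    unfolding hermite_poly_def deriv_funpow_gaussian by (simp only: mult_ac)
  also have "(-1) ^ j * (-1) ^ j = (1::real)" by (simp flip: power_mult_distrib)
  also have "exp (x\<^sup>2) * exp (- (x\<^sup>2)) = 1" by (simp flip: exp_add)
  finally show ?thesis by simp
qed

lemma herm_deg_coeff: "degree (herm j) \<le> j \<and> coeff (herm j) j = 2 ^ j"
proof (induction j)
  case (Suc j)
  then have d: "degree (pderiv (herm j)) \<le> j" by (auto simp: degree_pderiv)
  then have "coeff (pderiv (herm j)) (Suc j) = 0" by (intro coeff_eq_0) simp
  then show ?case using Suc d
    by (auto intro!: degree_diff_le order_trans[OF degree_mult_le] order_trans[OF degree_pCons_le] simp: coeff_pCons)
qed simp

lemma degree_herm: "degree (herm j) = j"
  using herm_deg_coeff[of j] le_degree[of "herm j" j] by simp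

lemma integrable_gaussian: "integrable lborel (\<lambda>x::real. exp (- (x\<^sup>2) / 2))"
proof -
  have "integrable lborel (\<lambda>x. sqrt (2 * pi) * std_normal_density x)"
    by (intro integrable_mult_right) simp
  then show ?thesis by (simp add: std_normal_density_def)
qed

lemma integrable_poly_gaussian:
  "integrable lborel (\<lambda>x::real. poly q x * exp (- (x\<^sup>2)))"
proof -
  have "integrable lborel (\<lambda>x. exp (- (x\<^sup>2)) * exp (1 * \<bar>x\<bar>) :: real)"
  proof (rule Bochner_Integration.integrable_bound)
    show "integrable lborel (\<lambda>x::real. exp (1/2) * exp (- (x\<^sup>2) / 2))"
      by (intro integrable_mult_right integrable_gaussian)
    show "AE x in lborel. norm (exp (- (x\<^sup>2)) * exp (1 * \<bar>x\<bar>)) \<le> norm (exp (1/2) * exp (- (x\<^sup>2) / 2) :: real)"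
    proof (rule AE_I2)
      fix x :: real
      have "0 \<le> (\<bar>x\<bar> - 1)\<^sup>2" by simp
      then have "- (x\<^sup>2) + \<bar>x\<bar> \<le> 1 / 2 + - (x\<^sup>2) / 2" by (simp add: power2_diff)
      then show "norm (exp (- (x\<^sup>2)) * exp (1 * \<bar>x\<bar>)) \<le> norm (exp (1/2) * exp (- (x\<^sup>2) / 2) :: real)"
        by (simp flip: exp_add)
    qed
  qed simp
  from integrable_exp_weight_poly[OF _ _ this, of q 1] show ?thesis by (simp add: mult.commute)
qed

text \<open>These limits are the boundary values in the integration by parts below.\<close>

lemma poly_gaussian_tendsto_0: "((\<lambda>x::real. poly q x * exp (- (x\<^sup>2))) \<longlongrightarrow> 0) at_infinity"
proof -
  have "((\<lambda>x::real. exp (- norm x)) \<longlongrightarrow> 0) at_infinity"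
    by (intro filterlim_compose[OF exp_at_bot] filterlim_compose[OF filterlim_uminus_at_bot_at_top]
        filterlim_norm_at_top)
  then have lim: "((\<lambda>x::real. fact n * exp 1 * exp (- norm x)) \<longlongrightarrow> 0) at_infinity" for n
    by (intro tendsto_mult_right_zero)
  have "((\<lambda>x::real. x ^ n * exp (- (x\<^sup>2))) \<longlongrightarrow> 0) at_infinity" for n
  proof (rule Lim_null_comparison[OF _ lim[of n]], rule always_eventually, rule allI)
    fix x :: real
    have "\<bar>x\<bar> ^ n \<le> fact n * exp \<bar>x\<bar>"
      using power_div_fact_le_exp[of "\<bar>x\<bar>" n] by (simp add: field_simps)
    then have "norm (x ^ n * exp (- (x\<^sup>2))) \<le> fact n * exp \<bar>x\<bar> * exp (- (x\<^sup>2))"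
      by (simp add: abs_mult power_abs)
    also have "\<dots> = fact n * exp (\<bar>x\<bar> - x\<^sup>2)" by (simp flip: exp_add)
    also have "\<dots> \<le> fact n * exp (1 - \<bar>x\<bar>)"
    proof -
      have "0 \<le> (\<bar>x\<bar> - 1)\<^sup>2" by simp
      then have "\<bar>x\<bar> - x\<^sup>2 \<le> 1 - \<bar>x\<bar>" by (simp add: power2_diff)
      then show ?thesis by simp
    qed
    also have "\<dots> = fact n * exp 1 * exp (- norm x)" by (simp add: exp_diff exp_minus field_simps)
    finally show "norm (x ^ n * exp (- (x\<^sup>2))) \<le> fact n * exp 1 * exp (- norm x)" .
  qed
  then have "((\<lambda>x. \<Sum>i\<le>degree q. coeff q i * (x ^ i * exp (- (x\<^sup>2)))) \<longlongrightarrow> 0) at_infinity"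
    by (intro tendsto_null_sum tendsto_mult_right_zero)
  then show ?thesis by (simp only: poly_altdef sum_distrib_right mult.assoc)
qed

lemma integral_derivative_poly_gaussian:
  fixes q :: "real poly"
  shows "(\<integral>x. (poly (pderiv q) x - 2 * x * poly q x) * exp (- (x\<^sup>2)) \<partial>lborel) = 0"
proof -
  let ?F = "\<lambda>x::real. poly q x * exp (- (x\<^sup>2))"
  let ?f = "\<lambda>x::real. (poly (pderiv q) x - 2 * x * poly q x) * exp (- (x\<^sup>2))"
  have f: "?f = (\<lambda>x. poly (pderiv q - [:0, 2:] * q) x * exp (- (x\<^sup>2)))"
    by (auto simp: algebra_simps)
  have "(LBINT x=-\<infinity>..\<infinity>. ?f x) = 0 - 0"
  proof (rule interval_integral_FTC_integrable[where F = ?F])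
    show "(?F has_vector_derivative ?f x) (at x)" for x
      unfolding has_real_derivative_iff_has_vector_derivative[symmetric]
      by (auto intro!: derivative_eq_intros simp: algebra_simps)
    show "isCont ?f x" for x by (intro continuous_intros)
    show "set_integrable lborel (einterval (-\<infinity>) \<infinity>) ?f"
      using integrable_poly_gaussian[of "pderiv q - [:0, 2:] * q"] unfolding f
      by (simp add: set_integrable_def del: poly_diff poly_mult)
    show "((?F \<circ> real_of_ereal) \<longlongrightarrow> 0) (at_right (-\<infinity>))"
      by (simp add: ereal_tendsto_simps filterlim_mono[OF poly_gaussian_tendsto_0 order_refl at_bot_le_at_infinity])
    show "((?F \<circ> real_of_ereal) \<longlongrightarrow> 0) (at_left \<infinity>)"
      by (simp add: ereal_tendsto_simps filterlim_mono[OF poly_gaussian_tendsto_0 order_refl at_top_le_at_infinity])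
  qed simp
  then show ?thesis
    by (simp add: interval_lebesgue_integral_def set_lebesgue_integral_def)
qed

text \<open>Integration by parts: \<open>herm (Suc j)\<close> times the Gaussian is minus the
  derivative of \<open>herm j\<close> times the Gaussian, so one derivative moves to
  \<open>q\<close>.\<close>

lemma integral_herm_Suc:
  "(\<integral>x. poly (herm (Suc j) * q) x * exp (- (x\<^sup>2)) \<partial>lborel)
    = (\<integral>x. poly (herm j * pderiv q) x * exp (- (x\<^sup>2)) \<partial>lborel)"
proof -
  have "(\<integral>x. poly (herm j * pderiv q) x * exp (- (x\<^sup>2)) - poly (herm (Suc j) * q) x * exp (- (x\<^sup>2)) \<partial>lborel) = 0"
    using integral_derivative_poly_gaussian[of "herm j * q"]
    by (simp add: pderiv_mult algebra_simps)
  then show ?thesis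
    unfolding Bochner_Integration.integral_diff[OF integrable_poly_gaussian integrable_poly_gaussian] by linarith
qed

lemma integral_herm:
  "(\<integral>x. poly (herm j * q) x * exp (- (x\<^sup>2)) \<partial>lborel)
    = (\<integral>x. poly ((pderiv ^^ j) q) x * exp (- (x\<^sup>2)) \<partial>lborel)"
proof (induction j arbitrary: q)
  case (Suc j)
  show ?case unfolding integral_herm_Suc Suc.IH by (simp add: funpow_Suc_right del: funpow.simps)
qed simp

lemma integral_gaussian: "(\<integral>x. exp (- (x\<^sup>2)) \<partial>lborel) = sqrt pi"
proof -
  have "has_bochner_integral lborel (\<lambda>x::real. exp (- x\<^sup>2)) (2 *\<^sub>R (sqrt pi / 2))"
    by (rule has_bochner_integral_even_function[OF gaussian_moment_0]) auto
  then show ?thesis by (simp add: has_bochner_integral_integral_eq)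
qed

lemma hermite_fun_borel[measurable]: "hermite_fun j \<in> borel_measurable borel"
proof (rule borel_measurable_continuous_onI)
  show "continuous_on UNIV (hermite_fun j)"
    by (subst continuous_on_cong[OF refl, where g="\<lambda>x. (2 ^ j * fact j * sqrt pi) powr (- 1 / 2) *
        poly (herm j) x * exp (- (x\<^sup>2) / 2)"])
      (auto simp: hermite_fun_def hermite_poly_eq intro!: continuous_intros)
qed

text \<open>After \<open>j\<close> integrations by parts only the \<open>j\<close>-th derivative of
  \<open>herm k\<close> remains under the Gaussian. It is zero for \<open>k < j\<close> and the
  constant \<open>fact j * 2 ^ j\<close> for \<open>k = j\<close>, which together with
  \<open>sqrt pi\<close> cancels the normalisation.\<close>

lemma hermite_orthonormal_le:
  assumes "k \<le> j"
  shows "has_bochner_integral lborel (\<lambda>x. hermite_fun j x * hermite_fun k x) (if j = k then 1 else 0)"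
proof -
  let ?c = "\<lambda>j. (2 ^ j * fact j * sqrt pi) powr (- 1 / 2) :: real"
  have eq: "hermite_fun j x * hermite_fun k x = ?c j * ?c k * (poly (herm j * herm k) x * exp (- (x\<^sup>2)))" for x
  proof -
    have "exp (- (x\<^sup>2)) = exp (- (x\<^sup>2) / 2) * exp (- (x\<^sup>2) / 2)" by (simp flip: exp_add)
    then show ?thesis by (simp add: hermite_fun_def hermite_poly_eq mult_ac)
  qed
  have "(pderiv ^^ j) (herm k) = (if j = k then [:fact j * 2 ^ j:] else 0)"
  proof (rule poly_eqI)
    fix n
    show "coeff ((pderiv ^^ j) (herm k)) n = coeff (if j = k then [:fact j * 2 ^ j:] else 0) n"
      using assms degree_herm[of k] herm_deg_coeff[of k]
      by (cases n) (auto simp: coeff_higher_pderiv coeff_eq_0 pochhammer_fact)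
  qed
  then have "(\<integral>x. poly (herm j * herm k) x * exp (- (x\<^sup>2)) \<partial>lborel)
      = (if j = k then fact j * 2 ^ j * sqrt pi else 0)"
    unfolding integral_herm by (simp add: integral_gaussian)
  moreover have "?c j * ?c j * (fact j * 2 ^ j * sqrt pi) = 1"
  proof -
    have "?c j * ?c j = (2 ^ j * fact j * sqrt pi) powr (- 1)" by (simp flip: powr_add)
    also have "\<dots> = 1 / (2 ^ j * fact j * sqrt pi)" by (simp add: powr_minus_divide)
    finally show ?thesis by simp
  qed
  ultimately have "(\<integral>x. hermite_fun j x * hermite_fun k x \<partial>lborel) = (if j = k then 1 else 0)"
    unfolding eq by (auto simp del: poly_mult)
  moreover have "integrable lborel (\<lambda>x. hermite_fun j x * hermite_fun k x)"
    unfolding eq by (intro integrable_mult_right integrable_poly_gaussian)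
  ultimately show ?thesis by (simp add: has_bochner_integral_iff)
qed

lemma hermite_orthonormal:
  "has_bochner_integral lborel (\<lambda>x. hermite_fun j x * hermite_fun k x) (if j = k then 1 else 0)"
  using hermite_orthonormal_le[of k j] hermite_orthonormal_le[of j k]
  by (cases "k \<le> j") (auto simp: mult.commute)

text \<open>Half of the Gaussian survives the exponential weight: completing the square gives
  \<open>- (x\<^sup>2) + \<bar>x\<bar> \<le> 1 / 2 - x\<^sup>2 / 2\<close>, so \<open>h\<close> is
  paired with a square integrable function.\<close>

lemma hermite_complete:
  assumes [measurable]: "h \<in> borel_measurable borel"
    and int: "integrable lborel (\<lambda>x. (h x)\<^sup>2)"
    and zero: "\<And>j. (\<integral>x. h x * hermite_fun j x \<partial>lborel) = 0"
  shows "AE x in lborel. h x = 0"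
proof -
  have "AE x in lborel. h x * exp (- (x\<^sup>2) / 2) = 0"
  proof (rule graded_polynomials_complete[where p=herm and \<delta>="1/2" and a=1])
    show "herm j \<noteq> 0" for j using herm_deg_coeff[of j] by auto
    show "integrable lborel (\<lambda>x. h x * exp (- (x\<^sup>2) / 2) * exp (1 / 2 * \<bar>x\<bar>))"
    proof (rule Bochner_Integration.integrable_bound)
      show "integrable lborel (\<lambda>x. (h x)\<^sup>2 + exp (1/2) * exp (- (x\<^sup>2) / 2))"
        using int integrable_gaussian by simp
      show "AE x in lborel. norm (h x * exp (- (x\<^sup>2) / 2) * exp (1 / 2 * \<bar>x\<bar>))
          \<le> norm ((h x)\<^sup>2 + exp (1/2) * exp (- (x\<^sup>2) / 2))"
      proof (rule AE_I2)
        fix x :: real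
        let ?e = "exp (- (x\<^sup>2) / 2 + 1 / 2 * \<bar>x\<bar>)"
        have "\<bar>h x\<bar> * ?e \<le> (h x)\<^sup>2 + ?e\<^sup>2"
          proof -
          have "0 \<le> \<bar>h x\<bar> * ?e" by simp
          then show ?thesis
            using sum_squares_bound[of "\<bar>h x\<bar>" ?e] unfolding power2_abs by linarith
        qed
        also have "?e\<^sup>2 \<le> exp (1/2) * exp (- (x\<^sup>2) / 2)"
        proof -
          have "0 \<le> (\<bar>x\<bar> - 1)\<^sup>2" by simp
          then have "- (x\<^sup>2) + \<bar>x\<bar> \<le> 1 / 2 + - (x\<^sup>2) / 2" by (simp add: power2_diff)
          moreover have "?e\<^sup>2 = exp (- (x\<^sup>2) + \<bar>x\<bar>)"
            unfolding power2_eq_square by (simp flip: exp_add add: field_simps)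
          ultimately show ?thesis by (simp flip: exp_add)
        qed
        finally have "\<bar>h x\<bar> * ?e \<le> (h x)\<^sup>2 + exp (1/2) * exp (- (x\<^sup>2) / 2)" by simp
        moreover have "norm (h x * exp (- (x\<^sup>2) / 2) * exp (1 / 2 * \<bar>x\<bar>)) = \<bar>h x\<bar> * ?e"
          unfolding exp_add by (simp add: abs_mult)
        ultimately show "norm (h x * exp (- (x\<^sup>2) / 2) * exp (1 / 2 * \<bar>x\<bar>))
          \<le> norm ((h x)\<^sup>2 + exp (1/2) * exp (- (x\<^sup>2) / 2))"
          by simp
      qed
    qed simp
    show "(\<integral>x. h x * exp (- (x\<^sup>2) / 2) * poly (herm j) (1 * x) \<partial>lborel) = 0" for j
    proof -
      have "h x * hermite_fun j x = (2 ^ j * fact j * sqrt pi) powr (- 1 / 2) *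
          (h x * exp (- (x\<^sup>2) / 2) * poly (herm j) (1 * x))" for x
        by (simp add: hermite_fun_def hermite_poly_eq mult_ac)
      then show ?thesis using zero[of j] by (simp only: integral_mult_right_zero) simp
    qed
  qed (auto simp: degree_herm)
  then show ?thesis by simp
qed

section \<open>Orthonormal expansions of densities of smoothness above one\<close>

lemma integrable_mult_square_integrable:
  fixes u v :: "'a \<Rightarrow> real"
  assumes [measurable]: "u \<in> borel_measurable M" "v \<in> borel_measurable M"
    and "integrable M (\<lambda>x. (u x)\<^sup>2)" "integrable M (\<lambda>x. (v x)\<^sup>2)"
  shows "integrable M (\<lambda>x. u x * v x)"
proof (rule Bochner_Integration.integrable_bound)
  show "integrable M (\<lambda>x. (u x)\<^sup>2 + (v x)\<^sup>2)" using assms by simp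
  show "AE x in M. norm (u x * v x) \<le> norm ((u x)\<^sup>2 + (v x)\<^sup>2)"
  proof (rule AE_I2)
    fix x
    have "2 * (\<bar>u x\<bar> * \<bar>v x\<bar>) \<le> (u x)\<^sup>2 + (v x)\<^sup>2" "0 \<le> \<bar>u x\<bar> * \<bar>v x\<bar>"
      using sum_squares_bound[of "\<bar>u x\<bar>" "\<bar>v x\<bar>"] by auto
    then show "norm (u x * v x) \<le> norm ((u x)\<^sup>2 + (v x)\<^sup>2)"
      unfolding real_norm_def abs_mult by linarith
  qed
qed simp

lemma integrable_square_add:
  fixes u v :: "'a \<Rightarrow> real"
  assumes [measurable]: "u \<in> borel_measurable M" "v \<in> borel_measurable M"
    and "integrable M (\<lambda>x. (u x)\<^sup>2)" "integrable M (\<lambda>x. (v x)\<^sup>2)"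
  shows "integrable M (\<lambda>x. (u x + v x)\<^sup>2)"
  using assms integrable_mult_square_integrable[OF assms] by (simp add: power2_sum mult.assoc)

text \<open>Fatou delivers integrability of the limit together with the bound. The hypotheses are
  asked only from \<open>N\<close> on because partial sums of order \<open>m\<close> are later
  compared with a fixed one of order \<open>k\<close>, hence only for
  \<open>m \<ge> k\<close>.\<close>

lemma fatou_integral_le:
  fixes u :: "nat \<Rightarrow> 'a \<Rightarrow> real"
  assumes [measurable]: "\<And>m. u m \<in> borel_measurable M"
    and nonneg: "\<And>m x. 0 \<le> u m x" and lim: "\<And>x. (\<lambda>m. u m x) \<longlonglongrightarrow> v x"
    and int: "\<And>m. m \<ge> N \<Longrightarrow> integrable M (u m)" and le: "\<And>m. m \<ge> N \<Longrightarrow> (\<integral>x. u m x \<partial>M) \<le> K"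
  shows "integrable M v" "(\<integral>x. v x \<partial>M) \<le> K"
proof -
  have [measurable]: "v \<in> borel_measurable M"
    by (rule borel_measurable_LIMSEQ_real[OF lim]) auto
  have v0: "0 \<le> v x" for x
    by (rule LIMSEQ_le_const[OF lim]) (auto simp: nonneg)
  have K: "0 \<le> K" 
  proof -
    have "0 \<le> (\<integral>x. u N x \<partial>M)" by (simp add: nonneg)
    then show ?thesis using le[of N] by simp
  qed
  have "(\<integral>\<^sup>+x. ennreal (v x) \<partial>M) = (\<integral>\<^sup>+x. liminf (\<lambda>m. ennreal (u m x)) \<partial>M)"
  proof (rule nn_integral_cong)
    fix x
    have "(\<lambda>m. ennreal (u m x)) \<longlonglongrightarrow> ennreal (v x)" by (intro tendsto_ennrealI lim)
    then show "ennreal (v x) = liminf (\<lambda>m. ennreal (u m x))"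
      by (simp add: lim_imp_Liminf)
  qed
  also have "\<dots> \<le> liminf (\<lambda>m. \<integral>\<^sup>+x. ennreal (u m x) \<partial>M)"
    by (rule nn_integral_liminf) simp
  also have "\<dots> \<le> liminf (\<lambda>m. ennreal K)"
  proof (rule Liminf_mono)
    show "\<forall>\<^sub>F m in sequentially. (\<integral>\<^sup>+x. ennreal (u m x) \<partial>M) \<le> ennreal K"
      using eventually_ge_at_top[of N]
    proof eventually_elim
      case (elim m)
      then show ?case
        using int[of m] le[of m] by (subst nn_integral_eq_integral) (auto simp: nonneg intro: ennreal_leI)
    qed
  qed
  also have "\<dots> = ennreal K" by (simp add: Liminf_const)
  finally have *: "(\<integral>\<^sup>+x. ennreal (v x) \<partial>M) \<le> ennreal K" .
  then show i: "integrable M v"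
    by (intro integrableI_nonneg) (auto simp: v0 intro: le_less_trans)
  show "(\<integral>x. v x \<partial>M) \<le> K"
    using * K by (subst (asm) nn_integral_eq_integral[OF i]) (auto simp: v0)
qed

text \<open>Abel summation: a single \<open>g j\<close> may exceed \<open>C\<close>, only the
  partial sums are controlled. The induction keeps \<open>w n\<close> times the accumulated slack as
  a lower bound; the slack is nonnegative, so lowering its weight is harmless.\<close>

lemma sum_decreasing_weights_le:
  fixes w g :: "nat \<Rightarrow> real"
  assumes dec: "decseq w" and w0: "\<And>j. 0 \<le> w j" and g: "\<And>k. (\<Sum>j<k. g j) \<le> C * real k"
  shows "(\<Sum>j<N. w j * g j) \<le> C * (\<Sum>j<N. w j)"
proof -
  have H: "0 \<le> (\<Sum>j<k. C - g j)" for k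
    using g[of k] by (simp add: sum_subtractf mult.commute)
  have "w n * (\<Sum>j<Suc n. C - g j) \<le> (\<Sum>j<Suc n. w j * (C - g j))" for n
  proof (induction n)
    case (Suc n)
    have "w (Suc n) * (\<Sum>j<Suc n. C - g j) \<le> w n * (\<Sum>j<Suc n. C - g j)"
      using dec by (intro mult_right_mono H) (simp add: decseq_Suc_iff)
    then show ?case
      unfolding sum.lessThan_Suc[of _ "Suc n"] distrib_left using Suc by linarith
  qed simp
  then have "0 \<le> (\<Sum>j<N. w j * (C - g j))"
    using order_trans[OF mult_nonneg_nonneg[OF w0 H]] by (cases N) (auto simp del: sum.lessThan_Suc)
  then show ?thesis
    by (simp add: right_diff_distrib sum_subtractf sum_distrib_left mult.commute)
qed

section \<open>Finite orthonormal expansions: projection distance and Bessel's inequality\<close>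

locale orthonormal_system =
  fixes A :: "real set" and \<phi> :: "nat \<Rightarrow> real \<Rightarrow> real"
  assumes phi_borel[measurable]: "\<And>j. \<phi> j \<in> borel_measurable borel"
    and phi_supp: "\<And>j x. x \<notin> A \<Longrightarrow> \<phi> j x = 0"
    and orthonormal: "\<And>j k. has_bochner_integral lborel (\<lambda>x. \<phi> j x * \<phi> k x) (if j = k then 1 else 0)"
    and complete: "\<And>h. h \<in> borel_measurable borel \<Longrightarrow> integrable lborel (\<lambda>x. (h x)\<^sup>2) \<Longrightarrow>
      (\<And>x. x \<notin> A \<Longrightarrow> h x = 0) \<Longrightarrow> (\<And>j. (\<integral>x. h x * \<phi> j x \<partial>lborel) = 0) \<Longrightarrow> AE x in lborel. h x = 0"
begin

definition coef :: "(real \<Rightarrow> real) \<Rightarrow> nat \<Rightarrow> real" where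
  "coef u j = (\<integral>x. u x * \<phi> j x \<partial>lborel)"

text \<open>The squared distance from \<open>u\<close> to the span of the first \<open>M\<close>
  functions, in the form given by Pythagoras. Identifying it with the tail of squared coefficients
  takes completeness.\<close>

definition resid :: "(real \<Rightarrow> real) \<Rightarrow> nat \<Rightarrow> real" where
  "resid u M = (\<integral>x. (u x)\<^sup>2 \<partial>lborel) - (\<Sum>j<M. (coef u j)\<^sup>2)"

lemma integrable_phi_sq: "integrable lborel (\<lambda>x. (\<phi> j x)\<^sup>2)"
  and integral_phi_sq: "(\<integral>x. (\<phi> j x)\<^sup>2 \<partial>lborel) = 1"
  using orthonormal[of j j] by (simp_all add: power2_eq_square has_bochner_integral_iff)

context
  fixes u :: "real \<Rightarrow> real"
  assumes u[measurable]: "u \<in> borel_measurable borel" and usq: "integrable lborel (\<lambda>x. (u x)\<^sup>2)"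
begin

lemma integrable_mult_phi: "integrable lborel (\<lambda>x. u x * \<phi> j x)"
  by (rule integrable_mult_square_integrable) (auto simp: usq integrable_phi_sq)

lemma integral_expansion_diff_mult_phi:
  "integrable lborel (\<lambda>x. ((\<Sum>j<M. c j * \<phi> j x) - u x) * \<phi> k x)"
  "(\<integral>x. ((\<Sum>j<M. c j * \<phi> j x) - u x) * \<phi> k x \<partial>lborel) = (if k < M then c k else 0) - coef u k"
proof -
  have "has_bochner_integral lborel (\<lambda>x. (\<Sum>j<M. c j * (\<phi> j x * \<phi> k x)) - u x * \<phi> k x)
      ((\<Sum>j<M. c j * (if j = k then 1 else 0)) - coef u k)"
    by (intro has_bochner_integral_diff has_bochner_integral_sum has_bochner_integral_mult_right orthonormal)
      (auto simp: coef_def has_bochner_integral_iff integrable_mult_phi)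
  moreover have "(\<Sum>j<M. c j * (if j = k then 1 else 0)) = (if k < M then c k else 0)"
    by (simp add: mult.commute[of "c _"] if_distrib[of "\<lambda>x. x * _"] sum.delta cong: if_cong)
  moreover have "(\<Sum>j<M. c j * (\<phi> j x * \<phi> k x)) - u x * \<phi> k x = ((\<Sum>j<M. c j * \<phi> j x) - u x) * \<phi> k x" for x
    by (simp add: left_diff_distrib sum_distrib_right mult.assoc)
  ultimately have "has_bochner_integral lborel (\<lambda>x. ((\<Sum>j<M. c j * \<phi> j x) - u x) * \<phi> k x)
    ((if k < M then c k else 0) - coef u k)" by simp
  then show "integrable lborel (\<lambda>x. ((\<Sum>j<M. c j * \<phi> j x) - u x) * \<phi> k x)"
    "(\<integral>x. ((\<Sum>j<M. c j * \<phi> j x) - u x) * \<phi> k x \<partial>lborel) = (if k < M then c k else 0) - coef u k"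
    by (simp_all add: has_bochner_integral_iff)
qed

text \<open>One function is added at a time; the cross term is \<open>- coef u M\<close>, because
  the earlier functions are orthogonal to \<open>\<phi> M\<close>. Arbitrary coefficients
  \<open>c\<close> let the identity serve projections, estimators and, with \<open>u = 0\<close>,
  finite sums.\<close>

lemma square_distance:
  "integrable lborel (\<lambda>x. ((\<Sum>j<M. c j * \<phi> j x) - u x)\<^sup>2)"
  "(\<integral>x. ((\<Sum>j<M. c j * \<phi> j x) - u x)\<^sup>2 \<partial>lborel) = (\<Sum>j<M. (c j - coef u j)\<^sup>2) + resid u M"
proof -
  have "has_bochner_integral lborel (\<lambda>x. ((\<Sum>j<M. c j * \<phi> j x) - u x)\<^sup>2)
      ((\<Sum>j<M. (c j - coef u j)\<^sup>2) + resid u M)"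
  proof (induction M)
    case 0
    then show ?case by (simp add: has_bochner_integral_iff usq resid_def)
  next
    case (Suc M)
    let ?g = "\<lambda>x. (\<Sum>j<M. c j * \<phi> j x) - u x"
    have "has_bochner_integral lborel (\<lambda>x. (?g x)\<^sup>2 + (2 * c M * (?g x * \<phi> M x) + (c M)\<^sup>2 * (\<phi> M x)\<^sup>2))
        (((\<Sum>j<M. (c j - coef u j)\<^sup>2) + resid u M) + (2 * c M * (- coef u M) + (c M)\<^sup>2 * 1))"
      by (intro has_bochner_integral_add has_bochner_integral_mult_right Suc.IH)
        (auto simp: has_bochner_integral_iff integral_expansion_diff_mult_phi integrable_phi_sq integral_phi_sq)
    moreover have "(?g x)\<^sup>2 + (2 * c M * (?g x * \<phi> M x) + (c M)\<^sup>2 * (\<phi> M x)\<^sup>2)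
        = ((\<Sum>j<Suc M. c j * \<phi> j x) - u x)\<^sup>2" for x
      by (simp add: power2_eq_square algebra_simps)
    moreover have "((\<Sum>j<M. (c j - coef u j)\<^sup>2) + resid u M) + (2 * c M * (- coef u M) + (c M)\<^sup>2 * 1)
        = (\<Sum>j<Suc M. (c j - coef u j)\<^sup>2) + resid u (Suc M)"
      by (simp add: resid_def power2_diff)
    ultimately show ?case by (simp only:)
  qed
  then show "integrable lborel (\<lambda>x. ((\<Sum>j<M. c j * \<phi> j x) - u x)\<^sup>2)"
    "(\<integral>x. ((\<Sum>j<M. c j * \<phi> j x) - u x)\<^sup>2 \<partial>lborel) = (\<Sum>j<M. (c j - coef u j)\<^sup>2) + resid u M"
    by (simp_all add: has_bochner_integral_iff)
qed

lemma resid_nonneg: "0 \<le> resid u M"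
proof -
  have "0 \<le> (\<integral>x. ((\<Sum>j<M. coef u j * \<phi> j x) - u x)\<^sup>2 \<partial>lborel)" by simp
  then show ?thesis by (simp add: square_distance(2)[where c="coef u"])
qed

lemma bessel: "(\<Sum>j<M. (coef u j)\<^sup>2) \<le> (\<integral>x. (u x)\<^sup>2 \<partial>lborel)"
  using resid_nonneg[of M] by (simp add: resid_def)

lemma coef_sq_le: "(coef u j)\<^sup>2 \<le> (\<integral>x. (u x)\<^sup>2 \<partial>lborel)"
  using bessel[of "Suc j"] sum_nonneg[of "{..<j}" "\<lambda>j. (coef u j)\<^sup>2"] by simp

end

end

text \<open>The facts about density and basis that the analysis uses, detached from the two cases.
  All functions live on the line and vanish off \<open>A\<close>, so \<open>lborel\<close> integrals
  are the inner products over \<open>A\<close>.\<close>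

locale sobolev_density = orthonormal_system +
  fixes f :: "real \<Rightarrow> real" and s L C \<alpha> :: real
  assumes f_borel[measurable]: "f \<in> borel_measurable borel" and f_nonneg: "\<And>x. 0 \<le> f x"
    and f_supp: "\<And>x. x \<notin> A \<Longrightarrow> f x = 0"
    and f_int: "has_bochner_integral lborel f 1" and f_sq: "integrable lborel (\<lambda>x. (f x)\<^sup>2)"
    and smooth: "\<And>N. (\<Sum>j<N. real j powr s * (coef f j)\<^sup>2) \<le> L"
    and phi_sq_le: "\<And>k x. (\<Sum>j<k. (\<phi> j x)\<^sup>2) \<le> C * real k"
    and phi_sq_le_moment: "AE x in lborel. x \<in> A \<longrightarrow>
      (\<forall>k. (\<Sum>j<k. (\<phi> j x)\<^sup>2) \<le> C * (\<bar>x\<bar> powr \<alpha> + 1) * sqrt (real k))"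
    and moment: "(\<integral>\<^sup>+x. ennreal (\<bar>x\<bar> powr (2 * \<alpha>)) * ennreal (f x) \<partial>lborel) \<le> ennreal L"
    and s: "1 < s" and C: "1 \<le> C" and L: "0 < L"
begin

lemma phi_bounded: "\<bar>\<phi> j x\<bar> \<le> sqrt (C * real (Suc j))"
proof -
  have "(\<phi> j x)\<^sup>2 \<le> (\<Sum>j<Suc j. (\<phi> j x)\<^sup>2)" by (simp add: sum_nonneg)
  also have "\<dots> \<le> C * real (Suc j)" by (rule phi_sq_le)
  finally show ?thesis by (simp add: real_le_rsqrt)
qed

text \<open>The smoothness sum has weight \<open>0 powr s = 0\<close> at index 0 and says nothing
  about this coefficient. It is bounded through \<open>\<bar>\<phi> 0 x\<bar> \<le> sqrt C\<close>
  and the unit mass of \<open>f\<close>.\<close>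

lemma coef_0_sq_le: "(coef f 0)\<^sup>2 \<le> C"
proof -
  have "\<bar>coef f 0\<bar> \<le> (\<integral>x. \<bar>f x * \<phi> 0 x\<bar> \<partial>lborel)"
    unfolding coef_def by (rule integral_abs_bound)
  also have "\<dots> \<le> (\<integral>x. f x * sqrt C \<partial>lborel)"
    using f_int phi_bounded[of 0]
    by (intro integral_mono integrable_abs integrable_mult_phi f_borel f_sq)
      (auto simp: abs_mult f_nonneg has_bochner_integral_iff intro!: mult_left_mono)
  also have "\<dots> = sqrt C" using f_int by (simp add: has_bochner_integral_iff)
  finally have "\<bar>coef f 0\<bar>\<^sup>2 \<le> (sqrt C)\<^sup>2" by (intro power_mono) auto
  then show ?thesis using C by simp
qed

text \<open>Index 0 is treated as 1, which keeps the weights positive and decreasing, as summation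
  by parts requires.\<close>

definition wt :: "nat \<Rightarrow> real" where "wt j = real (max 1 j) powr - s"

text \<open>Half of two bounds: \<open>C + L\<close> for the sum of
  \<open>(coef f j)\<^sup>2 / wt j\<close>, and the rest for the sum of
  \<open>wt j * (\<phi> j x)\<^sup>2\<close>.\<close>

definition B :: real where "B = (C + L + C * (\<Sum>j. wt j)) / 2"

lemma wt_pos: "0 < wt j" by (simp add: wt_def)

lemma wt_dec: "decseq wt"
  unfolding decseq_def wt_def using s by (auto intro!: powr_mono2')

lemma wt_summable: "summable wt"
proof -
  have "summable (\<lambda>j. real (Suc j) powr - s)"
    using s summable_real_powr_iff[of "- s"] by (subst summable_Suc_iff) simp
  then have "summable (\<lambda>j. wt (Suc j))" by (simp add: wt_def)
  then show ?thesis by (subst (asm) summable_Suc_iff)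
qed

text \<open>The inequality of arithmetic and geometric means, with weight \<open>wt j\<close>,
  separates coefficients from functions. Summation by parts turns the linearly growing uniform bound
  into \<open>C\<close> times the sum of the weights, finite because \<open>s > 1\<close>.\<close>

lemma sum_abs_le_B: "(\<Sum>j<N. \<bar>coef f j * \<phi> j x\<bar>) \<le> B"
proof -
  have "\<bar>coef f j * \<phi> j x\<bar> \<le> ((coef f j)\<^sup>2 / wt j + wt j * (\<phi> j x)\<^sup>2) / 2" for j
  proof -
    have "0 \<le> (\<bar>coef f j\<bar> - wt j * \<bar>\<phi> j x\<bar>)\<^sup>2 / wt j" using wt_pos[of j] by simp
    also have "\<dots> = (coef f j)\<^sup>2 / wt j + wt j * (\<phi> j x)\<^sup>2 - 2 * \<bar>coef f j * \<phi> j x\<bar>"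
      using wt_pos[of j] by (simp add: power2_eq_square field_simps abs_mult)
    finally show ?thesis by simp
  qed
  then have "(\<Sum>j<N. \<bar>coef f j * \<phi> j x\<bar>) \<le> (\<Sum>j<N. ((coef f j)\<^sup>2 / wt j + wt j * (\<phi> j x)\<^sup>2) / 2)"
    by (intro sum_mono)
  also have "\<dots> = ((\<Sum>j<N. (coef f j)\<^sup>2 / wt j) + (\<Sum>j<N. wt j * (\<phi> j x)\<^sup>2)) / 2"
    by (simp add: sum_divide_distrib sum.distrib add_divide_distrib)
  also have "(\<Sum>j<N. wt j * (\<phi> j x)\<^sup>2) \<le> C * (\<Sum>j<N. wt j)"
    using phi_sq_le wt_pos by (intro sum_decreasing_weights_le wt_dec) (auto intro: less_imp_le)
  also have "(\<Sum>j<N. wt j) \<le> (\<Sum>j. wt j)"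
    using wt_pos by (intro sum_le_suminf wt_summable) (auto intro: less_imp_le)
  also have "(\<Sum>j<N. (coef f j)\<^sup>2 / wt j) \<le> (\<Sum>j<N. (if j = 0 then (coef f 0)\<^sup>2 else 0) + real j powr s * (coef f j)\<^sup>2)"
  proof (rule sum_mono)
    fix j
    show "(coef f j)\<^sup>2 / wt j \<le> (if j = 0 then (coef f 0)\<^sup>2 else 0) + real j powr s * (coef f j)\<^sup>2"
      by (cases "j = 0") (auto simp: wt_def powr_minus max_def divide_inverse mult.commute)
  qed
  also have "\<dots> = (\<Sum>j<N. (if j = 0 then (coef f 0)\<^sup>2 else 0)) + (\<Sum>j<N. real j powr s * (coef f j)\<^sup>2)"
    by (rule sum.distrib)
  also have "\<dots> \<le> C + L"
    using coef_0_sq_le C by (intro add_mono smooth) (auto simp: sum.delta')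
  finally show ?thesis unfolding B_def using C by (simp add: divide_right_mono)
qed

lemma B_nonneg: "0 \<le> B" using sum_abs_le_B[where N=0] by simp

lemma tail_sum_le:
  assumes "1 \<le> k"
  shows "(\<Sum>j=k..<m. (coef f j)\<^sup>2) \<le> L * real k powr - s"
proof -
  have "(\<Sum>j=k..<m. (coef f j)\<^sup>2) \<le> (\<Sum>j=k..<m. real k powr - s * (real j powr s * (coef f j)\<^sup>2))"
  proof (rule sum_mono)
    fix j assume j: "j \<in> {k..<m}"
    have "1 = real k powr - s * real k powr s" using assms by (simp flip: powr_add)
    also have "\<dots> \<le> real k powr - s * real j powr s"
      using j s by (intro mult_left_mono powr_mono2) auto
    finally have "1 * (coef f j)\<^sup>2 \<le> (real k powr - s * real j powr s) * (coef f j)\<^sup>2"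
      by (intro mult_right_mono) auto
    then show "(coef f j)\<^sup>2 \<le> real k powr - s * (real j powr s * (coef f j)\<^sup>2)" by (simp add: mult.assoc)
  qed
  also have "\<dots> = real k powr - s * (\<Sum>j=k..<m. real j powr s * (coef f j)\<^sup>2)"
    by (simp add: sum_distrib_left)
  also have "\<dots> \<le> real k powr - s * L"
    by (intro mult_left_mono order_trans[OF sum_mono2 smooth[of m]]) auto
  finally show ?thesis by (simp add: mult.commute)
qed

section \<open>The pointwise orthonormal series and its agreement with the density\<close>

definition series :: "real \<Rightarrow> real" where "series x = (\<Sum>j. coef f j * \<phi> j x)"

lemma series_sums: "(\<lambda>m. \<Sum>j<m. coef f j * \<phi> j x) \<longlonglongrightarrow> series x"
proof -
  have "summable (\<lambda>j. \<bar>coef f j * \<phi> j x\<bar>)"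
  proof (rule bounded_imp_summable)
    show "(\<Sum>j\<le>n. \<bar>coef f j * \<phi> j x\<bar>) \<le> B" for n
      using sum_abs_le_B[where N="Suc n" and x=x] by (simp only: lessThan_Suc_atMost)
  qed simp
  then have "summable (\<lambda>j. coef f j * \<phi> j x)" by (rule summable_rabs_cancel)
  then show ?thesis unfolding series_def by (rule summable_LIMSEQ)
qed

lemma series_borel[measurable]: "series \<in> borel_measurable borel"
  by (rule borel_measurable_LIMSEQ_real[OF series_sums]) auto

lemma square_distance_partial:
  assumes "k \<le> m"
  shows "integrable lborel (\<lambda>x. ((\<Sum>j<m. coef f j * \<phi> j x) - (\<Sum>j<k. coef f j * \<phi> j x))\<^sup>2)"
    "(\<integral>x. ((\<Sum>j<m. coef f j * \<phi> j x) - (\<Sum>j<k. coef f j * \<phi> j x))\<^sup>2 \<partial>lborel) = (\<Sum>j=k..<m. (coef f j)\<^sup>2)"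
proof -
  \<comment> \<open>Coefficients are zeroed below \<open>k\<close> and the target is the zero
    function, so that the general distance identity applies.\<close>
  let ?c = "\<lambda>j. if k \<le> j then coef f j else 0"
  have eq: "(\<Sum>j<m. coef f j * \<phi> j x) - (\<Sum>j<k. coef f j * \<phi> j x) = (\<Sum>j<m. ?c j * \<phi> j x) - (\<lambda>_. 0) x" for x
  proof -
    have "(\<Sum>j<m. coef f j * \<phi> j x) - (\<Sum>j<k. coef f j * \<phi> j x) = (\<Sum>j=k..<m. coef f j * \<phi> j x)"
      using assms by (simp add: lessThan_atLeast0 sum_diff_nat_ivl)
    also have "\<dots> = (\<Sum>j<m. ?c j * \<phi> j x)"
      by (rule sum.mono_neutral_cong_left) auto
    finally show ?thesis by simp
  qed
  show "integrable lborel (\<lambda>x. ((\<Sum>j<m. coef f j * \<phi> j x) - (\<Sum>j<k. coef f j * \<phi> j x))\<^sup>2)"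
    unfolding eq by (rule square_distance) auto
  have "(\<Sum>j<m. (?c j)\<^sup>2) = (\<Sum>j=k..<m. (coef f j)\<^sup>2)"
    by (rule sum.mono_neutral_cong_right) auto
  then show "(\<integral>x. ((\<Sum>j<m. coef f j * \<phi> j x) - (\<Sum>j<k. coef f j * \<phi> j x))\<^sup>2 \<partial>lborel) = (\<Sum>j=k..<m. (coef f j)\<^sup>2)"
    unfolding eq by (subst square_distance(2)) (auto simp: resid_def coef_def)
qed

text \<open>The finite tails are bounded uniformly in \<open>m\<close>; pointwise convergence of the
  partial sums lets Fatou carry the bound to the series.\<close>

lemma series_distance:
  assumes "1 \<le> k"
  shows "integrable lborel (\<lambda>x. (series x - (\<Sum>j<k. coef f j * \<phi> j x))\<^sup>2)"
    "(\<integral>x. (series x - (\<Sum>j<k. coef f j * \<phi> j x))\<^sup>2 \<partial>lborel) \<le> L * real k powr - s"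
proof -
  have lim: "(\<lambda>m. ((\<Sum>j<m. coef f j * \<phi> j x) - (\<Sum>j<k. coef f j * \<phi> j x))\<^sup>2)
      \<longlonglongrightarrow> (series x - (\<Sum>j<k. coef f j * \<phi> j x))\<^sup>2" for x
    by (intro tendsto_intros series_sums)
  show "integrable lborel (\<lambda>x. (series x - (\<Sum>j<k. coef f j * \<phi> j x))\<^sup>2)"
    by (rule fatou_integral_le(1)[OF _ _ lim square_distance_partial(1)])
      (use square_distance_partial(2) tail_sum_le[OF assms] in auto)
  show "(\<integral>x. (series x - (\<Sum>j<k. coef f j * \<phi> j x))\<^sup>2 \<partial>lborel) \<le> L * real k powr - s"
    by (rule fatou_integral_le(2)[OF _ _ lim square_distance_partial(1)])
      (use square_distance_partial(2) tail_sum_le[OF assms] in auto)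
qed

lemma series_square_integrable: "integrable lborel (\<lambda>x. (series x)\<^sup>2)"
proof -
  let ?p = "\<lambda>x. \<Sum>j<1. coef f j * \<phi> j x"
  have "integrable lborel (\<lambda>x. ((series x - ?p x) + ?p x)\<^sup>2)"
    using series_distance(1)[of 1] square_distance(1)[of "\<lambda>_. 0" "coef f" 1]
    by (intro integrable_square_add) auto
  then show ?thesis by simp
qed

text \<open>A squared coefficient of a difference is at most its squared norm, and the distance from
  \<open>series\<close> to its partial sums tends to 0. For \<open>m > j\<close> the partial sum
  already has coefficient \<open>coef f j\<close>.\<close>

lemma coef_series: "coef series j = coef f j"
proof -
  have "(coef series j - coef f j)\<^sup>2 \<le> L * real m powr - s" if m: "j < m" for m
  proof -
    let ?v = "\<lambda>x. (\<Sum>j<m. coef f j * \<phi> j x) - series x"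
    have "(coef ?v j)\<^sup>2 \<le> (\<integral>x. (?v x)\<^sup>2 \<partial>lborel)"
      by (rule coef_sq_le) (auto intro: square_distance series_square_integrable)
    also have "\<dots> \<le> L * real m powr - s"
      using series_distance(2)[of m] m by (simp add: power2_commute[of _ "series _"])
    also have "coef ?v j = coef f j - coef series j"
      unfolding coef_def[of ?v] using m
      by (subst integral_expansion_diff_mult_phi) (auto intro: series_square_integrable)
    finally show ?thesis by (simp add: power2_commute)
  qed
  then have "eventually (\<lambda>m. (coef series j - coef f j)\<^sup>2 \<le> L * real m powr - s) sequentially"
    by (rule eventually_mono[OF eventually_gt_at_top[of j]])
  moreover have "(\<lambda>m. L * real m powr - s) \<longlonglongrightarrow> 0"
    using s by (intro tendsto_mult_right_zero tendsto_neg_powr filterlim_real_sequentially) auto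
  ultimately have "(coef series j - coef f j)\<^sup>2 \<le> 0"
    by (intro tendsto_lowerbound[of "\<lambda>m. L * real m powr - s" 0 sequentially]) auto
  then show ?thesis by simp
qed

text \<open>Completeness enters here: the difference is orthogonal to every basis function. The
  bound \<open>f \<le> B\<close> and the decay of \<open>resid\<close> are then read off the
  series.\<close>

lemma f_eq_series: "AE x in lborel. f x = series x"
proof -
  have "AE x in lborel. f x + - series x = 0"
  proof (rule complete)
    show "integrable lborel (\<lambda>x. (f x + - series x)\<^sup>2)"
      by (rule integrable_square_add) (auto simp: f_sq series_square_integrable)
    show "f x + - series x = 0" if "x \<notin> A" for x
      using that by (simp add: f_supp series_def phi_supp)
    show "(\<integral>x. (f x + - series x) * \<phi> j x \<partial>lborel) = 0" for j
      using coef_series[of j] integrable_mult_phi[OF f_borel f_sq, of j]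
        integrable_mult_phi[OF series_borel series_square_integrable, of j]
      by (simp add: coef_def left_diff_distrib)
  qed auto
  then show ?thesis by eventually_elim simp
qed

lemma f_le_B: "AE x in lborel. f x \<le> B"
  using f_eq_series
proof eventually_elim
  case (elim x)
  have "(\<Sum>j<m. coef f j * \<phi> j x) \<le> B" for m
    using sum_abs_le_B[where N=m and x=x] sum_mono[of "{..<m}" "\<lambda>j. coef f j * \<phi> j x" "\<lambda>j. \<bar>coef f j * \<phi> j x\<bar>"]
    by force
  then have "series x \<le> B" by (intro LIMSEQ_le_const2[OF series_sums]) auto
  then show ?case using elim by simp
qed

lemma resid_le:
  assumes "1 \<le> k"
  shows "resid f k \<le> L * real k powr - s"
proof -
  have "resid f k = (\<integral>x. ((\<Sum>j<k. coef f j * \<phi> j x) - f x)\<^sup>2 \<partial>lborel)"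
    by (subst square_distance(2)) (auto simp: f_sq)
  also have "\<dots> = (\<integral>x. (series x - (\<Sum>j<k. coef f j * \<phi> j x))\<^sup>2 \<partial>lborel)"
    by (rule integral_cong_AE) (use f_eq_series in \<open>auto elim!: eventually_mono simp: power2_commute\<close>)
  also have "\<dots> \<le> L * real k powr - s" by (rule series_distance[OF assms])
  finally show ?thesis .
qed

lemma f_square_integral_le: "(\<integral>x. (f x)\<^sup>2 \<partial>lborel) \<le> C + L"
  using resid_le[of 1] coef_0_sq_le by (simp add: resid_def)

end

section \<open>Degenerate U-statistics, Gibbs weights and the oracle comparison\<close>

text \<open>The setting of a degenerate U-statistic of order two. The bound \<open>b\<close> makes
  all products integrable; the estimates are in terms of the second moment of
  \<open>H\<close>.\<close>

locale degenerate_kernel = prob_space \<mu> for \<mu> :: "'a measure" +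
  fixes H :: "'a \<Rightarrow> 'a \<Rightarrow> real" and b :: real
  assumes H_measurable: "(\<lambda>p. H (fst p) (snd p)) \<in> borel_measurable (\<mu> \<Otimes>\<^sub>M \<mu>)"
    and H_bounded: "\<And>y z. \<bar>H y z\<bar> \<le> b"
    and H_sym: "\<And>y z. H y z = H z y"
    and H_degenerate: "\<And>z. z \<in> space \<mu> \<Longrightarrow> (\<integral>y. H y z \<partial>\<mu>) = 0"
begin

lemma measurable_H_component:
  fixes I :: "'i set"
  assumes "i \<in> I" "k \<in> I"
  shows "(\<lambda>X. H (X i) (X k)) \<in> borel_measurable (Pi\<^sub>M I (\<lambda>_. \<mu>))"
proof -
  have "(\<lambda>X. (X i, X k)) \<in> measurable (Pi\<^sub>M I (\<lambda>_. \<mu>)) (\<mu> \<Otimes>\<^sub>M \<mu>)"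
    using assms by (intro measurable_Pair measurable_component_singleton)
  from measurable_compose[OF this H_measurable] show ?thesis by simp
qed

lemma b_nonneg: "0 \<le> b" using H_bounded[of undefined undefined] by linarith

lemma abs_HH_le: "\<bar>H y z * H y' z'\<bar> \<le> b * b"
  unfolding abs_mult by (intro mult_mono H_bounded b_nonneg) auto

lemma integrable_HH:
  fixes I :: "'i set"
  assumes "finite I" "i \<in> I" "k \<in> I" "i' \<in> I" "k' \<in> I"
  shows "integrable (Pi\<^sub>M I (\<lambda>_. \<mu>)) (\<lambda>X. H (X i) (X k) * H (X i') (X k'))"
proof -
  interpret P: prob_space "Pi\<^sub>M I (\<lambda>_. \<mu>)"
    by (rule prob_space_PiM) (rule prob_space_axioms)
  show ?thesis
    using assms abs_HH_le by (intro P.integrable_const_bound[where B="b * b"] borel_measurable_times measurable_H_component) auto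
qed

text \<open>The index \<open>i\<close> occurs once. Integrating that coordinate first leaves the
  other factor constant, and degeneracy annihilates the inner integral.\<close>

lemma integral_HH_eq_0:
  fixes I :: "'i set"
  assumes "finite I" "i \<in> I" "k \<in> I" "i' \<in> I" "k' \<in> I" "i \<noteq> k" "i \<noteq> i'" "i \<noteq> k'"
  shows "(\<integral>X. H (X i) (X k) * H (X i') (X k') \<partial>Pi\<^sub>M I (\<lambda>_. \<mu>)) = 0"
proof -
  interpret P: product_prob_space "\<lambda>_::'i. \<mu>" I by unfold_locales
  have I: "I = insert i (I - {i})" using assms by auto
  have "(\<integral>X. H (X i) (X k) * H (X i') (X k') \<partial>Pi\<^sub>M (insert i (I - {i})) (\<lambda>_. \<mu>))
      = (\<integral>X. (\<integral>y. H ((X(i := y)) i) ((X(i := y)) k) * H ((X(i := y)) i') ((X(i := y)) k') \<partial>\<mu>)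
          \<partial>Pi\<^sub>M (I - {i}) (\<lambda>_. \<mu>))"
    using assms I by (intro P.product_integral_insert integrable_HH) auto
  also have "\<dots> = (\<integral>X. 0 \<partial>Pi\<^sub>M (I - {i}) (\<lambda>_. \<mu>))"
  proof (rule Bochner_Integration.integral_cong[OF refl])
    fix X assume "X \<in> space (Pi\<^sub>M (I - {i}) (\<lambda>_. \<mu>))"
    then have "X k \<in> space \<mu>" using assms by (auto simp: space_PiM)
    then show "(\<integral>y. H ((X(i := y)) i) ((X(i := y)) k) * H ((X(i := y)) i') ((X(i := y)) k') \<partial>\<mu>) = 0"
      using assms H_degenerate[of "X k"] by (simp add: fun_upd_def)
  qed
  finally show ?thesis using I by simp
qed

lemma integral_H_sq:
  fixes I :: "'i set"
  assumes "finite I" "i \<in> I" "k \<in> I" "i \<noteq> k"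
  shows "(\<integral>X. H (X i) (X k) * H (X i) (X k) \<partial>Pi\<^sub>M I (\<lambda>_. \<mu>)) = (\<integral>z. (\<integral>y. (H y z)\<^sup>2 \<partial>\<mu>) \<partial>\<mu>)"
proof -
  interpret P: product_prob_space "\<lambda>_::'i. \<mu>" I by unfold_locales
  have I: "I = insert i (I - {i})" using assms by auto
  have [measurable]: "(\<lambda>z. \<integral>y. (H y z)\<^sup>2 \<partial>\<mu>) \<in> borel_measurable \<mu>"
  proof (rule borel_measurable_lebesgue_integral)
    show "(\<lambda>(z, y). (H y z)\<^sup>2) \<in> borel_measurable (\<mu> \<Otimes>\<^sub>M \<mu>)"
      using borel_measurable_power[OF H_measurable, of 2] by (simp add: H_sym split_beta')
  qed
  have "(\<integral>X. H (X i) (X k) * H (X i) (X k) \<partial>Pi\<^sub>M (insert i (I - {i})) (\<lambda>_. \<mu>))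
      = (\<integral>X. (\<integral>y. H ((X(i := y)) i) ((X(i := y)) k) * H ((X(i := y)) i) ((X(i := y)) k) \<partial>\<mu>)
          \<partial>Pi\<^sub>M (I - {i}) (\<lambda>_. \<mu>))"
    using assms I by (intro P.product_integral_insert integrable_HH) auto
  also have "\<dots> = (\<integral>X. (\<integral>y. (H y (X k))\<^sup>2 \<partial>\<mu>) \<partial>Pi\<^sub>M (I - {i}) (\<lambda>_. \<mu>))"
    using assms by (simp add: fun_upd_def power2_eq_square)
  also have "\<dots> = (\<integral>z. (\<integral>y. (H y z)\<^sup>2 \<partial>\<mu>) \<partial>distr (Pi\<^sub>M (I - {i}) (\<lambda>_. \<mu>)) \<mu> (\<lambda>X. X k))"
    using assms by (intro integral_distr[symmetric]) auto
  also have "distr (Pi\<^sub>M (I - {i}) (\<lambda>_. \<mu>)) \<mu> (\<lambda>X. X k) = \<mu>"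
    using distr_PiM_component[of "I - {i}" "\<lambda>_. \<mu>" k] assms prob_space_axioms by simp
  finally show ?thesis using I by simp
qed

text \<open>In the expanded square only \<open>q = p\<close> and \<open>q = prod.swap p\<close>
  survive, all with the same expectation, so at most \<open>2 * card Q\<close> terms remain.\<close>

lemma second_moment_off_diagonal_sum:
  fixes I :: "'i set"
  assumes fin: "finite I" and Q: "Q = {p \<in> I \<times> I. fst p \<noteq> snd p}"
  shows "integrable (Pi\<^sub>M I (\<lambda>_. \<mu>)) (\<lambda>X. (\<Sum>p\<in>Q. H (X (fst p)) (X (snd p)))\<^sup>2)"
    "(\<integral>X. (\<Sum>p\<in>Q. H (X (fst p)) (X (snd p)))\<^sup>2 \<partial>Pi\<^sub>M I (\<lambda>_. \<mu>))
      \<le> 2 * (real (card I))\<^sup>2 * (\<integral>z. (\<integral>y. (H y z)\<^sup>2 \<partial>\<mu>) \<partial>\<mu>)"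
proof -
  let ?h = "\<lambda>p X. H (X (fst p)) (X (snd p))"
  let ?M = "Pi\<^sub>M I (\<lambda>_. \<mu>)"
  define e where "e = (\<integral>z. (\<integral>y. (H y z)\<^sup>2 \<partial>\<mu>) \<partial>\<mu>)"
  have e0: "0 \<le> e" unfolding e_def by simp
  have finQ: "finite Q" using fin unfolding Q by simp
  have eq: "(\<Sum>p\<in>Q. ?h p X)\<^sup>2 = (\<Sum>p\<in>Q. \<Sum>q\<in>Q. ?h p X * ?h q X)" for X
    by (simp add: power2_eq_square sum_product)
  have int: "integrable ?M (\<lambda>X. ?h p X * ?h q X)" if "p \<in> Q" "q \<in> Q" for p q
    using that fin unfolding Q by (intro integrable_HH) auto
  show "integrable ?M (\<lambda>X. (\<Sum>p\<in>Q. ?h p X)\<^sup>2)"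
    unfolding eq by (intro Bochner_Integration.integrable_sum int)
  have le: "(\<integral>X. ?h p X * ?h q X \<partial>?M) = (if q = p \<or> q = prod.swap p then e else 0)"
    if p: "p \<in> Q" and q: "q \<in> Q" for p q
  proof -
    obtain i k where pik: "p = (i, k)" by (cases p)
    obtain i' k' where qik: "q = (i', k')" by (cases q)
    have mem: "i \<in> I" "k \<in> I" "i' \<in> I" "k' \<in> I" "i \<noteq> k" "i' \<noteq> k'"
      using p q by (auto simp: Q pik qik)
    \<comment> \<open>If \<open>q\<close> is neither \<open>p\<close> nor its swap, one of the two
      distinct entries of \<open>p\<close> is absent from \<open>q\<close>; when that entry is
      \<open>k\<close>, symmetry of \<open>H\<close> brings it to the first place.\<close>
    consider "q = p \<or> q = prod.swap p" | "q \<noteq> p" "q \<noteq> prod.swap p" "i \<noteq> i'" "i \<noteq> k'"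
      | "q \<noteq> p" "q \<noteq> prod.swap p" "k \<noteq> i'" "k \<noteq> k'"
      using mem by (auto simp: pik qik)
    then show ?thesis
    proof cases
      case 1
      then have "?h q X = ?h p X" for X by (auto simp: H_sym)
      then show ?thesis using 1 integral_H_sq[OF fin mem(1,2,5)] by (simp add: pik e_def)
    next
      case 2
      then show ?thesis using integral_HH_eq_0[OF fin mem(1-4) mem(5)] by (simp add: pik qik)
    next
      case 3
      have "?h p X = H (X k) (X i)" for X by (simp add: pik H_sym[of "X i"])
      then show ?thesis using 3 integral_HH_eq_0[OF fin mem(2,1,3,4)] mem(5) by (simp add: qik)
    qed
  qed
  have "(\<integral>X. (\<Sum>p\<in>Q. ?h p X)\<^sup>2 \<partial>?M) = (\<Sum>p\<in>Q. \<Sum>q\<in>Q. \<integral>X. ?h p X * ?h q X \<partial>?M)"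
    unfolding eq by (simp add: int)
  also have "\<dots> = (\<Sum>p\<in>Q. \<Sum>q\<in>Q. if q = p \<or> q = prod.swap p then e else 0)"
    by (intro sum.cong refl le)
  also have "\<dots> \<le> (\<Sum>p\<in>Q. 2 * e)"
  proof (rule sum_mono)
    fix p
    have "(\<Sum>q\<in>Q. if q = p \<or> q = prod.swap p then e else 0) = (\<Sum>q\<in>Q \<inter> {p, prod.swap p}. e)"
      using finQ by (subst sum.inter_restrict) (auto intro!: sum.cong)
    also have "\<dots> = real (card (Q \<inter> {p, prod.swap p})) * e" by simp
    also have "\<dots> \<le> 2 * e"
    proof (intro mult_right_mono e0)
      have "card (Q \<inter> {p, prod.swap p}) \<le> card {p, prod.swap p}" by (intro card_mono) auto
      also have "\<dots> \<le> 2" by (simp add: card_insert_if)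
      finally show "real (card (Q \<inter> {p, prod.swap p})) \<le> 2" by simp
    qed
    finally show "(\<Sum>q\<in>Q. if q = p \<or> q = prod.swap p then e else 0) \<le> 2 * e" .
  qed
  also have "\<dots> = real (card Q) * (2 * e)" by simp
  also have "\<dots> \<le> (real (card I))\<^sup>2 * (2 * e)"
  proof (rule mult_right_mono)
    have "card Q \<le> card (I \<times> I)" using fin unfolding Q by (intro card_mono) auto
    then show "real (card Q) \<le> (real (card I))\<^sup>2"
      by (simp add: card_cartesian_product power2_eq_square flip: of_nat_mult)
  qed (use e0 in simp)
  finally show "(\<integral>X. (\<Sum>p\<in>Q. ?h p X)\<^sup>2 \<partial>?M) \<le> 2 * (real (card I))\<^sup>2 * (\<integral>z. (\<integral>y. (H y z)\<^sup>2 \<partial>\<mu>) \<partial>\<mu>)"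
    by (simp add: e_def mult_ac)
qed

end

text \<open>Gibbs variational principle: \<open>\<beta>\<close> times the average is the entropy of
  the weights minus \<open>ln Z\<close>. The entropy is at most \<open>ln (card S)\<close>, by
  \<open>ln y \<le> y - 1\<close>, and the single term \<open>k0\<close> bounds \<open>Z\<close>
  from below.\<close>

lemma gibbs_average_le:
  fixes g :: "'a \<Rightarrow> real"
  assumes fin: "finite S" and k0: "k0 \<in> S" and \<beta>: "0 < \<beta>"
  defines "Z \<equiv> (\<Sum>l\<in>S. exp (- \<beta> * g l))"
  shows "(\<Sum>k\<in>S. exp (- \<beta> * g k) / Z * g k) \<le> g k0 + ln (real (card S)) / \<beta>"
proof -
  define p where "p k = exp (- \<beta> * g k) / Z" for k
  have Z: "0 < Z" unfolding Z_def using fin k0 by (intro sum_pos) auto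
  have p0: "0 < p k" for k using Z by (simp add: p_def)
  have p1: "(\<Sum>k\<in>S. p k) = 1" using Z by (simp add: p_def Z_def flip: sum_divide_distrib)
  have card: "0 < real (card S)" using fin k0 by (auto simp: card_gt_0_iff)
  have gk: "\<beta> * g k = - ln (p k) - ln Z" for k using Z by (simp add: p_def ln_div)
  have "(\<Sum>k\<in>S. p k * (- ln (p k) - ln (real (card S)))) \<le> (\<Sum>k\<in>S. 1 / real (card S) - p k)"
  proof (rule sum_mono)
    fix k
    have "- ln (p k) - ln (real (card S)) = ln (1 / (p k * real (card S)))"
      using p0[of k] card by (simp add: ln_div ln_mult)
    also have "\<dots> \<le> 1 / (p k * real (card S)) - 1"
      using p0[of k] card by (intro ln_le_minus_one) simp
    finally have "p k * (- ln (p k) - ln (real (card S))) \<le> p k * (1 / (p k * real (card S)) - 1)"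
      using p0[of k] by (intro mult_left_mono) auto
    then show "p k * (- ln (p k) - ln (real (card S))) \<le> 1 / real (card S) - p k"
      using p0[of k] by (simp add: right_diff_distrib)
  qed
  also have "\<dots> = 0" using card p1 by (simp add: sum_subtractf)
  finally have ent: "(\<Sum>k\<in>S. p k * - ln (p k)) \<le> ln (real (card S))"
    using p1 by (simp add: right_diff_distrib sum_subtractf flip: sum_distrib_right)
  have "exp (- \<beta> * g k0) \<le> Z"
    unfolding Z_def using fin k0 by (intro member_le_sum) auto
  then have "- \<beta> * g k0 \<le> ln Z" using Z by (simp add: ln_ge_iff)
  moreover have "\<beta> * (\<Sum>k\<in>S. p k * g k) = (\<Sum>k\<in>S. p k * - ln (p k)) - ln Z"
  proof -
    have "\<beta> * (\<Sum>k\<in>S. p k * g k) = (\<Sum>k\<in>S. p k * (- ln (p k) - ln Z))"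
      unfolding gk[symmetric] by (simp add: sum_distrib_left mult_ac)
    then show ?thesis using p1 by (simp add: right_diff_distrib sum_subtractf flip: sum_distrib_right)
  qed
  ultimately have "\<beta> * (\<Sum>k\<in>S. p k * g k) \<le> ln (real (card S)) + \<beta> * g k0"
    using ent by linarith
  then show ?thesis using \<beta> by (simp add: p_def field_simps)
qed

text \<open>Only the coordinates between \<open>k\<close> and \<open>k0\<close> matter. For
  \<open>k0 \<le> k\<close> the extra empirical energy is at most twice the noise plus twice the
  drop in bias; doubling the contrast difference costs \<open>4 * Z k\<close>, while
  \<open>2 * pen k\<close> provides \<open>8 * Z k - 2 * R\<close>. For \<open>k < k0\<close> the
  extra bias shows in the contrast up to the noise at \<open>k0\<close>, which \<open>pen k0\<close>
  pays for.\<close>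

lemma oracle_comparison:
  fixes x a :: "nat \<Rightarrow> real" and pen :: "nat \<Rightarrow> real" and R S :: real
  defines "Z \<equiv> \<lambda>k. \<Sum>j<k. (x j - a j)\<^sup>2" and "r \<equiv> \<lambda>k. S - (\<Sum>j<k. (a j)\<^sup>2)"
    and "\<gamma> \<equiv> \<lambda>k. - (\<Sum>j<k. (x j)\<^sup>2) + pen k"
  assumes Zk: "4 * Z k \<le> pen k + R" and Zk0: "4 * Z k0 \<le> pen k0 + R"
    and pen: "\<And>k. 0 \<le> pen k" and R: "0 \<le> R" and r0: "\<And>k. 0 \<le> r k"
  shows "Z k + r k \<le> 5 * r k0 + 3 * pen k0 + 2 * R + 2 * (\<gamma> k - \<gamma> k0)"
proof -
  have split: "(\<Sum>j<n. h j) = (\<Sum>j<m. h j) + (\<Sum>j=m..<n. h j)" if "m \<le> n" for m n and h :: "nat \<Rightarrow> real"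
    using that sum.atLeastLessThan_concat[of 0 m n h] by (simp add: lessThan_atLeast0)
  have sq: "u\<^sup>2 \<le> 2 * (u - v)\<^sup>2 + 2 * v\<^sup>2" "v\<^sup>2 \<le> 2 * (u - v)\<^sup>2 + 2 * u\<^sup>2" for u v :: real
    using zero_le_power2[of "u - 2 * v"] zero_le_power2[of "2 * u - v"]
    by (auto simp: power2_eq_square algebra_simps)
  have Z0: "0 \<le> Z k" "0 \<le> Z k0" unfolding Z_def by (auto intro: sum_nonneg)
  show ?thesis
  proof (cases "k0 \<le> k")
    case True
    have "(\<Sum>j=k0..<k. (x j)\<^sup>2) \<le> (\<Sum>j=k0..<k. 2 * (x j - a j)\<^sup>2 + 2 * (a j)\<^sup>2)"
      by (intro sum_mono sq)
    also have "\<dots> = 2 * (\<Sum>j=k0..<k. (x j - a j)\<^sup>2) + 2 * (\<Sum>j=k0..<k. (a j)\<^sup>2)"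
      by (simp add: sum.distrib sum_distrib_left)
    finally have "(\<Sum>j=k0..<k. (x j)\<^sup>2) \<le> 2 * (Z k - Z k0) + 2 * (r k0 - r k)"
      unfolding Z_def r_def split[OF True] by simp
    moreover have "\<gamma> k - \<gamma> k0 = pen k - pen k0 - (\<Sum>j=k0..<k. (x j)\<^sup>2)"
      unfolding \<gamma>_def split[OF True] by simp
    ultimately show ?thesis using Zk Z0 pen[of k0] R r0[of k] r0[of k0] by (smt (verit))
  next
    case False
    then have le: "k \<le> k0" by simp
    have "(\<Sum>j=k..<k0. (a j)\<^sup>2) \<le> (\<Sum>j=k..<k0. 2 * (x j - a j)\<^sup>2 + 2 * (x j)\<^sup>2)"
      by (intro sum_mono sq)
    also have "\<dots> = 2 * (\<Sum>j=k..<k0. (x j - a j)\<^sup>2) + 2 * (\<Sum>j=k..<k0. (x j)\<^sup>2)"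
      by (simp add: sum.distrib sum_distrib_left)
    finally have "r k - r k0 \<le> 2 * (Z k0 - Z k) + 2 * (\<Sum>j=k..<k0. (x j)\<^sup>2)"
      unfolding Z_def r_def split[OF le] by simp
    moreover have "\<gamma> k - \<gamma> k0 = pen k - pen k0 + (\<Sum>j=k..<k0. (x j)\<^sup>2)"
      unfolding \<gamma>_def split[OF le] by simp
    ultimately show ?thesis using Zk0 Z0 pen[of k] pen[of k0] R r0[of k0] by (smt (verit))
  qed
qed

section \<open>Second moments under the density\<close>

lemma square_weighted_mean_le:
  fixes w y :: "'a \<Rightarrow> real"
  assumes "\<And>k. k \<in> S \<Longrightarrow> 0 \<le> w k" and "(\<Sum>k\<in>S. w k) = 1"
  shows "(\<Sum>k\<in>S. w k * y k)\<^sup>2 \<le> (\<Sum>k\<in>S. w k * (y k)\<^sup>2)"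
proof -
  define m where "m = (\<Sum>k\<in>S. w k * y k)"
  have "0 \<le> (\<Sum>k\<in>S. w k * (y k - m)\<^sup>2)" using assms by (intro sum_nonneg) auto
  also have "\<dots> = (\<Sum>k\<in>S. w k * (y k)\<^sup>2 - 2 * m * (w k * y k) + m\<^sup>2 * w k)"
    by (intro sum.cong) (auto simp: power2_diff algebra_simps)
  also have "\<dots> = (\<Sum>k\<in>S. w k * (y k)\<^sup>2) - m\<^sup>2"
    using assms(2) by (simp add: sum.distrib sum_subtractf m_def[symmetric] power2_eq_square
      flip: sum_distrib_left)
  finally show ?thesis by (simp add: m_def)
qed

lemma square_sum_split_diagonal:
  fixes z :: "'a \<Rightarrow> real"
  assumes "finite I"
  shows "(\<Sum>i\<in>I. z i)\<^sup>2 = (\<Sum>i\<in>I. (z i)\<^sup>2) + (\<Sum>p\<in>{p \<in> I \<times> I. fst p \<noteq> snd p}. z (fst p) * z (snd p))"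
proof -
  have "(\<Sum>i\<in>I. z i)\<^sup>2 = (\<Sum>p\<in>I \<times> I. z (fst p) * z (snd p))"
    by (simp add: power2_eq_square sum_product sum.cartesian_product split_beta')
  also have "I \<times> I = {p \<in> I \<times> I. fst p \<noteq> snd p} \<union> (\<lambda>i. (i, i)) ` I" by auto
  also have "(\<Sum>p\<in>\<dots>. z (fst p) * z (snd p)) = (\<Sum>p\<in>{p \<in> I \<times> I. fst p \<noteq> snd p}. z (fst p) * z (snd p))
      + (\<Sum>p\<in>(\<lambda>i. (i, i)) ` I. z (fst p) * z (snd p))"
    using assms by (intro sum.union_disjoint) auto
  also have "(\<Sum>p\<in>(\<lambda>i. (i, i)) ` I. z (fst p) * z (snd p)) = (\<Sum>i\<in>I. (z i)\<^sup>2)"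
    by (subst sum.reindex) (auto simp: inj_on_def power2_eq_square)
  finally show ?thesis by simp
qed

lemma ex_power2_between:
  assumes "1 \<le> k" "k \<le> 2 ^ I"
  shows "\<exists>i\<le>I. k \<le> 2 ^ i \<and> (2::nat) ^ i \<le> 2 * k"
proof -
  define i where "i = (LEAST i. k \<le> 2 ^ i)"
  have i: "k \<le> 2 ^ i" unfolding i_def by (rule LeastI) (rule assms)
  have "i \<le> I" unfolding i_def by (rule Least_le) (rule assms)
  moreover have "2 ^ i \<le> 2 * k"
  proof (cases i)
    case 0
    then show ?thesis using assms by simp
  next
    case (Suc i')
    then have "\<not> k \<le> 2 ^ i'" using not_less_Least[of i' "\<lambda>i. k \<le> 2 ^ i"] by (simp add: i_def)
    then show ?thesis using Suc by simp
  qed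
  ultimately show ?thesis using i by blast
qed

context sobolev_density
begin

abbreviation \<mu> :: "real measure" where "\<mu> \<equiv> law f"

lemma sets_mu[simp, measurable_cong]: "sets \<mu> = sets borel"
  and space_mu[simp]: "space \<mu> = UNIV"
  by (simp_all add: law_def)

lemma prob_space_mu: "prob_space \<mu>"
proof (rule prob_spaceI)
  have "(\<integral>\<^sup>+x. ennreal (f x) \<partial>lborel) = 1"
    using f_int by (subst nn_integral_eq_integral) (auto simp: f_nonneg has_bochner_integral_iff)
  then show "emeasure \<mu> (space \<mu>) = 1" by (simp add: law_def emeasure_density)
qed

sublocale mu: prob_space \<mu> by (rule prob_space_mu)

lemma integral_mu: "g \<in> borel_measurable borel \<Longrightarrow> (\<integral>x. g x \<partial>\<mu>) = (\<integral>x. f x * g x \<partial>lborel)"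
  unfolding law_def by (subst integral_density) (auto simp: f_nonneg)

lemma integrable_mu: "g \<in> borel_measurable borel \<Longrightarrow> integrable \<mu> g \<longleftrightarrow> integrable lborel (\<lambda>x. f x * g x)"
  unfolding law_def by (subst integrable_density) (auto simp: f_nonneg)

text \<open>Bounds the mean of \<open>\<bar>x\<bar> powr \<alpha> + 1\<close> over the class: the
  class controls the exponent \<open>2 * \<alpha>\<close>, and \<open>t \<le> 1 + t\<^sup>2\<close>
  converts it.\<close>

definition V :: real where "V = 2 + L"

lemma integrable_moment: "integrable \<mu> (\<lambda>x. \<bar>x\<bar> powr \<alpha>)"
  and integral_moment_le: "(\<integral>x. \<bar>x\<bar> powr \<alpha> \<partial>\<mu>) \<le> 1 + L"
proof -
  have le: "\<bar>x\<bar> powr \<alpha> \<le> 1 + \<bar>x\<bar> powr (2 * \<alpha>)" for x :: real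
  proof -
    have "\<bar>x\<bar> powr (2 * \<alpha>) = (\<bar>x\<bar> powr \<alpha>)\<^sup>2" by (simp add: power2_eq_square flip: powr_add)
    moreover have "2 * (\<bar>x\<bar> powr \<alpha>) \<le> 1 + (\<bar>x\<bar> powr \<alpha>)\<^sup>2"
      using sum_squares_bound[of 1 "\<bar>x\<bar> powr \<alpha>"] by simp
    moreover have "0 \<le> \<bar>x\<bar> powr \<alpha>" by simp
    ultimately show ?thesis by linarith
  qed
  have "(\<integral>\<^sup>+x. ennreal (\<bar>x\<bar> powr \<alpha>) \<partial>\<mu>) \<le> (\<integral>\<^sup>+x. 1 + ennreal (\<bar>x\<bar> powr (2 * \<alpha>)) \<partial>\<mu>)"
    by (intro nn_integral_mono) (simp add: le flip: ennreal_1 ennreal_plus)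
  also have "\<dots> = 1 + (\<integral>\<^sup>+x. ennreal (\<bar>x\<bar> powr (2 * \<alpha>)) \<partial>\<mu>)"
    by (subst nn_integral_add) (auto simp: mu.emeasure_space_1[simplified])
  also have "(\<integral>\<^sup>+x. ennreal (\<bar>x\<bar> powr (2 * \<alpha>)) \<partial>\<mu>) \<le> ennreal L"
    using moment unfolding law_def by (subst nn_integral_density) (auto simp: mult.commute)
  finally have *: "(\<integral>\<^sup>+x. ennreal (\<bar>x\<bar> powr \<alpha>) \<partial>\<mu>) \<le> ennreal (1 + L)"
    using L by (simp add: ennreal_plus)
  then show i: "integrable \<mu> (\<lambda>x. \<bar>x\<bar> powr \<alpha>)"
    by (intro integrableI_nonneg) (auto intro: le_less_trans)
  show "(\<integral>x. \<bar>x\<bar> powr \<alpha> \<partial>\<mu>) \<le> 1 + L"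
    using * L by (subst (asm) nn_integral_eq_integral[OF i]) (auto simp del: ennreal_plus)
qed

lemma phi_sq_le_moment_mu: "AE x in \<mu>. \<forall>k. (\<Sum>j<k. (\<phi> j x)\<^sup>2) \<le> C * (\<bar>x\<bar> powr \<alpha> + 1) * sqrt (real k)"
  unfolding law_def
proof (subst AE_density, simp, use phi_sq_le_moment in eventually_elim)
  case (elim x)
  then show ?case using f_supp[of x] by auto
qed

lemma integrable_mu_bounded:
  fixes g :: "real \<Rightarrow> real"
  shows "g \<in> borel_measurable borel \<Longrightarrow> (\<And>x. \<bar>g x\<bar> \<le> b) \<Longrightarrow> integrable \<mu> g"
  by (rule mu.integrable_const_bound[where B=b]) (auto simp: measurable_cong_sets[OF sets_mu refl])

lemma sum_integral_phi_sq_le: "(\<Sum>j<m. \<integral>x. (\<phi> j x)\<^sup>2 \<partial>\<mu>) \<le> C * V * sqrt (real m)"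
proof -
  have int: "integrable \<mu> (\<lambda>x. (\<phi> j x)\<^sup>2)" for j
  proof (rule integrable_mu_bounded)
    show "\<bar>(\<phi> j x)\<^sup>2\<bar> \<le> (sqrt (C * real (Suc j)))\<^sup>2" for x
      using power_mono[OF phi_bounded[of j x], of 2] by simp
  qed simp
  have "(\<Sum>j<m. \<integral>x. (\<phi> j x)\<^sup>2 \<partial>\<mu>) = (\<integral>x. (\<Sum>j<m. (\<phi> j x)\<^sup>2) \<partial>\<mu>)"
    by (simp add: int)
  also have "\<dots> \<le> (\<integral>x. C * (\<bar>x\<bar> powr \<alpha> + 1) * sqrt (real m) \<partial>\<mu>)"
    by (rule integral_mono_AE) (use int integrable_moment phi_sq_le_moment_mu in \<open>auto elim!: eventually_mono\<close>)
  also have "\<dots> = C * ((\<integral>x. \<bar>x\<bar> powr \<alpha> \<partial>\<mu>) + 1) * sqrt (real m)"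
    using integrable_moment by (simp add: mu.prob_space[simplified])
  also have "\<dots> \<le> C * V * sqrt (real m)"
    using C integral_moment_le by (intro mult_right_mono mult_left_mono) (auto simp: V_def)
  finally show ?thesis .
qed

section \<open>The centred kernel and its second moment\<close>

definition \<psi> :: "nat \<Rightarrow> real \<Rightarrow> real" where "\<psi> j x = \<phi> j x - coef f j"

text \<open>Its average over all pairs of observations is the squared coefficient error summed over
  \<open>j < m\<close>.\<close>

definition kern :: "nat \<Rightarrow> real \<Rightarrow> real \<Rightarrow> real" where "kern m y z = (\<Sum>j<m. \<psi> j y * \<psi> j z)"

definition psib :: "nat \<Rightarrow> real" where "psib j = sqrt (C * real (Suc j)) + \<bar>coef f j\<bar>"

lemma psi_borel[measurable]: "\<psi> j \<in> borel_measurable borel"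
  unfolding \<psi>_def by measurable

lemma psi_bounded: "\<bar>\<psi> j x\<bar> \<le> psib j"
  unfolding \<psi>_def psib_def using phi_bounded[of j x] by linarith

lemma psib_nonneg: "0 \<le> psib j"
  using psi_bounded[of j 0] by linarith

lemma psi_psi_bounded: "\<bar>\<psi> j x * \<psi> k y\<bar> \<le> psib j * psib k"
  unfolding abs_mult by (intro mult_mono psi_bounded psib_nonneg) auto

lemma integrable_phi_mu: "integrable \<mu> (\<phi> j)"
  by (rule integrable_mu_bounded[OF phi_borel phi_bounded])

lemma integral_phi_mu: "(\<integral>x. \<phi> j x \<partial>\<mu>) = coef f j"
  by (simp add: integral_mu coef_def)

lemma integral_psi: "(\<integral>x. \<psi> j x \<partial>\<mu>) = 0"
  unfolding \<psi>_def using integrable_phi_mu by (simp add: integral_phi_mu mu.prob_space[simplified])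

lemma integrable_psi_psi: "integrable \<mu> (\<lambda>x. \<psi> j x * \<psi> k x)"
  by (rule integrable_mu_bounded[OF _ psi_psi_bounded]) simp

lemma degenerate_kern: "degenerate_kernel \<mu> (kern m) (\<Sum>j<m. psib j * psib j)"
proof
  show "(\<lambda>p. kern m (fst p) (snd p)) \<in> borel_measurable (\<mu> \<Otimes>\<^sub>M \<mu>)"
    unfolding kern_def by measurable
  show "\<bar>kern m y z\<bar> \<le> (\<Sum>j<m. psib j * psib j)" for y z
    unfolding kern_def by (rule order_trans[OF sum_abs]) (intro sum_mono psi_psi_bounded)
  show "kern m y z = kern m z y" for y z
    by (simp add: kern_def mult.commute)
  show "(\<integral>y. kern m y z \<partial>\<mu>) = 0" for z
  proof -
    have "integrable \<mu> (\<psi> j)" for j by (rule integrable_mu_bounded[OF psi_borel psi_bounded])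
    then show ?thesis unfolding kern_def by (simp add: integral_psi)
  qed
qed

text \<open>The factors 2 stem from
  \<open>(u - v)\<^sup>2 \<le> 2 * u\<^sup>2 + 2 * v\<^sup>2\<close>, a covariance being a second
  moment minus a product of means. The second summand fits under \<open>sqrt m\<close> because
  \<open>m \<ge> 1\<close>.\<close>

definition E1 :: real where "E1 = 2 * (B * (C * V)) + 2 * (C + L)\<^sup>2"

lemma V_pos: "0 < V" using L by (simp add: V_def)

lemma E1_nonneg: "0 \<le> E1" using V_pos B_nonneg C by (simp add: E1_def)

lemma sum_coef_sq_le: "(\<Sum>j<m. (coef f j)\<^sup>2) \<le> C + L"
  using bessel[OF f_borel f_sq] f_square_integral_le by (rule order_trans)

text \<open>For fixed \<open>j\<close> these integrals are the expansion coefficients of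
  \<open>f\<close> times \<open>\<phi> j\<close>, so Bessel's inequality sums their squares over all
  \<open>l\<close> at once. One factor of the resulting \<open>f\<^sup>2\<close> is replaced by
  \<open>B\<close>.\<close>

lemma sum_square_integral_phi_phi_le:
  "(\<Sum>l<m. (\<integral>x. \<phi> j x * \<phi> l x \<partial>\<mu>)\<^sup>2) \<le> B * (\<integral>x. (\<phi> j x)\<^sup>2 \<partial>\<mu>)"
proof -
  let ?u = "\<lambda>x. f x * \<phi> j x"
  have p2: "(\<phi> j x)\<^sup>2 \<le> C * real (Suc j)" for x
    using power_mono[OF phi_bounded[of j x], of 2] C by simp
  have "integrable \<mu> (\<lambda>x. (\<phi> j x)\<^sup>2)"
    by (rule integrable_mu_bounded[where b="C * real (Suc j)"]) (use p2 in auto)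
  then have int1: "integrable lborel (\<lambda>x. f x * (\<phi> j x)\<^sup>2)"
    by (subst (asm) integrable_mu) auto
  have usq: "integrable lborel (\<lambda>x. (?u x)\<^sup>2)"
  proof (rule Bochner_Integration.integrable_bound)
    show "integrable lborel (\<lambda>x. C * real (Suc j) * (f x)\<^sup>2)"
      using f_sq by (rule integrable_mult_right)
    show "AE x in lborel. norm ((?u x)\<^sup>2) \<le> norm (C * real (Suc j) * (f x)\<^sup>2)"
    proof (rule AE_I2)
      fix x
      have "(f x)\<^sup>2 * (\<phi> j x)\<^sup>2 \<le> (f x)\<^sup>2 * (C * real (Suc j))" by (intro mult_left_mono p2) simp
      also have "\<dots> \<le> norm (C * real (Suc j) * (f x)\<^sup>2)" by (simp only: mult.commute real_norm_def abs_ge_self)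
      finally show "norm ((?u x)\<^sup>2) \<le> norm (C * real (Suc j) * (f x)\<^sup>2)"
        by (simp add: power_mult_distrib abs_mult)
    qed
  qed simp
  have "(\<Sum>l<m. (\<integral>x. \<phi> j x * \<phi> l x \<partial>\<mu>)\<^sup>2) = (\<Sum>l<m. (coef ?u l)\<^sup>2)"
    by (simp add: integral_mu coef_def mult.assoc)
  also have "\<dots> \<le> (\<integral>x. (?u x)\<^sup>2 \<partial>lborel)" by (rule bessel) (auto intro: usq)
  also have "\<dots> \<le> (\<integral>x. B * (f x * (\<phi> j x)\<^sup>2) \<partial>lborel)"
  proof (rule integral_mono_AE[OF usq integrable_mult_right[OF int1]])
    show "AE x in lborel. (?u x)\<^sup>2 \<le> B * (f x * (\<phi> j x)\<^sup>2)"
      using f_le_B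
    proof eventually_elim
      case (elim x)
      have "f x * (f x * (\<phi> j x)\<^sup>2) \<le> B * (f x * (\<phi> j x)\<^sup>2)"
        using elim by (intro mult_right_mono) (auto simp: f_nonneg)
      then show ?case by (simp add: power2_eq_square mult_ac)
    qed
  qed
  also have "\<dots> = B * (\<integral>x. (\<phi> j x)\<^sup>2 \<partial>\<mu>)" by (simp add: integral_mu)
  finally show ?thesis .
qed

text \<open>Integrating both variables leaves the sum of all squared covariances, the squared
  Frobenius norm of the covariance matrix. Row by row it is reduced to the trace, apart from the
  products of means.\<close>

lemma kern_second_moment:
  assumes "1 \<le> m"
  shows "(\<integral>z. (\<integral>y. (kern m y z)\<^sup>2 \<partial>\<mu>) \<partial>\<mu>) \<le> E1 * sqrt (real m)"
proof -
  let ?c = "\<lambda>j l. \<integral>x. \<psi> j x * \<psi> l x \<partial>\<mu>"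
  let ?d = "\<lambda>j l. \<integral>x. \<phi> j x * \<phi> l x \<partial>\<mu>"
  have eq: "(kern m y z)\<^sup>2 = (\<Sum>j<m. \<Sum>l<m. (\<psi> j z * \<psi> l z) * (\<psi> j y * \<psi> l y))" for y z
    by (simp add: kern_def power2_eq_square sum_product mult_ac)
  have "(\<integral>z. (\<integral>y. (kern m y z)\<^sup>2 \<partial>\<mu>) \<partial>\<mu>) = (\<integral>z. (\<Sum>j<m. \<Sum>l<m. (\<psi> j z * \<psi> l z) * ?c j l) \<partial>\<mu>)"
    unfolding eq by (simp add: integrable_psi_psi)
  also have "\<dots> = (\<Sum>j<m. \<Sum>l<m. (?c j l)\<^sup>2)"
    by (simp add: integrable_psi_psi power2_eq_square)
  also have "\<dots> \<le> (\<Sum>j<m. \<Sum>l<m. 2 * (?d j l)\<^sup>2 + 2 * ((coef f j)\<^sup>2 * (coef f l)\<^sup>2))"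
  proof (intro sum_mono)
    fix j l
    have int: "integrable \<mu> (\<lambda>x. \<phi> j x * \<phi> l x)"
      by (rule integrable_mu_bounded[where b="sqrt (C * real (Suc j)) * sqrt (C * real (Suc l))"])
        (use phi_bounded C in \<open>auto simp: abs_mult intro!: mult_mono\<close>)
    have "?c j l = (\<integral>x. \<phi> j x * \<phi> l x - coef f l * \<phi> j x - coef f j * \<phi> l x + coef f j * coef f l \<partial>\<mu>)"
      by (simp add: \<psi>_def algebra_simps)
    also have "\<dots> = ?d j l - coef f j * coef f l"
      using int integrable_phi_mu by (simp add: integral_phi_mu mu.prob_space[simplified])
    finally have c: "?c j l = ?d j l - coef f j * coef f l" .
    have "(?d j l - coef f j * coef f l)\<^sup>2 \<le> 2 * (?d j l)\<^sup>2 + 2 * (coef f j * coef f l)\<^sup>2"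
      using zero_le_power2[of "?d j l + coef f j * coef f l"]
      by (simp add: power2_sum power2_diff)
    then show "(?c j l)\<^sup>2 \<le> 2 * (?d j l)\<^sup>2 + 2 * ((coef f j)\<^sup>2 * (coef f l)\<^sup>2)"
      unfolding c by (simp add: power_mult_distrib)
  qed
  also have "\<dots> = 2 * (\<Sum>j<m. \<Sum>l<m. (?d j l)\<^sup>2) + 2 * (\<Sum>j<m. (coef f j)\<^sup>2)\<^sup>2"
    by (simp add: sum.distrib sum_product power2_eq_square[of "sum _ _"] flip: sum_distrib_left)
  also have "\<dots> \<le> 2 * (B * (C * V * sqrt (real m))) + 2 * (C + L)\<^sup>2"
  proof (intro add_mono mult_left_mono power_mono sum_coef_sq_le)
    have "(\<Sum>j<m. \<Sum>l<m. (?d j l)\<^sup>2) \<le> (\<Sum>j<m. B * (\<integral>x. (\<phi> j x)\<^sup>2 \<partial>\<mu>))"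
      by (intro sum_mono sum_square_integral_phi_phi_le)
    also have "\<dots> \<le> B * (C * V * sqrt (real m))"
      unfolding sum_distrib_left[symmetric] by (intro mult_left_mono sum_integral_phi_sq_le B_nonneg)
    finally show "(\<Sum>j<m. \<Sum>l<m. (?d j l)\<^sup>2) \<le> B * (C * V * sqrt (real m))" .
  qed (auto intro: sum_nonneg)
  also have "\<dots> \<le> 2 * (B * (C * V * sqrt (real m))) + 2 * (C + L)\<^sup>2 * sqrt (real m)"
    using assms by (intro add_mono order_refl) (simp add: mult_le_cancel_left1)
  also have "\<dots> = E1 * sqrt (real m)" by (simp add: E1_def algebra_simps)
  finally show ?thesis .
qed

end

section \<open>The penalised estimators\<close>

context sobolev_density
begin

definition ahat :: "nat \<Rightarrow> (nat \<Rightarrow> real) \<Rightarrow> nat \<Rightarrow> real" where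
  "ahat n X j = (1 / real n) * (\<Sum>i=1..n. \<phi> j (X i))"

definition vhat :: "nat \<Rightarrow> (nat \<Rightarrow> real) \<Rightarrow> real" where
  "vhat n X = 1 + (1 / real n) * (\<Sum>i=1..n. \<bar>X i\<bar> powr \<alpha>)"

definition zsum :: "nat \<Rightarrow> nat \<Rightarrow> (nat \<Rightarrow> real) \<Rightarrow> real" where
  "zsum n m X = (\<Sum>j<m. (ahat n X j - coef f j)\<^sup>2)"

definition ustat :: "nat \<Rightarrow> nat \<Rightarrow> (nat \<Rightarrow> real) \<Rightarrow> real" where
  "ustat n m X = (1 / (real n)\<^sup>2) *
    (\<Sum>p\<in>{p \<in> {1..n} \<times> {1..n}. fst p \<noteq> snd p}. kern m (X (fst p)) (X (snd p)))"

text \<open>The summands come from \<open>4 u \<le> q / n + 4 n u\<^sup>2 / q\<close> with \<open>q = sqrt (2 ^ i)\<close>, where \<open>q / n\<close> is absorbed by the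
  penalty.\<close>

definition remainder :: "nat \<Rightarrow> nat \<Rightarrow> (nat \<Rightarrow> real) \<Rightarrow> real" where
  "remainder n I X = 8 * (C + L) / real n + (\<Sum>i\<le>I. 4 * real n / sqrt (2 ^ i) * (ustat n (2 ^ i) X)\<^sup>2)"

text \<open>The bound holds at every observation and for all \<open>k\<close> at once; it fails only
  on a null set of samples, which leaves the risk unchanged.\<close>

definition good :: "nat \<Rightarrow> (nat \<Rightarrow> real) \<Rightarrow> bool" where
  "good n X \<longleftrightarrow> (\<forall>i\<in>{1..n}. \<forall>k. (\<Sum>j<k. (\<phi> j (X i))\<^sup>2) \<le> C * (\<bar>X i\<bar> powr \<alpha> + 1) * sqrt (real k))"

lemma vhat_ge_1: "1 \<le> vhat n X"
  unfolding vhat_def by (simp add: sum_nonneg)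

lemma remainder_nonneg: "0 \<le> remainder n I X"
  unfolding remainder_def using C L by (intro add_nonneg_nonneg sum_nonneg) auto

lemma zsum_eq:
  assumes "1 \<le> n"
  shows "zsum n m X = (1 / (real n)\<^sup>2) * (\<Sum>i=1..n. \<Sum>j<m. (\<psi> j (X i))\<^sup>2) + ustat n m X"
proof -
  let ?Q = "{p \<in> {1..n} \<times> {1..n}. fst p \<noteq> snd p}"
  have "(ahat n X j - coef f j)\<^sup>2 = (1 / (real n)\<^sup>2) * (\<Sum>i=1..n. (\<psi> j (X i))\<^sup>2)
      + (1 / (real n)\<^sup>2) * (\<Sum>p\<in>?Q. \<psi> j (X (fst p)) * \<psi> j (X (snd p)))" for j
  proof -
    have "ahat n X j - coef f j = (1 / real n) * (\<Sum>i=1..n. \<psi> j (X i))"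
      using assms by (simp add: ahat_def \<psi>_def sum_subtractf field_simps)
    then have "(ahat n X j - coef f j)\<^sup>2 = (1 / (real n)\<^sup>2) * (\<Sum>i=1..n. \<psi> j (X i))\<^sup>2"
      by (simp add: power_mult_distrib power_divide)
    also have "(\<Sum>i=1..n. \<psi> j (X i))\<^sup>2
        = (\<Sum>i=1..n. (\<psi> j (X i))\<^sup>2) + (\<Sum>p\<in>?Q. \<psi> j (X (fst p)) * \<psi> j (X (snd p)))"
      by (rule square_sum_split_diagonal) simp
    finally show ?thesis by (simp only: distrib_left)
  qed
  then have "zsum n m X = (1 / (real n)\<^sup>2) * (\<Sum>j<m. \<Sum>i=1..n. (\<psi> j (X i))\<^sup>2)
      + (1 / (real n)\<^sup>2) * (\<Sum>j<m. \<Sum>p\<in>?Q. \<psi> j (X (fst p)) * \<psi> j (X (snd p)))"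
    unfolding zsum_def by (simp only: sum.distrib sum_distrib_left)
  also have "(\<Sum>j<m. \<Sum>i=1..n. (\<psi> j (X i))\<^sup>2) = (\<Sum>i=1..n. \<Sum>j<m. (\<psi> j (X i))\<^sup>2)"
    by (rule sum.swap)
  also have "(\<Sum>j<m. \<Sum>p\<in>?Q. \<psi> j (X (fst p)) * \<psi> j (X (snd p))) = (\<Sum>p\<in>?Q. kern m (X (fst p)) (X (snd p)))"
    unfolding kern_def by (rule sum.swap)
  finally show ?thesis by (simp add: ustat_def)
qed

lemma zsum_le:
  assumes n: "1 \<le> n" and good: "good n X"
  shows "zsum n m X \<le> 2 * C * vhat n X * sqrt (real m) / real n + 2 * (C + L) / real n + ustat n m X"
proof -
  have "(\<Sum>j<m. (\<psi> j (X i))\<^sup>2) \<le> 2 * (C * (\<bar>X i\<bar> powr \<alpha> + 1) * sqrt (real m)) + 2 * (C + L)"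
    if i: "i \<in> {1..n}" for i
  proof -
    have "(\<Sum>j<m. (\<psi> j (X i))\<^sup>2) \<le> (\<Sum>j<m. 2 * (\<phi> j (X i))\<^sup>2 + 2 * (coef f j)\<^sup>2)"
    proof (rule sum_mono)
      fix j
      show "(\<psi> j (X i))\<^sup>2 \<le> 2 * (\<phi> j (X i))\<^sup>2 + 2 * (coef f j)\<^sup>2"
        using zero_le_power2[of "\<phi> j (X i) + coef f j"] by (simp add: \<psi>_def power2_sum power2_diff)
    qed
    also have "\<dots> = 2 * (\<Sum>j<m. (\<phi> j (X i))\<^sup>2) + 2 * (\<Sum>j<m. (coef f j)\<^sup>2)"
      by (simp add: sum.distrib sum_distrib_left)
    also have "\<dots> \<le> 2 * (C * (\<bar>X i\<bar> powr \<alpha> + 1) * sqrt (real m)) + 2 * (C + L)"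
      using good i by (intro add_mono mult_left_mono sum_coef_sq_le) (auto simp: good_def)
    finally show ?thesis .
  qed
  then have "(\<Sum>i=1..n. \<Sum>j<m. (\<psi> j (X i))\<^sup>2)
      \<le> (\<Sum>i=1..n. 2 * (C * (\<bar>X i\<bar> powr \<alpha> + 1) * sqrt (real m)) + 2 * (C + L))"
    by (intro sum_mono)
  also have "\<dots> = 2 * C * sqrt (real m) * (\<Sum>i=1..n. \<bar>X i\<bar> powr \<alpha> + 1) + real n * (2 * (C + L))"
    by (simp add: sum.distrib sum_distrib_left algebra_simps)
  \<comment> \<open>The 1 in the pointwise bound is the 1 in \<open>vhat\<close>, so the diagonal is
    measured exactly by the empirical penalty.\<close>
  also have "(\<Sum>i=1..n. \<bar>X i\<bar> powr \<alpha> + 1) = real n * vhat n X"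
    using n by (simp add: sum.distrib vhat_def algebra_simps)
  finally have "(1 / (real n)\<^sup>2) * (\<Sum>i=1..n. \<Sum>j<m. (\<psi> j (X i))\<^sup>2)
      \<le> (1 / (real n)\<^sup>2) * (2 * C * sqrt (real m) * (real n * vhat n X) + real n * (2 * (C + L)))"
    by (intro mult_left_mono) auto
  also have "\<dots> = 2 * C * vhat n X * sqrt (real m) / real n + 2 * (C + L) / real n"
    using n by (simp add: power2_eq_square field_simps)
  finally show ?thesis unfolding zsum_eq[OF n] by simp
qed

lemma zsum_mono: "k \<le> m \<Longrightarrow> zsum n k X \<le> zsum n m X"
  unfolding zsum_def by (rule sum_mono2) auto

text \<open>\<open>zsum\<close> increases with the dimension, so \<open>k\<close> is rounded up to a
  power of two, at the cost of \<open>sqrt 2 \<le> 3 / 2\<close> in the penalty. Eight units of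
  \<open>C * vhat n X * q / n\<close> come from the diagonal and one from splitting
  \<open>4 * U\<close>; the total \<open>9 * 3 / 2 * C\<close> is covered by
  \<open>84 * C\<close>.\<close>

lemma deviation:
  assumes n: "1 \<le> n" and good: "good n X" and k: "1 \<le> k" "k \<le> 2 ^ I" and \<Delta>: "84 * C \<le> \<Delta>"
  shows "4 * zsum n k X \<le> \<Delta> * vhat n X * sqrt (real k) / real n + remainder n I X"
proof -
  obtain i where i: "i \<le> I" "k \<le> 2 ^ i" "2 ^ i \<le> 2 * k" using ex_power2_between[OF k] by blast
  define q where "q = sqrt (real (2 ^ i))"
  define U where "U = ustat n (2 ^ i) X"
  have q0: "0 < q" by (simp add: q_def)
  have q: "q \<le> 3 / 2 * sqrt (real k)"
  proof -
    have "real (2 ^ i) \<le> 2 * real k" using i(3) by (metis of_nat_le_iff of_nat_mult of_nat_numeral)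
    also have "\<dots> \<le> (3 / 2 * sqrt (real k))\<^sup>2" by (simp add: power_mult_distrib power2_eq_square)
    finally show ?thesis unfolding q_def by (intro real_le_lsqrt) auto
  qed
  \<comment> \<open>This lets the deterministic \<open>q / n\<close> from splitting the U-statistic
    be charged to the random penalty.\<close>
  have v: "1 \<le> C * vhat n X" using mult_mono[OF C vhat_ge_1[of n X]] C by simp
  have "4 * zsum n k X \<le> 4 * zsum n (2 ^ i) X" using zsum_mono[OF i(2)] by simp
  also have "\<dots> \<le> 4 * (2 * C * vhat n X * q / real n + 2 * (C + L) / real n + U)"
    unfolding q_def U_def by (intro mult_left_mono zsum_le n good) simp
  also have "\<dots> = 8 * (C * vhat n X * q / real n) + 8 * (C + L) / real n + 4 * U"
    by (simp add: add_divide_distrib algebra_simps)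
  finally have h1: "4 * zsum n k X \<le> 8 * (C * vhat n X * q / real n) + 8 * (C + L) / real n + 4 * U" .
  have h2: "4 * U \<le> q / real n + 4 * real n / q * U\<^sup>2"
  proof -
    have "0 \<le> (2 * real n * U - q)\<^sup>2 / (real n * q)" using q0 by simp
    also have "\<dots> = q / real n + 4 * real n / q * U\<^sup>2 - 4 * U"
      using q0 n by (simp add: power2_eq_square field_simps)
    finally show ?thesis by simp
  qed
  have h3: "q / real n \<le> C * vhat n X * q / real n"
    using v q0 mult_right_mono[OF v, of q] by (intro divide_right_mono) auto
  from h1 h2 h3 have "4 * zsum n k X \<le> 9 * (C * vhat n X * q / real n) + 8 * (C + L) / real n + 4 * real n / q * U\<^sup>2"
    by linarith
  moreover have "9 * (C * vhat n X * q / real n) \<le> \<Delta> * vhat n X * sqrt (real k) / real n"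
  proof -
    have "9 * (C * vhat n X * q) \<le> 9 * (C * vhat n X * (3 / 2 * sqrt (real k)))"
      using q C vhat_ge_1[of n X] by (intro mult_left_mono) auto
    also have "\<dots> = (27 / 2 * C) * (vhat n X * sqrt (real k))" by simp
    also have "\<dots> \<le> \<Delta> * (vhat n X * sqrt (real k))"
      using \<Delta> C vhat_ge_1[of n X] by (intro mult_right_mono) auto
    finally show ?thesis using divide_right_mono[of _ _ "real n"] by (fastforce simp: mult.assoc)
  qed
  moreover have "4 * real n / q * U\<^sup>2 \<le> (\<Sum>i\<le>I. 4 * real n / sqrt (2 ^ i) * (ustat n (2 ^ i) X)\<^sup>2)"
    unfolding q_def U_def using i(1)
      member_le_sum[of i "{..I}" "\<lambda>i. 4 * real n / sqrt (2 ^ i) * (ustat n (2 ^ i) X)\<^sup>2"] by simp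
  ultimately show ?thesis unfolding remainder_def by linarith
qed

section \<open>Expectations over the sample\<close>

abbreviation sample :: "nat \<Rightarrow> (nat \<Rightarrow> real) measure" where
  "sample n \<equiv> Pi\<^sub>M {1..n} (\<lambda>_. \<mu>)"

lemma prob_space_sample: "prob_space (sample n)"
  by (rule prob_space_PiM) (rule prob_space_mu)

lemma AE_good: "AE X in sample n. good n X"
  unfolding good_def
proof (rule AE_finite_allI)
  fix i assume "i \<in> {1..n}"
  then show "AE X in sample n. \<forall>k. (\<Sum>j<k. (\<phi> j (X i))\<^sup>2) \<le> C * (\<bar>X i\<bar> powr \<alpha> + 1) * sqrt (real k)"
    by (intro AE_PiM_component[OF prob_space_mu _ phi_sq_le_moment_mu])
qed simp

lemma ustat_second_moment:
  assumes n: "1 \<le> n" and m: "1 \<le> m"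
  shows "integrable (sample n) (\<lambda>X. (ustat n m X)\<^sup>2)"
    "(\<integral>X. (ustat n m X)\<^sup>2 \<partial>sample n) \<le> 2 * E1 * sqrt (real m) / (real n)\<^sup>2"
proof -
  interpret K: degenerate_kernel \<mu> "kern m" "\<Sum>j<m. psib j * psib j" by (rule degenerate_kern)
  let ?Q = "{p \<in> {1..n} \<times> {1..n}. fst p \<noteq> snd p}"
  note K2 = K.second_moment_off_diagonal_sum[of "{1..n}" ?Q, OF _ refl]
  have eq: "(ustat n m X)\<^sup>2 = (1 / (real n) ^ 4) * (\<Sum>p\<in>?Q. kern m (X (fst p)) (X (snd p)))\<^sup>2" for X
    by (simp add: ustat_def power_mult_distrib power_divide flip: power_mult)
  show "integrable (sample n) (\<lambda>X. (ustat n m X)\<^sup>2)"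
    unfolding eq by (intro integrable_mult_right K2(1)) simp
  have "(\<integral>X. (ustat n m X)\<^sup>2 \<partial>sample n)
      \<le> (1 / (real n) ^ 4) * (2 * (real (card {1..n}))\<^sup>2 * (\<integral>z. (\<integral>y. (kern m y z)\<^sup>2 \<partial>\<mu>) \<partial>\<mu>))"
    unfolding eq integral_mult_right_zero by (intro mult_left_mono K2(2)) auto
  also have "\<dots> \<le> (1 / (real n) ^ 4) * (2 * (real (card {1..n}))\<^sup>2 * (E1 * sqrt (real m)))"
    by (intro mult_left_mono kern_second_moment m) auto
  also have "\<dots> = 2 * E1 * sqrt (real m) / (real n)\<^sup>2"
    using n by (simp add: field_simps eval_nat_numeral)
  finally show "(\<integral>X. (ustat n m X)\<^sup>2 \<partial>sample n) \<le> 2 * E1 * sqrt (real m) / (real n)\<^sup>2" .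
qed

lemma remainder_expectation:
  assumes n: "1 \<le> n"
  shows "integrable (sample n) (remainder n I)"
    "(\<integral>X. remainder n I X \<partial>sample n) \<le> 8 * (C + L) / real n + 8 * E1 * (real I + 1) / real n"
proof -
  interpret S: prob_space "sample n" by (rule prob_space_sample)
  have u1: "integrable (sample n) (\<lambda>X. (ustat n (2 ^ i) X)\<^sup>2)" for i
    by (rule ustat_second_moment(1)[OF n]) simp
  have u2: "(\<integral>X. (ustat n (2 ^ i) X)\<^sup>2 \<partial>sample n) \<le> 2 * E1 * sqrt (real (2 ^ i)) / (real n)\<^sup>2" for i
    by (rule ustat_second_moment(2)[OF n]) simp
  have const: "has_bochner_integral (sample n) (\<lambda>_. r) r" for r :: real
    by (simp add: has_bochner_integral_iff S.prob_space del: One_nat_def)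
  have rem: "has_bochner_integral (sample n) (remainder n I)
      (8 * (C + L) / real n + (\<Sum>i\<le>I. 4 * real n / sqrt (2 ^ i) * (\<integral>X. (ustat n (2 ^ i) X)\<^sup>2 \<partial>sample n)))"
    unfolding remainder_def
    by (intro has_bochner_integral_add const has_bochner_integral_sum has_bochner_integral_mult_right
      has_bochner_integral_integrable u1)
  then show "integrable (sample n) (remainder n I)" by (rule integrable.intros)
  have eq: "(\<integral>X. remainder n I X \<partial>sample n)
      = 8 * (C + L) / real n + (\<Sum>i\<le>I. 4 * real n / sqrt (2 ^ i) * (\<integral>X. (ustat n (2 ^ i) X)\<^sup>2 \<partial>sample n))"
    using rem by (rule has_bochner_integral_integral_eq)
  have "(\<Sum>i\<le>I. 4 * real n / sqrt (2 ^ i) * (\<integral>X. (ustat n (2 ^ i) X)\<^sup>2 \<partial>sample n))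
      \<le> (\<Sum>i\<le>I. 4 * real n / sqrt (2 ^ i) * (2 * E1 * sqrt (real (2 ^ i)) / (real n)\<^sup>2))"
    by (intro sum_mono mult_left_mono u2) simp
  \<comment> \<open>Every dyadic level contributes equally: the prefactor \<open>n / q\<close> meets
    a second moment of order \<open>q / n\<^sup>2\<close>.\<close>
  also have "\<dots> = (\<Sum>i\<le>I. 8 * E1 / real n)"
  proof (rule sum.cong[OF refl])
    fix i
    define q where "q = sqrt (2 ^ i)"
    have "0 < q" by (simp add: q_def)
    then have "4 * real n / q * (2 * E1 * q / (real n)\<^sup>2) = 8 * E1 / real n"
      using n by (simp add: power2_eq_square field_simps)
    then show "4 * real n / sqrt (2 ^ i) * (2 * E1 * sqrt (real (2 ^ i)) / (real n)\<^sup>2) = 8 * E1 / real n"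
      unfolding q_def by (simp only: of_nat_power of_nat_numeral)
  qed
  also have "\<dots> = 8 * E1 * (real I + 1) / real n" by (simp add: algebra_simps)
  finally show "(\<integral>X. remainder n I X \<partial>sample n) \<le> 8 * (C + L) / real n + 8 * E1 * (real I + 1) / real n"
    unfolding eq by (rule add_left_mono)
qed

lemma vhat_expectation:
  assumes n: "1 \<le> n"
  shows "integrable (sample n) (vhat n)" "(\<integral>X. vhat n X \<partial>sample n) \<le> V"
proof -
  interpret S: prob_space "sample n" by (rule prob_space_sample)
  have comp: "distr (sample n) \<mu> (\<lambda>X. X i) = \<mu>" if "i \<in> {1..n}" for i
    using distr_PiM_component[of "{1..n}" "\<lambda>_. \<mu>" i] prob_space_mu that by simp
  have int: "integrable (sample n) (\<lambda>X. \<bar>X i\<bar> powr \<alpha>)" if "i \<in> {1..n}" for i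
    using integrable_distr[of "\<lambda>X. X i" "sample n" \<mu> "\<lambda>x. \<bar>x\<bar> powr \<alpha>"] that integrable_moment
    unfolding comp[OF that] by auto
  have le: "(\<integral>X. \<bar>X i\<bar> powr \<alpha> \<partial>sample n) \<le> 1 + L" if "i \<in> {1..n}" for i
    using integral_distr[of "\<lambda>X. X i" "sample n" \<mu> "\<lambda>x. \<bar>x\<bar> powr \<alpha>"] that integral_moment_le
    unfolding comp[OF that] by auto
  have const: "has_bochner_integral (sample n) (\<lambda>_. r) r" for r :: real
    by (simp add: has_bochner_integral_iff S.prob_space del: One_nat_def)
  have vh: "has_bochner_integral (sample n) (vhat n)
      (1 + (1 / real n) * (\<Sum>i=1..n. \<integral>X. \<bar>X i\<bar> powr \<alpha> \<partial>sample n))"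
    unfolding vhat_def
    by (intro has_bochner_integral_add const has_bochner_integral_sum has_bochner_integral_mult_right
      has_bochner_integral_integrable int)
  then show "integrable (sample n) (vhat n)" by (rule integrable.intros)
  have "(\<integral>X. vhat n X \<partial>sample n) = 1 + (1 / real n) * (\<Sum>i=1..n. \<integral>X. \<bar>X i\<bar> powr \<alpha> \<partial>sample n)"
    using vh by (rule has_bochner_integral_integral_eq)
  also have "\<dots> \<le> 1 + (1 / real n) * (\<Sum>i=1..n. 1 + L)"
    by (intro add_left_mono mult_left_mono sum_mono le) auto
  also have "\<dots> = V" using n by (simp add: V_def field_simps)
  finally show "(\<integral>X. vhat n X \<partial>sample n) \<le> V" .
qed

text \<open>The weights enter only as averages obeying the free energy bound, which covers both
  families. On good samples convexity replaces the aggregate by an average of single losses, each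
  bounded by an affine function of its contrast.\<close>

lemma risk_le:
  fixes w :: "(nat \<Rightarrow> real) \<Rightarrow> nat \<Rightarrow> real" and \<Delta> t :: real and n M I k0 :: nat
  defines "pen \<equiv> \<lambda>X k. \<Delta> * vhat n X * sqrt (real k) / real n"
  defines "\<gamma> \<equiv> \<lambda>X k. - (\<Sum>j<k. (ahat n X j)\<^sup>2) + pen X k"
  assumes n: "1 \<le> n" and M: "M \<le> 2 ^ I" and k0: "1 \<le> k0" "k0 \<le> M" and \<Delta>: "84 * C \<le> \<Delta>"
    and w0: "\<And>X k. 0 \<le> w X k" and w1: "\<And>X. (\<Sum>k=1..M. w X k) = 1"
    and free_energy: "\<And>X. (\<Sum>k=1..M. w X k * \<gamma> X k) \<le> \<gamma> X k0 + t"
  shows "(\<integral>\<^sup>+X. ennreal (\<integral>x. ((\<Sum>k=1..M. w X k * (\<Sum>j<k. ahat n X j * \<phi> j x)) - f x)\<^sup>2 \<partial>lborel) \<partial>sample n)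
    \<le> ennreal (5 * L * real k0 powr - s + 3 * \<Delta> * V * sqrt (real k0) / real n
      + 16 * (C + L + E1 * (real I + 1)) / real n + 2 * t)"
proof -
  interpret S: prob_space "sample n" by (rule prob_space_sample)
  define T where "T X = 5 * resid f k0 + 3 * \<Delta> * sqrt (real k0) / real n * vhat n X + 2 * remainder n I X + 2 * t" for X
  have pen0: "0 \<le> pen X k" for X k
    unfolding pen_def using \<Delta> C vhat_ge_1[of n X] by (intro divide_nonneg_nonneg mult_nonneg_nonneg) auto
  have dev: "4 * zsum n k X \<le> pen X k + remainder n I X" if "good n X" "1 \<le> k" "k \<le> M" for X k
    unfolding pen_def using that M by (intro deviation n \<Delta>) auto
  have pw: "(\<integral>x. ((\<Sum>k=1..M. w X k * (\<Sum>j<k. ahat n X j * \<phi> j x)) - f x)\<^sup>2 \<partial>lborel) \<le> T X"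
    if good: "good n X" for X
  proof -
    let ?f = "\<lambda>k x. \<Sum>j<k. ahat n X j * \<phi> j x"
    note sd = square_distance[OF f_borel f_sq, of "ahat n X"]
    have "(\<integral>x. ((\<Sum>k=1..M. w X k * ?f k x) - f x)\<^sup>2 \<partial>lborel)
        \<le> (\<integral>x. (\<Sum>k=1..M. w X k * (?f k x - f x)\<^sup>2) \<partial>lborel)"
    proof (rule integral_mono')
      show "integrable lborel (\<lambda>x. \<Sum>k=1..M. w X k * (?f k x - f x)\<^sup>2)"
        by (intro Bochner_Integration.integrable_sum integrable_mult_right sd)
      fix x
      have "((\<Sum>k=1..M. w X k * ?f k x) - f x)\<^sup>2 = (\<Sum>k=1..M. w X k * (?f k x - f x))\<^sup>2"
        using w1[of X] by (simp add: right_diff_distrib sum_subtractf flip: sum_distrib_right)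
      also have "\<dots> \<le> (\<Sum>k=1..M. w X k * (?f k x - f x)\<^sup>2)"
        by (intro square_weighted_mean_le w0 w1)
      finally show "((\<Sum>k=1..M. w X k * ?f k x) - f x)\<^sup>2 \<le> (\<Sum>k=1..M. w X k * (?f k x - f x)\<^sup>2)" .
      show "0 \<le> (\<Sum>k=1..M. w X k * (?f k x - f x)\<^sup>2)"
        using w0 by (intro sum_nonneg) auto
    qed
    also have "\<dots> = (\<Sum>k=1..M. w X k * (zsum n k X + resid f k))"
      by (simp add: sd zsum_def)
    \<comment> \<open>The contrast at \<open>k0\<close> joins the part independent of
      \<open>k\<close>, leaving only the weighted mean of the contrasts for
      \<open>free_energy\<close>.\<close>
    also have "\<dots> \<le> (\<Sum>k=1..M. w X k * ((5 * resid f k0 + 3 * pen X k0 + 2 * remainder n I X - 2 * \<gamma> X k0) + 2 * \<gamma> X k))"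
    proof (intro sum_mono mult_left_mono w0)
      fix k assume k: "k \<in> {1..M}"
      have "zsum n k X + resid f k \<le> 5 * resid f k0 + 3 * pen X k0 + 2 * remainder n I X + 2 * (\<gamma> X k - \<gamma> X k0)"
        unfolding \<gamma>_def zsum_def resid_def
        by (rule oracle_comparison[where R="remainder n I X"])
          (use dev[OF good, unfolded zsum_def] k k0 pen0 remainder_nonneg resid_nonneg[OF f_borel f_sq, unfolded resid_def] in auto)
      then show "zsum n k X + resid f k \<le> (5 * resid f k0 + 3 * pen X k0 + 2 * remainder n I X - 2 * \<gamma> X k0) + 2 * \<gamma> X k"
        by simp
    qed
    also have "\<dots> = (\<Sum>k=1..M. w X k) * (5 * resid f k0 + 3 * pen X k0 + 2 * remainder n I X - 2 * \<gamma> X k0)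
        + 2 * (\<Sum>k=1..M. w X k * \<gamma> X k)"
      unfolding distrib_left sum.distrib sum_distrib_right
      by (simp add: sum_distrib_left mult.left_commute)
    also have "\<dots> \<le> 5 * resid f k0 + 3 * pen X k0 + 2 * remainder n I X + 2 * t"
      using free_energy[of X] w1[of X] by simp
    also have "\<dots> = T X" by (simp add: T_def pen_def)
    finally show ?thesis .
  qed
  have intT: "integrable (sample n) T"
    unfolding T_def using vhat_expectation(1)[OF n] remainder_expectation(1)[OF n] by (simp del: One_nat_def)
  have T0: "0 \<le> T X" if "good n X" for X
    using pw[OF that] by (rule order_trans[rotated]) simp
  \<comment> \<open>Monotonicity of the nonnegative integral asks for no measurability of the left
    integrand, which arbitrary \<open>w\<close> would not guarantee.\<close>
  have "(\<integral>\<^sup>+X. ennreal (\<integral>x. ((\<Sum>k=1..M. w X k * (\<Sum>j<k. ahat n X j * \<phi> j x)) - f x)\<^sup>2 \<partial>lborel) \<partial>sample n)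
      \<le> (\<integral>\<^sup>+X. ennreal (T X) \<partial>sample n)"
    by (rule nn_integral_mono_AE[OF eventually_mono[OF AE_good ennreal_leI[OF pw]]])
  also have "\<dots> = ennreal (\<integral>X. T X \<partial>sample n)"
    by (rule nn_integral_eq_integral[OF intT eventually_mono[OF AE_good T0]])
  also have "(\<integral>X. T X \<partial>sample n) = 5 * resid f k0 + 3 * \<Delta> * sqrt (real k0) / real n * (\<integral>X. vhat n X \<partial>sample n)
      + 2 * (\<integral>X. remainder n I X \<partial>sample n) + 2 * t"
    unfolding T_def using vhat_expectation(1)[OF n] remainder_expectation(1)[OF n] by (simp add: S.prob_space del: One_nat_def)
  also have "\<dots> \<le> 5 * (L * real k0 powr - s) + 3 * \<Delta> * sqrt (real k0) / real n * V
      + 2 * (8 * (C + L) / real n + 8 * E1 * (real I + 1) / real n) + 2 * t"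
    using C \<Delta> by (intro add_mono order_refl mult_left_mono resid_le k0 vhat_expectation n remainder_expectation) auto
  also have "\<dots> = 5 * L * real k0 powr - s + 3 * \<Delta> * V * sqrt (real k0) / real n
      + 16 * (C + L + E1 * (real I + 1)) / real n + 2 * t"
    by (simp add: add_divide_distrib algebra_simps)
  finally show ?thesis by (simp add: ennreal_leI)
qed

end

section \<open>The two bases satisfy the assumptions\<close>

lemma basis_orthonormal_system: "orthonormal_system (dom_set c) (basis_fun c)"
proof (cases c)
  case Laguerre
  have "laguerre_fun j x = 0" if "x \<notin> {0<..}" for j x
    using that by (simp add: laguerre_fun_def)
  then show ?thesis
    using Laguerre by unfold_locales (auto simp: laguerre_orthonormal intro: laguerre_complete)
next
  case Hermite
  then show ?thesis
    by unfold_locales (auto simp: hermite_orthonormal intro: hermite_complete)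
qed

lemma basis_fun_borel[measurable]: "basis_fun c j \<in> borel_measurable borel"
  using basis_orthonormal_system[of c] by (rule orthonormal_system.phi_borel)

text \<open>Both dimension exponents are at most 1, so the linear bound is the common form for the
  two cases.\<close>

lemma sum_basis_sq_le:
  assumes "basis_bound_const c C"
  shows "(\<Sum>j<k. (basis_fun c j x)\<^sup>2) \<le> C * real k"
proof (cases "k = 0")
  case False
  then have k: "1 \<le> k" by simp
  let ?G = "\<lambda>x. \<Sum>j<k. (basis_fun c j x)\<^sup>2"
  have C: "1 \<le> C" using assms by (simp add: basis_bound_const_def)
  have "ennreal \<bar>?G x\<bar> \<le> sup_norm ?G" unfolding sup_norm_def by (rule SUP_upper) simp
  also have "\<dots> \<le> ennreal (C * real k powr dim_exp c)"
    using assms k by (simp add: basis_bound_const_def)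
  finally have "\<bar>?G x\<bar> \<le> C * real k powr dim_exp c"
    using C by (subst (asm) ennreal_le_iff) auto
  also have "\<dots> \<le> C * real k powr 1"
    using C k by (intro mult_left_mono powr_mono) (cases c; simp)+
  finally show ?thesis using k by simp
qed simp

text \<open>The assumed bound is tested on uniform densities on the sets where the pointwise bound fails.
  These sets are cut off near \<open>0\<close> and \<open>\<infinity>\<close> so that the moment on the right-hand side is finite.\<close>

lemma sum_basis_sq_le_moment_AE:
  assumes bb: "basis_bound_const c C"
  shows "AE x in lborel. x \<in> dom_set c \<longrightarrow>
    (\<forall>k. (\<Sum>j<k. (basis_fun c j x)\<^sup>2) \<le> C * (\<bar>x\<bar> powr mom_exp c + 1) * sqrt (real k))"
proof -
  have C: "1 \<le> C" using bb by (simp add: basis_bound_const_def)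
  have Ameas[measurable]: "dom_set c \<in> sets borel" by (cases c) auto
  define G where "G k x = (\<Sum>j<k. (basis_fun c j x)\<^sup>2)" for k x
  define g where "g k x = C * (\<bar>x\<bar> powr mom_exp c + 1) * sqrt (real k)" for k and x :: real
  have [measurable]: "G k \<in> borel_measurable borel" "g k \<in> borel_measurable borel" for k
    unfolding G_def g_def by measurable
  define E where "E k N = {x \<in> dom_set c. g k x < G k x \<and> 1 / real (Suc N) \<le> \<bar>x\<bar> \<and> \<bar>x\<bar> \<le> real (Suc N)}" for k N
  have Emeas[measurable]: "E k N \<in> sets borel" for k N
  proof -
    have "E k N = dom_set c \<inter> {x \<in> space borel. g k x < G k x \<and> 1 / real (Suc N) \<le> \<bar>x\<bar> \<and> \<bar>x\<bar> \<le> real (Suc N)}"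
      by (auto simp: E_def)
    also have "\<dots> \<in> sets borel" by measurable
    finally show ?thesis .
  qed
  have null: "emeasure lborel (E k N) = 0" if k: "1 \<le> k" for k N
  proof (rule ccontr)
    assume nz: "emeasure lborel (E k N) \<noteq> 0"
    have "emeasure lborel (E k N) \<le> emeasure lborel {- real (Suc N)..real (Suc N)}"
      by (intro emeasure_mono) (auto simp: E_def)
    also have "\<dots> < \<infinity>" by simp
    finally have fin: "emeasure lborel (E k N) < \<infinity>" .
    define p where "p = measure lborel (E k N)"
    have ep: "emeasure lborel (E k N) = ennreal p"
      using fin unfolding p_def by (intro emeasure_eq_ennreal_measure) auto
    have p: "0 < p" using nz ep by (metis ennreal_0 measure_nonneg order_le_less p_def)
    define f where "f x = indicator (E k N) x / p" for x
    have fmeas[measurable]: "f \<in> borel_measurable borel" unfolding f_def by measurable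
    have f0: "0 \<le> f x" for x using p by (simp add: f_def)
    have prob: "prob_space (law f)"
    proof (rule prob_spaceI)
      have "(\<integral>\<^sup>+x. ennreal (f x) \<partial>lborel) = (\<integral>\<^sup>+x. ennreal (1 / p) * indicator (E k N) x \<partial>lborel)"
        by (intro nn_integral_cong) (auto simp: f_def split: split_indicator)
      also have "\<dots> = ennreal (1 / p) * ennreal p" by (simp add: nn_integral_cmult_indicator ep)
      also have "\<dots> = 1" using p by (simp flip: ennreal_mult)
      finally show "emeasure (law f) (space (law f)) = 1" by (simp add: law_def emeasure_density)
    qed
    interpret P: prob_space "law f" by (rule prob)
    have dens: "prob_density_on (dom_set c) f"
      unfolding prob_density_on_def using prob f0 by (auto simp: f_def E_def)
    have AE_E: "AE x in law f. x \<in> E k N"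
      unfolding law_def by (subst AE_density) (auto simp: f_def split: split_indicator)
    have mcs: "h \<in> borel_measurable (law f)" if "h \<in> borel_measurable borel" for h :: "real \<Rightarrow> real"
      using that by (simp add: law_def)
    have G0: "0 \<le> G k x" for x by (simp add: G_def sum_nonneg)
    have g0: "0 \<le> g k x" for x using C by (simp add: g_def)
    have intG: "integrable (law f) (G k)"
      using sum_basis_sq_le[OF bb, where k=k] G0
      by (intro P.integrable_const_bound[where B="C * real k"] mcs) (auto simp: G_def)
    \<comment> \<open>On \<open>E k N\<close> the bound fails, so \<open>g k\<close> lies below
      \<open>G k\<close>, which is at most \<open>C * k\<close>.\<close>
    have intg: "integrable (law f) (g k)"
    proof (rule P.integrable_const_bound)
      show "AE x in law f. norm (g k x) \<le> C * real k"
        using AE_E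
      proof eventually_elim
        case (elim x)
        then show ?case
          using sum_basis_sq_le[OF bb, where k=k and x=x] g0[of x] by (simp add: E_def G_def)
      qed
    qed (simp add: mcs)
    have "(\<integral>\<^sup>+x. ennreal (G k x) \<partial>law f) = (\<Sum>j<k. \<integral>\<^sup>+x. ennreal ((basis_fun c j x)\<^sup>2) \<partial>law f)"
      unfolding G_def by (subst nn_integral_sum[symmetric]) (auto simp: law_def intro!: nn_integral_cong sum_ennreal[symmetric])
    also have "\<dots> \<le> ennreal C * (abs_moment f (mom_exp c) + 1) * ennreal (real k powr (1 / 2))"
      using bb k dens by (simp add: basis_bound_const_def)
    also have "\<dots> = (\<integral>\<^sup>+x. ennreal (g k x) \<partial>law f)"
    proof -
      have "(\<integral>\<^sup>+x. ennreal (g k x) \<partial>law f)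
          = (\<integral>\<^sup>+x. ennreal C * ((ennreal (\<bar>x\<bar> powr mom_exp c) + 1) * ennreal (real k powr (1 / 2))) \<partial>law f)"
        unfolding g_def using C k
        by (intro nn_integral_cong) (auto simp: ennreal_mult powr_half_sqrt mult.assoc)
      also have "\<dots> = ennreal C * ((abs_moment f (mom_exp c) + 1) * ennreal (real k powr (1 / 2)))"
        unfolding abs_moment_def
        by (subst nn_integral_cmult, simp add: law_def, subst nn_integral_multc, simp add: law_def,
            subst nn_integral_add) (auto simp: law_def P.emeasure_space_1[unfolded law_def, simplified])
      finally show ?thesis by (simp add: mult.assoc)
    qed
    finally have "ennreal (\<integral>x. G k x \<partial>law f) \<le> ennreal (\<integral>x. g k x \<partial>law f)"
      using intG intg by (simp add: nn_integral_eq_integral G0 g0)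
    then have "(\<integral>x. G k x \<partial>law f) \<le> (\<integral>x. g k x \<partial>law f)"
      by (simp add: g0 integral_nonneg)
    then have le0: "(\<integral>x. G k x - g k x \<partial>law f) \<le> 0" using intG intg by simp
    have nn: "AE x in law f. 0 \<le> G k x - g k x"
      using AE_E by eventually_elim (simp add: E_def)
    have "(\<integral>x. G k x - g k x \<partial>law f) = 0"
      using le0 integral_nonneg_AE[OF nn] by simp
    then have "AE x in law f. G k x - g k x = 0"
      using integral_nonneg_eq_0_iff_AE[OF _ nn] intG intg by simp
    with AE_E have "AE x in law f. False" by eventually_elim (simp add: E_def)
    then show False by simp
  qed
  have "AE x in lborel. 1 \<le> k \<longrightarrow> x \<notin> E k N" for k N
    by (cases "1 \<le> k") (auto intro!: AE_not_in null_setsI null)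
  then have "AE x in lborel. \<forall>k N. 1 \<le> k \<longrightarrow> x \<notin> E k N"
    unfolding AE_all_countable by blast
  \<comment> \<open>The cutoffs exclude the origin from every \<open>E k N\<close>, so this point is
    discarded separately.\<close>
  with AE_lborel_singleton[of "0::real"] show ?thesis
  proof eventually_elim
    case (elim x)
    show ?case
    proof (intro impI allI)
      fix k assume x: "x \<in> dom_set c"
      show "(\<Sum>j<k. (basis_fun c j x)\<^sup>2) \<le> C * (\<bar>x\<bar> powr mom_exp c + 1) * sqrt (real k)"
      proof (cases "k = 0")
        case False
        obtain N1 :: nat where N1: "\<bar>x\<bar> \<le> real N1" using real_arch_simple by blast
        obtain N2 :: nat where N2: "1 / \<bar>x\<bar> \<le> real N2" using real_arch_simple by blast
        define N where "N = max N1 N2"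
        have "\<bar>x\<bar> \<le> real (Suc N)" using N1 by (simp add: N_def)
        moreover have "1 / real (Suc N) \<le> \<bar>x\<bar>"
        proof -
          have "1 / \<bar>x\<bar> \<le> real (Suc N)" using N2 by (simp add: N_def)
          then show ?thesis using elim by (simp add: field_simps)
        qed
        moreover have "x \<notin> E k N" using elim False by auto
        ultimately show ?thesis using x by (simp add: E_def G_def g_def not_less)
      qed simp
    qed
  qed
qed

lemma density_class_sobolev_density:
  assumes bb: "basis_bound_const c C" and f: "f \<in> density_class c s L" and s: "1 < s" and L: "0 < L"
  shows "sobolev_density (dom_set c) (basis_fun c) f s L C (mom_exp c)"
proof -
  interpret orthonormal_system "dom_set c" "basis_fun c" by (rule basis_orthonormal_system)
  have C: "1 \<le> C" using bb by (simp add: basis_bound_const_def)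
  have f_L2: "f \<in> borel_measurable borel" "set_integrable lborel (dom_set c) (\<lambda>x. (f x)\<^sup>2)"
    and dens: "prob_density_on (dom_set c) f"
    and ser: "(\<Sum>k. ennreal (real k powr s * \<bar>basis_coeff c f k\<bar>\<^sup>2)) \<le> ennreal L"
    and mom: "abs_moment f (2 * mom_exp c) \<le> ennreal L"
    using f by (auto simp: density_class_def L2_on_def)
  note [measurable] = f_L2(1)
  have f0: "0 \<le> f x" and fsupp: "x \<notin> dom_set c \<Longrightarrow> f x = 0" for x
    using dens by (auto simp: prob_density_on_def)
  have sq: "integrable lborel (\<lambda>x. (f x)\<^sup>2)"
  proof -
    have "indicator (dom_set c) x *\<^sub>R (f x)\<^sup>2 = (f x)\<^sup>2" for x
      using fsupp[of x] by (auto split: split_indicator)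
    then show ?thesis using f_L2(2) by (simp only: set_integrable_def)
  qed
  have co: "basis_coeff c f k = coef f k" for k
  proof -
    have "indicator (dom_set c) x *\<^sub>R (f x * basis_fun c k x) = f x * basis_fun c k x" for x
      using fsupp[of x] by (auto split: split_indicator)
    then show ?thesis by (simp only: basis_coeff_def inner_on_def coef_def set_lebesgue_integral_def)
  qed
  show ?thesis
  proof (intro sobolev_density.intro sobolev_density_axioms.intro)
    have "prob_space (law f)" using dens by (simp add: prob_density_on_def)
    then have "emeasure (law f) (space (law f)) = 1" by (rule prob_space.emeasure_space_1)
    then have "(\<integral>\<^sup>+x. ennreal (f x) \<partial>lborel) = ennreal 1"
      by (simp add: law_def emeasure_density)
    then show "has_bochner_integral lborel f 1"
      by (intro has_bochner_integral_nn_integral) (auto simp: f0)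
    show "(\<Sum>j<N. real j powr s * (coef f j)\<^sup>2) \<le> L" for N
    proof -
      have "ennreal (\<Sum>j<N. real j powr s * (coef f j)\<^sup>2)
          = (\<Sum>j<N. ennreal (real j powr s * \<bar>basis_coeff c f j\<bar>\<^sup>2))"
        by (subst sum_ennreal) (auto simp: co)
      also have "\<dots> \<le> (\<Sum>j. ennreal (real j powr s * \<bar>basis_coeff c f j\<bar>\<^sup>2))"
        by (rule sum_le_suminf) auto
      finally show ?thesis using ser L by (meson ennreal_le_iff less_imp_le order_trans)
    qed
    show "(\<integral>\<^sup>+x. ennreal (\<bar>x\<bar> powr (2 * mom_exp c)) * ennreal (f x) \<partial>lborel) \<le> ennreal L"
      using mom unfolding abs_moment_def law_def
      by (subst (asm) nn_integral_density) (auto simp: mult.commute)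
  qed (use s L C f0 fsupp sq sum_basis_sq_le[OF bb] sum_basis_sq_le_moment_AE[OF bb] in
      \<open>auto intro: basis_orthonormal_system\<close>)
qed

text \<open>The distance identity with target 0 is the finite Parseval formula; it expresses the
  contrast through the empirical coefficients and the penalty.\<close>

lemma norm_on_f_hat_sq: "(norm_on (dom_set c) (f_hat c n X k))\<^sup>2 = (\<Sum>j<k. (a_hat c n X j)\<^sup>2)"
proof -
  interpret orthonormal_system "dom_set c" "basis_fun c" by (rule basis_orthonormal_system)
  have "indicator (dom_set c) x *\<^sub>R (f_hat c n X k x * f_hat c n X k x)
      = ((\<Sum>j<k. a_hat c n X j * basis_fun c j x) - (\<lambda>_. 0) x)\<^sup>2" for x
    using phi_supp[of x] by (auto simp: f_hat_def power2_eq_square split: split_indicator)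
  then have "inner_on (dom_set c) (f_hat c n X k) (f_hat c n X k) = (\<Sum>j<k. (a_hat c n X j)\<^sup>2)"
    unfolding inner_on_def set_lebesgue_integral_def
    by (simp only: square_distance(2)[of "\<lambda>_. 0"] borel_measurable_const) (simp add: resid_def coef_def square_distance(2)[of "\<lambda>_. 0", simplified])
  then show ?thesis unfolding norm_on_def by (simp add: sum_nonneg)
qed

section \<open>The rate\<close>

text \<open>Truncating the oracle dimension at \<open>max_dim\<close> may cost only a constant
  factor, for which a linear lower bound is enough; the upper bound \<open>n\<^sup>2\<close> keeps
  the number of dyadic levels logarithmic.\<close>

lemma max_dim_bounds:
  "\<exists>c0>0. c0 \<le> 1 / 2 \<and> (\<forall>n\<ge>3. 1 \<le> max_dim c n \<longrightarrow>
     c0 * real n \<le> real (max_dim c n) \<and> max_dim c n \<le> n\<^sup>2)"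
proof (cases c)
  case Hermite
  have "1 / 2 * real n \<le> real (n\<^sup>2)" if "3 \<le> n" for n
  proof -
    have "n \<le> n\<^sup>2" by (simp add: power2_eq_square)
    then have "real n \<le> real (n\<^sup>2)" by (simp only: of_nat_le_iff)
    then show ?thesis by linarith
  qed
  then show ?thesis using Hermite by (intro exI[of _ "1 / 2"]) auto
next
  case Laguerre
  \<comment> \<open>\<open>256 * 600 ^ 4\<close> comes from the fourth power of
    \<open>ln n \<le> 4 * n powr (1 / 4)\<close>; the factor 2 absorbs the rounding down, as
    \<open>max_dim c n \<ge> 1\<close>.\<close>
  define c0 :: real where "c0 = 1 / (2 * 256 * 600 ^ 4)"
  have "c0 * real n \<le> real (max_dim c n) \<and> max_dim c n \<le> n\<^sup>2"
    if n: "3 \<le> n" and M: "1 \<le> max_dim c n" for n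
  proof -
    define y where "y = (real n)\<^sup>2 * (600 * ln (real n)) powi (- 4)"
    have M_eq: "max_dim c n = nat \<lfloor>y\<rfloor>" using Laguerre by (simp add: y_def)
    have ln1: "1 \<le> ln (real n)"
    proof -
      have "exp 1 \<le> real n" using exp_le n by linarith
      then show ?thesis using n by (subst ln_ge_iff) auto
    qed
    have y: "y = (real n)\<^sup>2 / (600 * ln (real n)) ^ 4"
      unfolding y_def by (simp only: power_int_minus power_int_numeral divide_inverse)
    have "real (max_dim c n) = of_int \<lfloor>y\<rfloor>" using M by (simp add: M_eq)
    then have fl: "real (max_dim c n) \<le> y" "y < real (max_dim c n) + 1" by linarith+
    have "ln (real n) \<le> 4 * real n powr (1 / 4)"
      using ln_powr_bound[of "real n" "1 / 4"] n by simp
    then have "(600 * ln (real n)) ^ 4 \<le> (600 * (4 * real n powr (1 / 4))) ^ 4"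
      using ln1 by (intro power_mono) auto
    also have "\<dots> = 600 ^ 4 * 256 * real n"
      using n by (simp add: power_mult_distrib powr_power)
    finally have den: "(600 * ln (real n)) ^ 4 \<le> 600 ^ 4 * 256 * real n" .
    have "(real n)\<^sup>2 / (600 ^ 4 * 256 * real n) \<le> y"
      unfolding y using den ln1 n by (intro divide_left_mono mult_pos_pos zero_less_power) auto
    moreover have "(real n)\<^sup>2 / (600 ^ 4 * 256 * real n) = 2 * (c0 * real n)"
      using n by (simp add: c0_def power2_eq_square)
    ultimately have "2 * (c0 * real n) \<le> y" by simp
    moreover have "1 \<le> real (max_dim c n)" using M by simp
    ultimately have "c0 * real n \<le> real (max_dim c n)" using fl by linarith
    moreover have "y \<le> (real n)\<^sup>2"
    proof -
      have "1 \<le> (600 * ln (real n)) ^ 4" using ln1 by (intro one_le_power) simp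
      then have "(real n)\<^sup>2 / (600 * ln (real n)) ^ 4 \<le> (real n)\<^sup>2 / 1"
        by (intro divide_left_mono) auto
      then show ?thesis by (simp add: y)
    qed
    then have "real (max_dim c n) \<le> real (n\<^sup>2)" using fl(1) unfolding of_nat_power by linarith
    then have "max_dim c n \<le> n\<^sup>2" by (simp only: of_nat_le_iff)
    ultimately show ?thesis by simp
  qed
  moreover have "0 < c0" "c0 \<le> 1 / 2" by (simp_all add: c0_def)
  ultimately show ?thesis by blast
qed

text \<open>The exponent \<open>r\<close> balances \<open>k powr - s\<close> against
  \<open>sqrt k / n\<close>. Since \<open>r \<le> 1\<close>, truncation at
  \<open>M \<ge> c0 * n\<close> keeps \<open>k0\<close> above \<open>c0 * n powr r\<close>, and
  \<open>c0 \<le> 1 / 2\<close> covers the rounding.\<close>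

lemma rate_arithmetic:
  fixes s L D a E c0 :: real
  assumes s: "1 < s" and n: "3 \<le> n" and M1: "1 \<le> M" and Mle: "M \<le> n\<^sup>2"
    and c0: "0 < c0" "c0 \<le> 1 / 2" and Mge: "c0 * real n \<le> real M"
    and nonneg: "0 \<le> L" "0 \<le> D" "0 \<le> a" "0 \<le> E"
  shows "\<exists>k0 I. 1 \<le> k0 \<and> k0 \<le> M \<and> M \<le> 2 ^ I \<and>
    5 * L * real k0 powr - s + D * sqrt (real k0) / real n + 16 * (a + E * (real I + 1)) / real n
      + 2 * (ln (real M) / real n)
    \<le> (5 * L * c0 powr - s + D + (16 * (a + 9 * E) + 4) * (2 * s + 1)) * real n powr (- 2 * s / (2 * s + 1))"
proof -
  define r where "r = 2 / (2 * s + 1)"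
  define \<rho> where "\<rho> = - 2 * s / (2 * s + 1)"
  have r: "0 < r" "r \<le> 1" using s by (auto simp: r_def)
  have rs: "r * - s = \<rho>" by (simp add: r_def \<rho>_def)
  have r2: "r / 2 - 1 = \<rho>" using s by (simp add: r_def \<rho>_def field_simps)
  have x1: "1 \<le> real n powr r" using n r by (intro ge_one_powr_ge_zero) auto
  define k0 where "k0 = min (nat \<lfloor>real n powr r\<rfloor>) M"
  have fl: "real (nat \<lfloor>real n powr r\<rfloor>) \<le> real n powr r" "real n powr r < real (nat \<lfloor>real n powr r\<rfloor>) + 1"
    using x1 by linarith+
  have k01: "1 \<le> k0" using x1 M1 unfolding k0_def by (simp add: le_nat_iff)
  have k0M: "k0 \<le> M" by (simp add: k0_def)
  have k0up: "real k0 \<le> real n powr r" 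
  proof -
    have "real k0 \<le> real (nat \<lfloor>real n powr r\<rfloor>)" unfolding k0_def of_nat_le_iff by simp
    then show ?thesis using fl(1) by linarith
  qed
  have k0low: "c0 * real n powr r \<le> real k0"
  proof -
    have "real n powr r \<le> real n powr 1" using n r by (intro powr_mono) auto
    then have "c0 * real n powr r \<le> c0 * real n" using c0 by (intro mult_left_mono) auto
    then have 1: "c0 * real n powr r \<le> real M" using Mge by simp
    have "c0 * real n powr r \<le> 1 / 2 * real n powr r" using c0 by (intro mult_right_mono) auto
    also have "\<dots> \<le> real (nat \<lfloor>real n powr r\<rfloor>)"
    proof -
      have "1 \<le> nat \<lfloor>real n powr r\<rfloor>" using x1 by (simp add: le_nat_iff)
      then have "1 \<le> real (nat \<lfloor>real n powr r\<rfloor>)" by linarith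
      then show ?thesis using fl(2) by linarith
    qed
    finally show ?thesis using 1 by (simp add: k0_def min_def)
  qed
  have ln1: "1 \<le> ln (real n)"
  proof -
    have "exp 1 \<le> real n" using exp_le n by linarith
    then show ?thesis using n by (subst ln_ge_iff) auto
  qed
  have bias: "5 * L * real k0 powr - s \<le> 5 * L * c0 powr - s * real n powr \<rho>"
  proof -
    have "real k0 powr - s \<le> (c0 * real n powr r) powr - s"
      using k0low c0 n s by (intro powr_mono2') auto
    also have "\<dots> = c0 powr - s * real n powr \<rho>"
      using c0 n by (simp add: powr_mult powr_powr rs[symmetric])
    finally have "5 * L * real k0 powr - s \<le> 5 * L * (c0 powr - s * real n powr \<rho>)"
      using nonneg by (intro mult_left_mono) auto
    then show ?thesis by simp
  qed
  have var: "D * sqrt (real k0) / real n \<le> D * real n powr \<rho>"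
  proof -
    have "sqrt (real k0) \<le> sqrt (real n powr r)" using k0up by simp
    also have "\<dots> = real n powr (r / 2)" using n by (simp add: powr_half_sqrt[symmetric] powr_powr)
    finally have "sqrt (real k0) / real n \<le> real n powr (r / 2) / real n" by (intro divide_right_mono) auto
    also have "\<dots> = real n powr \<rho>" using n by (simp add: r2[symmetric] powr_diff)
    finally have "D * (sqrt (real k0) / real n) \<le> D * real n powr \<rho>"
      using nonneg by (intro mult_left_mono) auto
    then show ?thesis by simp
  qed
  \<comment> \<open>The exponent \<open>1 / (2 * s + 1)\<close> is exactly what separates
    \<open>1 / n\<close> from the rate, so the logarithm costs the factor
    \<open>2 * s + 1\<close>.\<close>
  have log: "ln (real n) / real n \<le> (2 * s + 1) * real n powr \<rho>"
  proof -
    have "ln (real n) \<le> real n powr (1 / (2 * s + 1)) / (1 / (2 * s + 1))"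
      using n s by (intro ln_powr_bound) auto
    then have "ln (real n) / real n \<le> (2 * s + 1) * real n powr (1 / (2 * s + 1)) / real n"
      by (intro divide_right_mono) (auto simp: mult.commute)
    also have "\<dots> = (2 * s + 1) * real n powr (1 / (2 * s + 1) - 1)"
      using n by (simp add: powr_diff)
    also have "1 / (2 * s + 1) - 1 = \<rho>" using s by (simp add: \<rho>_def field_simps)
    finally show ?thesis .
  qed
  have "n \<le> 2 ^ n" by (rule less_imp_le) (rule less_exp)
  then obtain J where J: "n \<le> 2 ^ J" "2 ^ J \<le> 2 * n" using ex_power2_between[of n n] n by auto
  \<comment> \<open>\<open>2 ^ J\<close> lies between \<open>n\<close> and \<open>2 * n\<close>, so
    its square reaches \<open>M \<le> n\<^sup>2\<close>. The 9 below comes from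
    \<open>J \<le> 4 * ln n\<close> and \<open>1 \<le> ln n\<close>.\<close>
  define I where "I = 2 * J"
  have "n\<^sup>2 \<le> (2 ^ J)\<^sup>2" using J(1) by (rule power_mono) simp
  then have MI: "M \<le> 2 ^ I" using Mle by (simp add: I_def power_mult[symmetric] mult.commute)
  have Iln: "real I + 1 \<le> 9 * ln (real n)"
  proof -
    have "real J * ln 2 = ln (2 ^ J)" by (simp add: ln_realpow)
    also have "\<dots> \<le> ln (2 * real n)"
    proof -
      have "real (2 ^ J) \<le> real (2 * n)" using J(2) by (simp only: of_nat_le_iff)
      then show ?thesis using n by (subst ln_le_cancel_iff) auto
    qed
    also have "\<dots> = ln 2 + ln (real n)" using n by (simp add: ln_mult)
    also have "\<dots> \<le> 2 * ln (real n)" using ln_2_less_1 ln1 by simp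
    finally have "real J * ln 2 \<le> 2 * ln (real n)" .
    moreover have "real J * (1 / 2) \<le> real J * ln 2"
      using ln2_ge_two_thirds by (intro mult_left_mono) auto
    ultimately have "real J \<le> 4 * ln (real n)" by linarith
    then show ?thesis using ln1 by (simp add: I_def)
  qed
  have logterms: "16 * (a + E * (real I + 1)) / real n + 2 * (ln (real M) / real n)
      \<le> (16 * (a + 9 * E) + 4) * (2 * s + 1) * real n powr \<rho>"
  proof -
    have "a + E * (real I + 1) \<le> a * ln (real n) + E * (9 * ln (real n))"
      using nonneg ln1 Iln by (intro add_mono mult_left_mono) (auto simp: mult_le_cancel_left1)
    then have "16 * (a + E * (real I + 1)) \<le> 16 * (a + 9 * E) * ln (real n)" by (simp add: algebra_simps)
    moreover have "ln (real M) \<le> 2 * ln (real n)"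
    proof -
      have "real M \<le> (real n)\<^sup>2" using Mle by (metis of_nat_le_iff of_nat_power)
      then have "ln (real M) \<le> ln ((real n)\<^sup>2)" using M1 n by (subst ln_le_cancel_iff) auto
      then show ?thesis using n by (simp add: ln_realpow)
    qed
    ultimately have "16 * (a + E * (real I + 1)) + 2 * ln (real M) \<le> (16 * (a + 9 * E) + 4) * ln (real n)"
      by (simp add: distrib_right)
    then have "(16 * (a + E * (real I + 1)) + 2 * ln (real M)) / real n
        \<le> (16 * (a + 9 * E) + 4) * ln (real n) / real n"
      by (intro divide_right_mono) auto
    also have "\<dots> = (16 * (a + 9 * E) + 4) * (ln (real n) / real n)" by simp
    also have "\<dots> \<le> (16 * (a + 9 * E) + 4) * ((2 * s + 1) * real n powr \<rho>)"
      using nonneg log by (intro mult_left_mono) auto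
    finally show ?thesis by (simp add: add_divide_distrib mult.assoc)
  qed
  have "5 * L * real k0 powr - s + D * sqrt (real k0) / real n + 16 * (a + E * (real I + 1)) / real n
      + 2 * (ln (real M) / real n)
    \<le> 5 * L * c0 powr - s * real n powr \<rho> + D * real n powr \<rho> + (16 * (a + 9 * E) + 4) * (2 * s + 1) * real n powr \<rho>"
    using bias var logterms by linarith
  also have "\<dots> = (5 * L * c0 powr - s + D + (16 * (a + 9 * E) + 4) * (2 * s + 1)) * real n powr \<rho>"
    by (simp add: distrib_right)
  finally show ?thesis using k01 k0M MI unfolding \<rho>_def by blast
qed

text \<open>For Bayesian weights this is the Gibbs bound at inverse temperature
  \<open>\<kappa> * n\<close>, and \<open>\<kappa> \<ge> 1\<close> can only lower the entropy term.
  For selection weights the average is the minimum itself and the logarithm is a nonnegative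
  surplus.\<close>

lemma weights_free_energy:
  assumes w: "w = bayes_weights c \<Delta> \<kappa> \<or> w = selection_weights c \<Delta>"
    and \<kappa>: "1 \<le> \<kappa>" and n: "1 \<le> n" and k0: "1 \<le> k0" "k0 \<le> max_dim c n"
  shows "0 \<le> w n X k" "(\<Sum>k=1..max_dim c n. w n X k) = 1"
    "(\<Sum>k=1..max_dim c n. w n X k * pen_contrast c \<Delta> n X k)
      \<le> pen_contrast c \<Delta> n X k0 + ln (real (max_dim c n)) / real n"
proof -
  let ?S = "{1..max_dim c n}" and ?g = "pen_contrast c \<Delta> n X"
  have ln0: "0 \<le> ln (real (max_dim c n)) / real n" using k0 by simp
  have "0 \<le> w n X k \<and> (\<Sum>k\<in>?S. w n X k) = 1 \<and>
    (\<Sum>k\<in>?S. w n X k * ?g k) \<le> ?g k0 + ln (real (max_dim c n)) / real n"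
    using w
  proof
    assume w: "w = bayes_weights c \<Delta> \<kappa>"
    let ?Z = "\<Sum>l\<in>?S. exp (- (\<kappa> * real n) * ?g l)"
    have Z: "0 < ?Z" using k0 by (intro sum_pos) auto
    have w_eq: "w n X k = exp (- (\<kappa> * real n) * ?g k) / ?Z" for k
      by (simp add: w bayes_weights_def)
    have "(\<Sum>k\<in>?S. w n X k * ?g k) \<le> ?g k0 + ln (real (card ?S)) / (\<kappa> * real n)"
      unfolding w_eq using k0 \<kappa> n by (intro gibbs_average_le) auto
    also have "ln (real (card ?S)) / (\<kappa> * real n) \<le> ln (real (max_dim c n)) / real n"
    proof -
      have "1 * real n \<le> \<kappa> * real n" using \<kappa> by (intro mult_right_mono) auto
      then show ?thesis using k0 n \<kappa> by (simp add: divide_left_mono)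
    qed
    finally have "(\<Sum>k\<in>?S. w n X k * ?g k) \<le> ?g k0 + ln (real (max_dim c n)) / real n" by simp
    moreover have "(\<Sum>k\<in>?S. w n X k) = 1" unfolding w_eq using Z by (simp flip: sum_divide_distrib)
    moreover have "0 \<le> w n X k" unfolding w_eq using Z by (intro divide_nonneg_pos) auto
    ultimately show ?thesis by blast
  next
    assume w: "w = selection_weights c \<Delta>"
    let ?P = "\<lambda>k. k \<in> ?S \<and> (\<forall>l\<in>?S. ?g k \<le> ?g l)"
    have "finite ?S" "?S \<noteq> {}" using k0 by auto
    then obtain m where "?P m"
      by (metis (no_types, lifting) arg_min_if_finite(1,2) not_le)
    then have P: "?P (k_hat c \<Delta> n X)" unfolding k_hat_def by (rule LeastI)
    have "(\<Sum>k\<in>?S. w n X k * ?g k) = (\<Sum>k\<in>?S. if k = k_hat c \<Delta> n X then ?g k else 0)"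
      by (intro sum.cong) (auto simp: w selection_weights_def)
    also have "\<dots> = ?g (k_hat c \<Delta> n X)" using P by (subst sum.delta) auto
    also have "\<dots> \<le> ?g k0" using P k0 by auto
    finally have "(\<Sum>k\<in>?S. w n X k * ?g k) \<le> ?g k0 + ln (real (max_dim c n)) / real n"
      using ln0 by simp
    moreover have "(\<Sum>k\<in>?S. w n X k) = 1"
      unfolding w selection_weights_def using P by (subst sum.delta) auto
    ultimately show ?thesis by (simp add: w selection_weights_def)
  qed
  then show "0 \<le> w n X k" "(\<Sum>k\<in>?S. w n X k) = 1"
    "(\<Sum>k\<in>?S. w n X k * ?g k) \<le> ?g k0 + ln (real (max_dim c n)) / real n" by blast+
qed

lemma (in sobolev_density) sample_law_eq: "sample_law n f = sample n"
  by (simp add: sample_law_def)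

theorem theorem3p6:
  fixes c :: setting
    and C\<^sub>\<phi> \<Delta> \<kappa> s L :: real
    and w :: "nat \<Rightarrow> (nat \<Rightarrow> real) \<Rightarrow> nat \<Rightarrow> real"
  assumes "basis_bound_const c C\<^sub>\<phi>"
    and "\<Delta> \<ge> 84 * C\<^sub>\<phi>"
    and "\<kappa> \<ge> 1"
    and "w = bayes_weights c \<Delta> \<kappa> \<or> w = selection_weights c \<Delta>"
    and "L > 0"
    and "s > 1"
  shows "\<exists>C :: real. \<forall>n::nat\<ge>3. max_dim c n \<ge> 1 \<longrightarrow>
           (SUP f\<in>density_class c s L. risk c w n f)
             \<le> ennreal (C * real n powr (- 2 * s / (2 * s + 1)))"
proof -
  have C1: "1 \<le> C\<^sub>\<phi>" using assms(1) by (simp add: basis_bound_const_def)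
  obtain c0 where c0: "0 < c0" "c0 \<le> 1 / 2" and dims: "\<And>n. 3 \<le> n \<Longrightarrow> 1 \<le> max_dim c n \<Longrightarrow>
      c0 * real n \<le> real (max_dim c n) \<and> max_dim c n \<le> n\<^sup>2"
    using max_dim_bounds[of c] by blast
  \<comment> \<open>The exported locale constants do not depend on \<open>f\<close>, which makes
    \<open>K\<close> uniform over the class. The maxima with 0 supply signs that the locale proves
    only once a density is given.\<close>
  define v where "v = sobolev_density.V L"
  define E where "E = max 0 (sobolev_density.E1 s L C\<^sub>\<phi>)"
  define D where "D = max 0 (3 * \<Delta> * v)"
  define K where "K = 5 * L * c0 powr - s + D + (16 * ((C\<^sub>\<phi> + L) + 9 * E) + 4) * (2 * s + 1)"
  have "risk c w n f \<le> ennreal (K * real n powr (- 2 * s / (2 * s + 1)))"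
    if n: "3 \<le> n" and M: "1 \<le> max_dim c n" and f: "f \<in> density_class c s L" for n f
  proof -
    interpret sobolev_density "dom_set c" "basis_fun c" f s L "C\<^sub>\<phi>" "mom_exp c"
      by (rule density_class_sobolev_density[OF assms(1) f assms(6,5)])
    have E_eq: "E = sobolev_density.E1 s L C\<^sub>\<phi>" using E1_nonneg by (simp add: E_def)
    have D_eq: "D = 3 * \<Delta> * v" using V_pos assms(2) C1 by (simp add: D_def v_def)
    have "0 \<le> L" "0 \<le> D" "0 \<le> C\<^sub>\<phi> + L" "0 \<le> E"
      using assms(5) C1 by (auto simp: D_def E_def)
    from rate_arithmetic[OF assms(6) n M _ c0 _ this] dims[OF n M]
    obtain k0 I where k0: "1 \<le> k0" "k0 \<le> max_dim c n" and I: "max_dim c n \<le> 2 ^ I"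
      and le: "5 * L * real k0 powr - s + D * sqrt (real k0) / real n + 16 * ((C\<^sub>\<phi> + L) + E * (real I + 1)) / real n
        + 2 * (ln (real (max_dim c n)) / real n) \<le> K * real n powr (- 2 * s / (2 * s + 1))"
      unfolding K_def by blast
    have n1: "1 \<le> n" using n by simp
    have ah: "ahat n X j = a_hat c n X j" for X j by (simp add: ahat_def a_hat_def)
    have vh: "vhat n X = v_hat c n X" for X by (simp add: vhat_def v_hat_def)
    have pc: "pen_contrast c \<Delta> n X k
        = - (\<Sum>j<k. (ahat n X j)\<^sup>2) + \<Delta> * vhat n X * sqrt (real k) / real n" for X k
      by (simp add: pen_contrast_def norm_on_f_hat_sq pen_hat_def ah vh powr_half_sqrt)
    have nrm: "(norm_on (dom_set c) (\<lambda>x. f_agg c w n X x - f x))\<^sup>2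
        = (\<integral>x. ((\<Sum>k=1..max_dim c n. w n X k * (\<Sum>j<k. ahat n X j * basis_fun c j x)) - f x)\<^sup>2 \<partial>lborel)" for X
    proof -
      let ?u = "\<lambda>x. f_agg c w n X x - f x"
      have "?u x = 0" if "x \<notin> dom_set c" for x
        using phi_supp[OF that] f_supp[OF that] by (simp add: f_agg_def f_hat_def)
      then have "indicator (dom_set c) x *\<^sub>R (?u x * ?u x) = (?u x)\<^sup>2" for x
        by (cases "x \<in> dom_set c") (auto simp: power2_eq_square)
      then have "inner_on (dom_set c) ?u ?u = (\<integral>x. (?u x)\<^sup>2 \<partial>lborel)"
        by (simp only: inner_on_def set_lebesgue_integral_def)
      then have "(norm_on (dom_set c) ?u)\<^sup>2 = (\<integral>x. (?u x)\<^sup>2 \<partial>lborel)"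
        by (simp add: norm_on_def)
      then show ?thesis by (simp add: f_agg_def f_hat_def ah)
    qed
    note wts = weights_free_energy[OF assms(4,3) n1 k0]
    have "risk c w n f \<le> ennreal (5 * L * real k0 powr - s + 3 * \<Delta> * v * sqrt (real k0) / real n
        + 16 * (C\<^sub>\<phi> + L + E * (real I + 1)) / real n + 2 * (ln (real (max_dim c n)) / real n))"
      unfolding risk_def nrm sample_law_eq v_def E_eq
      by (rule risk_le[where w="w n", OF n1 I k0 assms(2)]) (use wts in \<open>auto simp: pc\<close>)
    also have "\<dots> \<le> ennreal (K * real n powr (- 2 * s / (2 * s + 1)))"
      using le by (intro ennreal_leI) (simp add: D_eq)
    finally show ?thesis .
  qed
  then show ?thesis by (intro exI[of _ K]) (auto intro: SUP_least)
qed

end
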